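(* Let $\mathbb F\in\{\mathbb R,\mathbb C,\mathbb H\}$, $d:=\dim_{\mathbb R}\mathbb F$, and $k\ge2$. Let $\nu$ be a probability measure on $[0,\infty[$ with $\nu\ne\delta_0$ and compact support, and thus with finite moments $m_l:=\int_0^\infty x^l\,d\nu(x)\in]0,\infty[$ ($l\in\mathbb N$). Put $$M:=-\frac{\bigl(d(k+1)/2-1\bigr)\bigl(d(k+3)/2-2\bigr)\,m_4}{6dk\,(dk/2+1)}.$$ Then, as $n\to\infty$: (1) For $r\in]1/6,1/2[$, $$\frac{\mathrm{dist}(S_n^{(k,n^{-r})},eK)-\frac{(d(k+1)/2-1)\,m_2}{dk}\,n^{1-2r}}{n^{1/2-r}}$$ tends in distribution to $N\bigl(0,\frac{m_2}{dk}\bigr)$. (2) If $r=1/6$, then the random variables of part (1) (with $r=1/6$) tend in distribution to $N\bigl(M,\frac{m_2}{dk}\bigr)$. (3) If $r\in]0,1/6[$, then $$\frac{\mathrm{dist}(S_n^{(k,n^{-r})},eK)-\frac{(d(k+1)/2-1)\,m_2}{dk}\,n^{1-2r}}{n^{1-4r}}\longrightarrow M$$ in probability.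
   Context: Hyperbolic spaces. $H_k(\mathbb F)=G/K$ with $G=SO_o(1,k)$, $K=SO(k)$ for $\mathbb F=\mathbb R$; $G=SU(1,k)$, $K=S(U(1)\times U(k))$ for $\mathbb F=\mathbb C$; $G=Sp(1,k)$, $K=Sp(1)\times Sp(k)$ for $\mathbb F=\mathbb H$. For $t\ge 0$ let $$a_t=\begin{pmatrix}\cosh t&0&\sinh t\\0&I_{k-1}&0\\ \sinh t&0&\cosh t\end{pmatrix}\in G$$ (of size $(k+1)\times(k+1)$). Every double coset in $G//K$ equals $Ka_tK$ for a unique $t\in[0,\infty[$. The hyperbolic distance on $G/K$ is $\mathrm{dist}(xK,yK):=t$ where $Ky^{-1}xK=Ka_tK$. $G$ acts isometrically on $H_k(\mathbb F)$. Radial random walks. A radial random walk on $H_k(\mathbb F)$ is a time-homogeneous Markov chain $(S_n)_{n\ge0}$ on $H_k(\mathbb F)$ started at $eK$ whose transition kernel $K_k$ is $G$-invariant: $K_k(g(x),g(A))=K_k(x,A)$ for all $g\in G$, $x\in H_k(\mathbb F)$ and Borel sets $A\subset H_k(\mathbb F)$. The distribution on $[0,\infty[$ of $\mathrm{dist}(S_n,S_{n+1})$ does not depend on $n$, and each probability measure on $[0,\infty[$ determines a unique such kernel; the walk is called associated with this measure. Compression. For $c\in]0,1]$ let $D_c(x)=cx$ on $[0,\infty[$ and $\nu_c:=D_c(\nu)$ (image measure). $(S_n^{(k,c)})_{n\ge0}$ denotes the radial random walk on $H_k(\mathbb F)$ associated with $\nu_c$. Thus $S_n^{(k,n^{-r})}$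 is the $n$-th step of the walk associated with $\nu_{n^{-r}}$. $N(\mu,\sigma^2)$ is the normal distribution with mean $\mu$ and variance $\sigma^2$. *)

theory Defs
  imports
    "HOL-Probability.Probability"
    "HOL-Algebra.Left_Coset"
begin

section \<open>Quaternions\<close>

text \<open>\<open>Quat a b c e\<close> stands for \<open>a + b i + c j + e k\<close>.\<close>

datatype quat = Quat (qRe: real) (qI: real) (qJ: real) (qK: real)

lemma quat_eq_iff: "x = y \<longleftrightarrow> qRe x = qRe y \<and> qI x = qI y \<and> qJ x = qJ y \<and> qK x = qK y"
  by (cases x; cases y) auto

definition qcnj :: "quat \<Rightarrow> quat" where
  "qcnj x = Quat (qRe x) (- qI x) (- qJ x) (- qK x)"

instantiation quat :: real_algebra_1
begin

definition "0 = Quat 0 0 0 0"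
definition "1 = Quat 1 0 0 0"
definition "x + y = Quat (qRe x + qRe y) (qI x + qI y) (qJ x + qJ y) (qK x + qK y)"
definition "- x = Quat (- qRe x) (- qI x) (- qJ x) (- qK x)"
definition "x - y = Quat (qRe x - qRe y) (qI x - qI y) (qJ x - qJ y) (qK x - qK y)"
definition "x * y = Quat
  (qRe x * qRe y - qI x * qI y - qJ x * qJ y - qK x * qK y)
  (qRe x * qI y + qI x * qRe y + qJ x * qK y - qK x * qJ y)
  (qRe x * qJ y - qI x * qK y + qJ x * qRe y + qK x * qI y)
  (qRe x * qK y + qI x * qJ y - qJ x * qI y + qK x * qRe y)"
definition "r *\<^sub>R x = Quat (r * qRe x) (r * qI x) (r * qJ x) (r * qK x)"

lemma quat_sel [simp]:
  "qRe 0 = 0" "qI 0 = 0" "qJ 0 = 0" "qK 0 = 0"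
  "qRe 1 = 1" "qI 1 = 0" "qJ 1 = 0" "qK 1 = 0"
  "qRe (x + y) = qRe x + qRe y" "qI (x + y) = qI x + qI y"
  "qJ (x + y) = qJ x + qJ y" "qK (x + y) = qK x + qK y"
  "qRe (- x) = - qRe x" "qI (- x) = - qI x" "qJ (- x) = - qJ x" "qK (- x) = - qK x"
  "qRe (x - y) = qRe x - qRe y" "qI (x - y) = qI x - qI y"
  "qJ (x - y) = qJ x - qJ y" "qK (x - y) = qK x - qK y"
  "qRe (r *\<^sub>R x) = r * qRe x" "qI (r *\<^sub>R x) = r * qI x"
  "qJ (r *\<^sub>R x) = r * qJ x" "qK (r *\<^sub>R x) = r * qK x"
  "qRe (x * y) = qRe x * qRe y - qI x * qI y - qJ x * qJ y - qK x * qK y"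
  "qI (x * y) = qRe x * qI y + qI x * qRe y + qJ x * qK y - qK x * qJ y"
  "qJ (x * y) = qRe x * qJ y - qI x * qK y + qJ x * qRe y + qK x * qI y"
  "qK (x * y) = qRe x * qK y + qI x * qJ y - qJ x * qI y + qK x * qRe y"
  "qRe (qcnj x) = qRe x" "qI (qcnj x) = - qI x" "qJ (qcnj x) = - qJ x" "qK (qcnj x) = - qK x"
  by (simp_all add: zero_quat_def one_quat_def plus_quat_def uminus_quat_def minus_quat_def
      scaleR_quat_def times_quat_def qcnj_def)

instance
  by standard (simp_all add: quat_eq_iff algebra_simps)

end

instantiation quat :: real_normed_div_algebra
begin

definition norm_quat_def: "norm x = sqrt ((qRe x)\<^sup>2 + (qI x)\<^sup>2 + (qJ x)\<^sup>2 + (qK x)\<^sup>2)"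
definition "inverse x = qcnj x /\<^sub>R (norm x)\<^sup>2" for x :: quat
definition "x div y = x * inverse y" for x y :: quat
definition sgn_quat_def: "sgn x = x /\<^sub>R norm x" for x :: quat
definition dist_quat_def: "dist x y = norm (x - y)" for x y :: quat
definition uniformity_quat_def:
  "(uniformity :: (quat \<times> quat) filter) = (INF e\<in>{0<..}. principal {(x, y). dist x y < e})"
definition open_quat_def:
  "open U \<longleftrightarrow> (\<forall>x\<in>U. eventually (\<lambda>(x', y). x' = x \<longrightarrow> y \<in> U) uniformity)" for U :: "quat set"

lemma norm_quat_prod: "norm (x::quat) = norm ((qRe x, qI x), (qJ x, qK x))"
  by (simp add: norm_quat_def norm_Pair add.assoc)

lemma norm_quat_power2: "(norm (x::quat))\<^sup>2 = (qRe x)\<^sup>2 + (qI x)\<^sup>2 + (qJ x)\<^sup>2 + (qK x)\<^sup>2"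
  by (simp add: norm_quat_def)

lemma norm_quat_eq_0: "norm (x::quat) = 0 \<longleftrightarrow> x = 0"
  by (simp add: norm_quat_prod quat_eq_iff zero_prod_def)

instance
proof
  fix a b :: quat and r :: real and U :: "quat set"
  show "a div b = a * inverse b" by (simp add: divide_quat_def)
  show "inverse (0::quat) = 0" by (simp add: inverse_quat_def quat_eq_iff)
  show "dist a b = norm (a - b)" by (simp add: dist_quat_def)
  show "sgn a = a /\<^sub>R norm a" by (simp add: sgn_quat_def)
  show "(uniformity :: (quat \<times> quat) filter) = (INF e\<in>{0<..}. principal {(x, y). dist x y < e})"
    by (rule uniformity_quat_def)
  show "open U \<longleftrightarrow> (\<forall>x\<in>U. eventually (\<lambda>(x', y). x' = x \<longrightarrow> y \<in> U) uniformity)"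
    by (rule open_quat_def)
  show "norm a = 0 \<longleftrightarrow> a = 0" by (rule norm_quat_eq_0)
  show "norm (a + b) \<le> norm a + norm b"
    using norm_triangle_ineq[of "((qRe a, qI a), (qJ a, qK a))" "((qRe b, qI b), (qJ b, qK b))"]
    by (simp add: norm_quat_prod)
  show "norm (r *\<^sub>R a) = \<bar>r\<bar> * norm a"
    using norm_scaleR[of r "((qRe a, qI a), (qJ a, qK a))"] by (simp add: norm_quat_prod)
  show "norm (a * b) = norm a * norm b"
    unfolding norm_quat_def real_sqrt_mult [symmetric]
    by (rule arg_cong[where f = sqrt]) (simp add: power2_eq_square algebra_simps)
  have *: "a * qcnj a = (norm a)\<^sup>2 *\<^sub>R 1" "qcnj a * a = (norm a)\<^sup>2 *\<^sub>R 1"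
    unfolding norm_quat_power2 by (simp_all add: quat_eq_iff power2_eq_square algebra_simps)
  assume "a \<noteq> 0"
  then have "(norm a)\<^sup>2 \<noteq> 0" by (simp add: norm_quat_eq_0)
  then show "inverse a * a = 1" "a * inverse a = 1"
    by (simp_all add: inverse_quat_def *)
qed

end

section \<open>The groups and the hyperbolic spaces\<close>

text \<open>The three fields are the subalgebras \<open>\<real> \<subseteq> \<complex> = \<real> + \<real> i \<subseteq> \<H>\<close> of the quaternions, so that
  the three families of groups consist of quaternionic matrices.\<close>

datatype base_field = Real_Field | Complex_Field | Quaternion_Field

fun scalars :: "base_field \<Rightarrow> quat set" where
  "scalars Real_Field = {q. qI q = 0 \<and> qJ q = 0 \<and> qK q = 0}"
| "scalars Complex_Field = {q. qJ q = 0 \<and> qK q = 0}"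
| "scalars Quaternion_Field = UNIV"

text \<open>The rows and columns \<open>0, \<dots>, k\<close> of a matrix of size \<open>k + 1\<close> are indexed by a finite linearly
  ordered type with \<open>k + 1\<close> elements.\<close>

type_synonym 'n qmat = "((quat, 'n) vec, 'n) vec"

definition first_ix :: "'n::{finite,linorder}" where "first_ix = Min UNIV"
definition last_ix :: "'n::{finite,linorder}" where "last_ix = Max UNIV"

definition matrices_over :: "base_field \<Rightarrow> 'n::finite qmat set" where
  "matrices_over F = {A. \<forall>i j. A $ i $ j \<in> scalars F}"

definition conj_transpose :: "'n::finite qmat \<Rightarrow> 'n::finite qmat" where
  "conj_transpose A = (\<chi> i j. qcnj (A $ j $ i))"

text \<open>Determinant of a matrix with entries in \<open>\<real>\<close> or \<open>\<complex>\<close>; the \<open>j\<close> and \<open>k\<close> parts are dropped.\<close>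

definition det_complex :: "'n::finite qmat \<Rightarrow> complex" where
  "det_complex A = det (\<chi> i j. Complex (qRe (A $ i $ j)) (qI (A $ i $ j)))"

definition lorentz_form :: "'n::{finite,linorder} qmat" where
  "lorentz_form = (\<chi> i j. if i = j then (if i = first_ix then 1 else - 1) else 0)"

text \<open>\<open>O(1,k)\<close>, \<open>U(1,k)\<close> and \<open>Sp(1,k)\<close>, respectively.\<close>

definition indef_unitary :: "base_field \<Rightarrow> 'n::{finite,linorder} qmat set" where
  "indef_unitary F =
     {A \<in> matrices_over F. conj_transpose A ** lorentz_form ** A = lorentz_form}"

text \<open>\<open>SO\<^sub>o(1,k)\<close> is the identity component of \<open>SO(1,k)\<close>.\<close>

fun isom_matrices :: "base_field \<Rightarrow> 'n::{finite,linorder} qmat set" where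
  "isom_matrices Real_Field =
     connected_component_set {A \<in> indef_unitary Real_Field. det_complex A = 1} (mat 1)"
| "isom_matrices Complex_Field = {A \<in> indef_unitary Complex_Field. det_complex A = 1}"
| "isom_matrices Quaternion_Field = indef_unitary Quaternion_Field"

definition isom_group :: "base_field \<Rightarrow> 'n::{finite,linorder} qmat monoid" where
  "isom_group F = \<lparr>carrier = isom_matrices F, mult = (**), one = mat 1\<rparr>"

text \<open>Block diagonal unitary matrices over \<open>F\<close>, with blocks of sizes \<open>1\<close> and \<open>k\<close>.\<close>

definition block_unitary :: "base_field \<Rightarrow> 'n::{finite,linorder} qmat set" where
  "block_unitary F =
     {A \<in> matrices_over F. conj_transpose A ** A = mat 1 \<and>
        (\<forall>i. i \<noteq> first_ix \<longrightarrow> A $ first_ix $ i = 0 \<and> A $ i $ first_ix = 0)}"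

text \<open>\<open>SO(k)\<close> (embedded as the lower right block), \<open>S(U(1) \<times> U(k))\<close> and \<open>Sp(1) \<times> Sp(k)\<close>.\<close>

fun max_compact :: "base_field \<Rightarrow> 'n::{finite,linorder} qmat set" where
  "max_compact Real_Field =
     {A \<in> block_unitary Real_Field. A $ first_ix $ first_ix = 1 \<and> det_complex A = 1}"
| "max_compact Complex_Field = {A \<in> block_unitary Complex_Field. det_complex A = 1}"
| "max_compact Quaternion_Field = block_unitary Quaternion_Field"

definition hyp_translation :: "real \<Rightarrow> 'n::{finite,linorder} qmat" where
  "hyp_translation t = (\<chi> i j.
     if i = j then (if i = first_ix \<or> i = last_ix then of_real (cosh t) else 1)
     else if {i, j} = {first_ix, last_ix} then of_real (sinh t)
     else 0)"

definition hyp_space :: "base_field \<Rightarrow> 'n::{finite,linorder} qmat set set" where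
  "hyp_space F = lcosets\<^bsub>isom_group F\<^esub> (max_compact F)"

definition hyp_origin :: "base_field \<Rightarrow> 'n::{finite,linorder} qmat set" where
  "hyp_origin F = \<one>\<^bsub>isom_group F\<^esub> <#\<^bsub>isom_group F\<^esub> max_compact F"

text \<open>Borel sets of the quotient topology: a set of cosets is open iff its union is open in \<open>G\<close>.\<close>

definition hyp_borel :: "base_field \<Rightarrow> 'n::{finite,linorder} qmat set measure" where
  "hyp_borel F = sigma (hyp_space F)
     {U. U \<subseteq> hyp_space F \<and> openin (top_of_set (carrier (isom_group F))) (\<Union>U)}"

definition double_coset ::
  "base_field \<Rightarrow> 'n qmat \<Rightarrow> 'n::{finite,linorder} qmat set" where
  "double_coset F x =
     max_compact F <#>\<^bsub>isom_group F\<^esub> (x <#\<^bsub>isom_group F\<^esub> max_compact F)"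

definition hyp_dist ::
  "base_field \<Rightarrow> 'n qmat set \<Rightarrow> 'n::{finite,linorder} qmat set \<Rightarrow> real" where
  "hyp_dist F X Y = (THE t. 0 \<le> t \<and>
     (\<exists>x\<in>carrier (isom_group F). \<exists>y\<in>carrier (isom_group F).
        X = x <#\<^bsub>isom_group F\<^esub> max_compact F \<and> Y = y <#\<^bsub>isom_group F\<^esub> max_compact F \<and>
        double_coset F (inv\<^bsub>isom_group F\<^esub> y \<otimes>\<^bsub>isom_group F\<^esub> x)
          = double_coset F (hyp_translation t)))"

section \<open>Radial random walks\<close>

definition markov_chain ::
  "'w measure \<Rightarrow> 's measure \<Rightarrow> ('s \<Rightarrow> 's measure) \<Rightarrow> 's \<Rightarrow> (nat \<Rightarrow> 'w \<Rightarrow> 's) \<Rightarrow> bool" where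
  "markov_chain P E \<kappa> x0 S \<longleftrightarrow>
     prob_space P \<and> \<kappa> \<in> measurable E (prob_algebra E) \<and>
     (\<forall>n. S n \<in> measurable P E) \<and> (AE \<omega> in P. S 0 \<omega> = x0) \<and>
     (\<forall>n. \<forall>A\<in>sets E. AE \<omega> in P.
        real_cond_exp P
          (sigma (space P) (\<Union>i\<in>{..n}. {S i -` B \<inter> space P |B. B \<in> sets E}))
          (indicator (S (Suc n) -` A \<inter> space P)) \<omega>
        = measure (\<kappa> (S n \<omega>)) A)"

text \<open>\<open>g \<in> G\<close> acts on \<open>G/K\<close> by \<open>X \<mapsto> g X\<close>, and on subsets of \<open>G/K\<close> by taking images.\<close>

definition invariant_kernel ::
  "base_field \<Rightarrow>
    ('n::{finite,linorder} qmat set \<Rightarrow> 'n qmat set measure) \<Rightarrow> bool" where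
  "invariant_kernel F \<kappa> \<longleftrightarrow>
     (\<forall>g\<in>carrier (isom_group F). \<forall>X\<in>hyp_space F. \<forall>A\<in>sets (hyp_borel F).
        emeasure (\<kappa> (g <#\<^bsub>isom_group F\<^esub> X)) ((\<lambda>Y. g <#\<^bsub>isom_group F\<^esub> Y) ` A)
          = emeasure (\<kappa> X) A)"

definition radial_random_walk ::
  "base_field \<Rightarrow> 'w measure \<Rightarrow> (nat \<Rightarrow> 'w \<Rightarrow> 'n::{finite,linorder} qmat set) \<Rightarrow> bool" where
  "radial_random_walk F P S \<longleftrightarrow>
     (\<exists>\<kappa>. invariant_kernel F \<kappa> \<and> markov_chain P (hyp_borel F) \<kappa> (hyp_origin F) S)"

abbreviation borel_half_line :: "real measure" where
  "borel_half_line \<equiv> restrict_space borel {0..}"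

definition associated_with ::
  "base_field \<Rightarrow> 'w measure \<Rightarrow> (nat \<Rightarrow> 'w \<Rightarrow> 'n::{finite,linorder} qmat set) \<Rightarrow>
    real measure \<Rightarrow> bool" where
  "associated_with F P S \<nu> \<longleftrightarrow>
     (\<forall>n. distr P borel_half_line (\<lambda>\<omega>. hyp_dist F (S n \<omega>) (S (Suc n) \<omega>)) = \<nu>)"

definition compress :: "real \<Rightarrow> real measure \<Rightarrow> real measure" where
  "compress c \<nu> = distr \<nu> borel_half_line (\<lambda>x. c * x)"

definition measure_support :: "real measure \<Rightarrow> real set" where
  "measure_support \<nu> = {x \<in> space \<nu>. \<forall>U. open U \<longrightarrow> x \<in> U \<longrightarrow> 0 < emeasure \<nu> (U \<inter> space \<nu>)}"

definition moment :: "real measure \<Rightarrow> nat \<Rightarrow> real" where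
  "moment \<nu> l = (\<integral>x. x ^ l \<partial>\<nu>)"

definition normal_distribution :: "real \<Rightarrow> real \<Rightarrow> real measure" where
  "normal_distribution \<mu> v = density lborel (normal_density \<mu> (sqrt v))"

end

theory Submission
  imports Defs "HOL-Real_Asymp.Real_Asymp"
begin

text \<open>
  The idea is to replace the distance to the origin by a Busemann function, along which the random
  walk becomes a sum of independent identically distributed real random variables.

  Let \<open>x\<close> be the first column of a representative of a point of \<open>G/K\<close>. The distance \<open>t\<close> of the point
  to the origin is given by \<open>cosh t = |x\<^sub>0|\<close> (\<open>hyp_dist_coset\<close>, from the decomposition
  \<open>G = K A K\<close>), and its Busemann function for one fixed boundary point is \<open>log |x\<^sub>0 + x\<^sub>k|\<close>. The latter
  is the logarithm of the pairing with a null vector. Every element of \<open>G\<close> maps this null vector to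
  another one, and a suitable element of \<open>K\<close> makes the image proportional to the original one. Since
  the transition kernel is \<open>G\<close>-invariant, the law of an increment of the Busemann function therefore
  does not depend on the current position (\<open>busemann_cocycle\<close>, \<open>kernel_busemann\<close>), and its
  characteristic function after \<open>n\<close> steps is the \<open>n\<close>-th power of the one after the first step
  (\<open>char_busemann_law\<close>).

  Distance and Busemann function differ by at most \<open>log 2 - log |1 + \<zeta>|\<close>, where \<open>\<zeta> = x\<^sub>k x\<^sub>0\<^sup>-\<^sup>1\<close> is a
  coordinate in the ball model. The law of the walk at any time is \<open>K\<close>-invariant, and \<open>K\<close> contains
  rotations that carry a small neighbourhood of a boundary point to many disjoint copies. Hence \<open>\<zeta>\<close> is
  close to \<open>-1\<close> with small probability only (\<open>boundary_mass\<close>), the difference is bounded in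
  probability uniformly in \<open>n\<close> (\<open>dist_minus_busemann_tight\<close>), and it disappears after division by a
  positive power of \<open>n\<close>.

  It remains to find mean and variance of one step of length \<open>h\<close>. The Busemann function is
  \<open>log |1 + \<zeta>| + log cosh h\<close>, and the moments of \<open>\<zeta>\<close> up to order four follow from the invariance
  under plane rotations and under multiplication by units of \<open>F\<close>: they are powers of the radius
  \<open>tanh h\<close> times the moments of the uniform distribution on a sphere of dimension \<open>dk - 1\<close>. A Taylor expansion to order four
  (\<open>busemann_step_moments\<close>) gives the mean \<open>A h\<^sup>2 + B h\<^sup>4 + O(h\<^sup>5)\<close> and the second moment
  \<open>h\<^sup>2 / (dk) + O(h\<^sup>3)\<close>, where \<open>A m\<^sub>2 n\<^bsup>1-2r\<^esup>\<close> is the centring and \<open>M = B m\<^sub>4\<close>. For steps of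
  size \<open>n\<^bsup>-r\<^esup>\<close>, the sum of \<open>n\<close> increments minus its centring thus has mean about \<open>M n\<^bsup>1-4r\<^esup>\<close> and
  standard deviation of order \<open>n\<^bsup>1/2-r\<^esup>\<close>. These are balanced at \<open>r = 1/6\<close>, which separates the
  three regimes. The limits follow from Levy's continuity theorem, in the third regime with a point
  mass as limit.
\<close>

section \<open>The quaternions as a Euclidean space\<close>

lemma qcnj_simps [simp]:
  "qcnj 0 = 0" "qcnj 1 = 1" "qcnj (qcnj x) = x" "qcnj (x + y) = qcnj x + qcnj y"
  "qcnj (- x) = - qcnj x" "qcnj (x - y) = qcnj x - qcnj y" "qcnj (x * y) = qcnj y * qcnj x"
  "qcnj (r *\<^sub>R x) = r *\<^sub>R qcnj x"
  by (simp_all add: quat_eq_iff algebra_simps)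

lemma quat_of_real_sel [simp]:
  "qRe (of_real r) = r" "qI (of_real r) = 0" "qJ (of_real r) = 0" "qK (of_real r) = 0"
  by (simp_all add: of_real_def)

lemma qcnj_of_real [simp]: "qcnj (of_real r) = of_real r"
  by (simp add: quat_eq_iff)

lemma qcnj_sum: "qcnj (sum f A) = (\<Sum>i\<in>A. qcnj (f i))"
  by (induction A rule: infinite_finite_induct) simp_all

lemma qRe_sum: "qRe (sum f A) = (\<Sum>i\<in>A. qRe (f i))"
  by (induction A rule: infinite_finite_induct) simp_all

lemma norm_qcnj [simp]: "norm (qcnj x) = norm x"
  by (simp add: norm_quat_def)

lemma quat_mult_cnj: "x * qcnj x = of_real ((norm x)\<^sup>2)" "qcnj x * x = of_real ((norm x)\<^sup>2)"
  unfolding norm_quat_power2 by (simp_all add: quat_eq_iff power2_eq_square algebra_simps)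

lemma qRe_commute: "qRe (x * y) = qRe (y * x)"
  by simp

lemma of_real_quat_commute: "of_real r * (x :: quat) = x * of_real r"
  by (simp add: quat_eq_iff)

lemma abs_qRe_le_norm: "\<bar>qRe x\<bar> \<le> norm x"
  unfolding norm_quat_def by (rule real_le_rsqrt) simp

lemma quat_inverse_eq: "inverse x = qcnj x /\<^sub>R (norm x)\<^sup>2" for x :: quat
  by (simp add: inverse_quat_def)

text \<open>The inner product makes linear algebra over the reals available for quaternionic vectors.\<close>

instantiation quat :: euclidean_space
begin

definition inner_quat_def:
  "inner x y = qRe x * qRe y + qI x * qI y + qJ x * qJ y + qK x * qK y" for x y :: quat
definition Basis_quat_def: "Basis = {Quat 1 0 0 0, Quat 0 1 0 0, Quat 0 0 1 0, Quat 0 0 0 1}"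

instance
proof
  fix x y z :: quat and r :: real
  show "inner x y = inner y x" by (simp add: inner_quat_def)
  show "inner (x + y) z = inner x z + inner y z" by (simp add: inner_quat_def algebra_simps)
  show "inner (r *\<^sub>R x) y = r * inner x y" by (simp add: inner_quat_def algebra_simps)
  show "0 \<le> inner x x" by (simp add: inner_quat_def)
  have "inner x x = (norm x)\<^sup>2" by (simp only: inner_quat_def norm_quat_power2) (simp add: power2_eq_square)
  then show "inner x x = 0 \<longleftrightarrow> x = 0" "norm x = sqrt (inner x x)"
    by simp_all
  show "(Basis :: quat set) \<noteq> {}" "finite (Basis :: quat set)" by (simp_all add: Basis_quat_def)
  show "(\<forall>u\<in>Basis. inner x u = 0) \<longleftrightarrow> x = 0"
    unfolding Basis_quat_def inner_quat_def quat_eq_iff[of x 0] by simp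
next
  fix u v :: quat assume "u \<in> Basis" "v \<in> Basis"
  then show "inner u v = (if u = v then 1 else 0)"
    unfolding Basis_quat_def by (elim insertE) (simp_all add: inner_quat_def)
qed

end

lemma bounded_linear_quat_coordinates:
  "bounded_linear qRe" "bounded_linear qI" "bounded_linear qJ" "bounded_linear qK"
  "bounded_linear qcnj"
proof -
  have "\<bar>qRe x\<bar> \<le> norm x * 1" "\<bar>qI x\<bar> \<le> norm x * 1" "\<bar>qJ x\<bar> \<le> norm x * 1"
    "\<bar>qK x\<bar> \<le> norm x * 1" for x
    by (simp_all add: norm_quat_def real_le_rsqrt)
  then show "bounded_linear qRe" "bounded_linear qI" "bounded_linear qJ" "bounded_linear qK"
    by (auto intro!: bounded_linear_intro[where K = 1])
  show "bounded_linear qcnj"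
    by (rule bounded_linear_intro[where K = 1]) simp_all
qed

lemmas continuous_on_quat_coordinates [continuous_intros] =
  bounded_linear_quat_coordinates[THEN bounded_linear.continuous_on]

lemma borel_measurable_quat_coordinates [measurable (raw)]:
  assumes "f \<in> borel_measurable M"
  shows "(\<lambda>x. qRe (f x)) \<in> borel_measurable M" "(\<lambda>x. qI (f x)) \<in> borel_measurable M"
    "(\<lambda>x. qJ (f x)) \<in> borel_measurable M" "(\<lambda>x. qK (f x)) \<in> borel_measurable M"
    "(\<lambda>x. qcnj (f x)) \<in> borel_measurable M"
  by (auto intro!: measurable_compose[OF assms] borel_measurable_continuous_onI continuous_intros)

lemma scalars_closed [simp]:
  "0 \<in> scalars F" "1 \<in> scalars F" "of_real r \<in> scalars F"
  "x \<in> scalars F \<Longrightarrow> y \<in> scalars F \<Longrightarrow> x + y \<in> scalars F"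
  "x \<in> scalars F \<Longrightarrow> y \<in> scalars F \<Longrightarrow> x - y \<in> scalars F"
  "x \<in> scalars F \<Longrightarrow> y \<in> scalars F \<Longrightarrow> x * y \<in> scalars F"
  "x \<in> scalars F \<Longrightarrow> - x \<in> scalars F"
  "x \<in> scalars F \<Longrightarrow> qcnj x \<in> scalars F"
  "x \<in> scalars F \<Longrightarrow> r *\<^sub>R x \<in> scalars F"
  "x \<in> scalars F \<Longrightarrow> inverse x \<in> scalars F"
  by (cases F; auto simp: quat_inverse_eq)+

lemma scalars_sum: "(\<And>i. i \<in> A \<Longrightarrow> f i \<in> scalars F) \<Longrightarrow> sum f A \<in> scalars F"
  by (induction A rule: infinite_finite_induct) simp_all

lemma scalars_commute:
  "F \<noteq> Quaternion_Field \<Longrightarrow> x \<in> scalars F \<Longrightarrow> y \<in> scalars F \<Longrightarrow> x * y = y * x"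
  by (cases F) (auto simp: quat_eq_iff)

lemma dim_scalars:
  "dim (scalars Real_Field) = 1" "dim (scalars Complex_Field) = 2" "dim (scalars Quaternion_Field) = 4"
proof -
  have "dim (scalars F) = card B"
    if "B \<subseteq> Basis" "\<And>x. x \<in> scalars F \<longleftrightarrow> (\<forall>b\<in>Basis - B. inner x b = 0)" for F B
  proof (rule dim_unique)
    show "independent B" using that(1) independent_Basis independent_mono by blast
    show "B \<subseteq> scalars F"
      using that(1) by (force simp: that(2) inner_Basis)
    show "scalars F \<subseteq> span B"
    proof
      fix x assume x: "x \<in> scalars F"
      have "x = (\<Sum>b\<in>Basis. inner x b *\<^sub>R b)" by (simp add: euclidean_representation)
      also have "\<dots> = (\<Sum>b\<in>B. inner x b *\<^sub>R b)"
        using that x by (intro sum.mono_neutral_right) auto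
      finally show "x \<in> span B" by (metis (no_types, lifting) span_base span_scale span_sum)
    qed
  qed simp
  note * = this
  show "dim (scalars Real_Field) = 1"
    by (subst *[of "{Quat 1 0 0 0}"]) (auto simp: Basis_quat_def inner_quat_def)
  show "dim (scalars Complex_Field) = 2"
    by (subst *[of "{Quat 1 0 0 0, Quat 0 1 0 0}"]) (auto simp: Basis_quat_def inner_quat_def)
  show "dim (scalars Quaternion_Field) = 4"
    by (subst *[of Basis]) (auto simp: Basis_quat_def)
qed

section \<open>Quaternionic matrices\<close>

lemma matrix_mult_nth: "(A ** B) $ i $ j = (\<Sum>l\<in>UNIV. A $ i $ l * B $ l $ j)"
  by (simp add: matrix_matrix_mult_def)

lemma conj_transpose_nth [simp]: "conj_transpose A $ i $ j = qcnj (A $ j $ i)"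
  by (simp add: conj_transpose_def)

lemma conj_transpose_simps [simp]:
  "conj_transpose (conj_transpose A) = A" "conj_transpose (mat 1) = mat 1"
  "conj_transpose lorentz_form = lorentz_form"
  by (simp_all add: vec_eq_iff mat_def lorentz_form_def)

lemma conj_transpose_mult: "conj_transpose (A ** B) = conj_transpose B ** conj_transpose A"
  by (simp add: vec_eq_iff matrix_mult_nth qcnj_sum)

lemma lorentz_form_mult_nth:
  "(lorentz_form ** A) $ i $ j = (if i = first_ix then A $ i $ j else - (A $ i $ j))"
  "(A ** lorentz_form) $ i $ j = (if j = first_ix then A $ i $ j else - (A $ i $ j))"
proof -
  have "(\<Sum>l\<in>UNIV. lorentz_form $ i $ l * A $ l $ j)
      = (\<Sum>l\<in>UNIV. if l = i then (if i = first_ix then A $ i $ j else - (A $ i $ j)) else 0)"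
    by (intro sum.cong) (auto simp: lorentz_form_def)
  then show "(lorentz_form ** A) $ i $ j = (if i = first_ix then A $ i $ j else - (A $ i $ j))"
    by (simp add: matrix_mult_nth)
  have "(\<Sum>l\<in>UNIV. A $ i $ l * lorentz_form $ l $ j)
      = (\<Sum>l\<in>UNIV. if l = j then (if j = first_ix then A $ i $ j else - (A $ i $ j)) else 0)"
    by (intro sum.cong) (auto simp: lorentz_form_def)
  then show "(A ** lorentz_form) $ i $ j = (if j = first_ix then A $ i $ j else - (A $ i $ j))"
    by (simp add: matrix_mult_nth)
qed

lemma lorentz_form_square: "lorentz_form ** lorentz_form = mat 1"
proof -
  have "(lorentz_form ** lorentz_form) $ i $ j = (mat 1 :: 'a qmat) $ i $ j" for i j
    unfolding lorentz_form_mult_nth(1) by (simp add: lorentz_form_def mat_def)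
  then show ?thesis by (simp add: vec_eq_iff)
qed

text \<open>Over the noncommutative quaternions this uses that a matrix acts on the finite-dimensional
  real vector space of columns, where injective maps are surjective.\<close>

lemma quat_matrix_left_inverse_right:
  fixes A B :: "'n::finite qmat"
  assumes "A ** B = mat 1"
  shows "B ** A = mat 1"
proof -
  have lin: "linear ((*v) C)" for C :: "'n qmat"
    by (rule linearI)
      (simp_all add: vec_eq_iff matrix_vector_mult_def distrib_left sum.distrib scaleR_sum_right)
  have "inj ((*v) B)"
    by (metis assms injI matrix_vector_mul_assoc matrix_vector_mul_lid)
  then have "surj ((*v) B)" using linear_injective_imp_surjective[OF lin] by blast
  then have "(B ** A) *v y = y" for y
    by (metis assms matrix_vector_mul_assoc matrix_vector_mul_lid surjD)
  then show ?thesis by (simp add: matrix_eq)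
qed

lemma matrices_over_mult:
  "A \<in> matrices_over F \<Longrightarrow> B \<in> matrices_over F \<Longrightarrow> A ** B \<in> matrices_over F"
  by (auto simp: matrices_over_def matrix_mult_nth intro!: scalars_sum)

lemma matrices_over_simps [simp]:
  "mat 1 \<in> matrices_over F" "lorentz_form \<in> matrices_over F"
  "conj_transpose A \<in> matrices_over F \<longleftrightarrow> A \<in> matrices_over F"
  by (auto simp: matrices_over_def mat_def lorentz_form_def) (metis qcnj_simps(3) scalars_closed(8))

lemma det_complex_mult:
  assumes "F \<noteq> Quaternion_Field" "A \<in> matrices_over F" "B \<in> matrices_over F"
  shows "det_complex (A ** B) = det_complex A * det_complex B"
proof -
  have "qJ x = 0 \<and> qK x = 0" if "x \<in> scalars F" for x using that assms(1) by (cases F) auto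
  then have *: "qJ (A $ i $ j) = 0" "qK (A $ i $ j) = 0" "qJ (B $ i $ j) = 0" "qK (B $ i $ j) = 0" for i j
    using assms(2,3) by (auto simp: matrices_over_def)
  have sum: "Complex (qRe (sum f S)) (qI (sum f S)) = (\<Sum>i\<in>S. Complex (qRe (f i)) (qI (f i)))" for f :: "'b \<Rightarrow> quat" and S
    by (induction S rule: infinite_finite_induct) (simp_all add: complex_eq_iff)
  show ?thesis
    unfolding det_complex_def det_mul[symmetric]
    by (rule arg_cong[where f = det])
      (simp add: vec_eq_iff matrix_mult_nth sum complex_eq_iff * cong: sum.cong)
qed

lemma det_complex_mat_1 [simp]: "det_complex (mat 1 :: 'n::finite qmat) = 1"
proof -
  have "(\<chi> i j. Complex (qRe (mat 1 $ i $ j)) (qI (mat 1 $ i $ j))) = (mat 1 :: complex^'n^'n)"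
    by (simp add: vec_eq_iff mat_def complex_eq_iff)
  then show ?thesis by (simp add: det_complex_def)
qed

definition special_over :: "base_field \<Rightarrow> 'n::{finite,linorder} qmat \<Rightarrow> bool" where
  "special_over F A \<longleftrightarrow> F \<noteq> Quaternion_Field \<longrightarrow> det_complex A = 1"

text \<open>\<open>SO(1,k)\<close>, \<open>SU(1,k)\<close> and \<open>Sp(1,k)\<close>; only the first of them is disconnected.\<close>

definition special_indef_unitary :: "base_field \<Rightarrow> 'n::{finite,linorder} qmat set" where
  "special_indef_unitary F = {A \<in> indef_unitary F. special_over F A}"

lemma indef_unitary_inverse:
  assumes "A \<in> indef_unitary F"
  defines "B \<equiv> lorentz_form ** conj_transpose A ** lorentz_form"
  shows "B ** A = mat 1" "A ** B = mat 1" "A ** lorentz_form ** conj_transpose A = lorentz_form"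
    "B \<in> indef_unitary F"
proof -
  have *: "conj_transpose A ** lorentz_form ** A = lorentz_form" "A \<in> matrices_over F"
    using assms by (auto simp: indef_unitary_def)
  show "B ** A = mat 1"
    unfolding B_def by (metis "*"(1) lorentz_form_square matrix_mul_assoc)
  then show AB: "A ** B = mat 1" by (rule quat_matrix_left_inverse_right)
  then show **: "A ** lorentz_form ** conj_transpose A = lorentz_form"
    unfolding B_def by (metis lorentz_form_square matrix_mul_assoc matrix_mul_lid matrix_mul_rid)
  have "conj_transpose B ** lorentz_form ** B = lorentz_form ** (A ** lorentz_form ** conj_transpose A) ** lorentz_form"
    by (simp add: B_def conj_transpose_mult matrix_mul_assoc lorentz_form_square)
       (metis lorentz_form_square matrix_mul_assoc matrix_mul_rid)
  also have "\<dots> = lorentz_form"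
    by (simp add: ** lorentz_form_square)
  finally show "B \<in> indef_unitary F"
    using *(2) by (simp add: indef_unitary_def B_def matrices_over_mult)
qed

lemma indef_unitary_mult:
  assumes "A \<in> indef_unitary F" "B \<in> indef_unitary F"
  shows "A ** B \<in> indef_unitary F"
  using assms unfolding indef_unitary_def
  by (simp add: conj_transpose_mult matrices_over_mult) (metis matrix_mul_assoc)

lemma special_indef_unitary_mult:
  assumes "A \<in> special_indef_unitary F" "B \<in> special_indef_unitary F"
  shows "A ** B \<in> special_indef_unitary F"
  using assms det_complex_mult[of F A B] indef_unitary_mult[of A F B]
  by (auto simp: special_indef_unitary_def special_over_def indef_unitary_def)

lemma special_indef_unitary_inverse:
  assumes "A \<in> special_indef_unitary F"
  shows "lorentz_form ** conj_transpose A ** lorentz_form \<in> special_indef_unitary F"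
proof -
  let ?B = "lorentz_form ** conj_transpose A ** lorentz_form"
  have A: "A \<in> indef_unitary F" "special_over F A" using assms by (auto simp: special_indef_unitary_def)
  have "special_over F ?B"
    unfolding special_over_def
  proof
    assume F: "F \<noteq> Quaternion_Field"
    have "det_complex (?B ** A) = 1" using indef_unitary_inverse(1)[OF A(1)] by simp
    then show "det_complex ?B = 1"
      using A det_complex_mult[OF F, of ?B A] indef_unitary_inverse(4)[OF A(1)] F
      by (simp add: special_over_def indef_unitary_def)
  qed
  then show ?thesis using indef_unitary_inverse(4)[OF A(1)] by (simp add: special_indef_unitary_def)
qed

lemma special_indef_unitary_mat_1: "mat 1 \<in> special_indef_unitary F"
  by (simp add: special_indef_unitary_def special_over_def indef_unitary_def)

lemma continuous_on_matrix_mult [continuous_intros]: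
  fixes f g :: "'a::topological_space \<Rightarrow> 'n::finite qmat"
  assumes "continuous_on S f" "continuous_on S g"
  shows "continuous_on S (\<lambda>x. f x ** g x)"
  unfolding matrix_matrix_mult_def
  by (intro continuous_on_vec_lambda continuous_intros assms)

lemma continuous_on_conj_transpose [continuous_intros]:
  fixes f :: "'a::topological_space \<Rightarrow> 'n::finite qmat"
  assumes "continuous_on S f"
  shows "continuous_on S (\<lambda>x. conj_transpose (f x))"
  unfolding conj_transpose_def
  by (intro continuous_on_vec_lambda continuous_intros assms)

lemma isom_matrices_subset: "isom_matrices F \<subseteq> special_indef_unitary F"
proof (cases F)
  case Real_Field
  then show ?thesis
    using connected_component_subset
    by (fastforce simp: special_indef_unitary_def special_over_def)
qed (auto simp: special_indef_unitary_def special_over_def)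

lemma isom_matrices_eq:
  "isom_matrices F = (if F = Real_Field then connected_component_set (special_indef_unitary F) (mat 1)
     else special_indef_unitary F)"
  by (cases F) (auto simp: special_indef_unitary_def special_over_def)

lemma isom_matrices_connected:
  assumes "connected C" "C \<subseteq> special_indef_unitary Real_Field" "A \<in> C" "A \<in> isom_matrices Real_Field"
  shows "C \<subseteq> isom_matrices Real_Field"
proof
  fix x assume "x \<in> C"
  then have "connected_component (special_indef_unitary Real_Field) A x"
    using assms unfolding connected_component_def by blast
  moreover have "connected_component (special_indef_unitary Real_Field) (mat 1) A"
    using assms(4) by (simp add: isom_matrices_eq)
  ultimately show "x \<in> isom_matrices Real_Field"
    using connected_component_trans by (simp add: isom_matrices_eq) blast
qed

lemma mat_1_in_isom_matrices: "mat 1 \<in> isom_matrices F"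
  by (simp add: isom_matrices_eq special_indef_unitary_mat_1)

lemma isom_matrices_mult:
  assumes "A \<in> isom_matrices F" "B \<in> isom_matrices F"
  shows "A ** B \<in> isom_matrices F"
proof (cases "F = Real_Field")
  case True
  have "connected ((\<lambda>B. A ** B) ` isom_matrices Real_Field)"
    by (intro connected_continuous_image continuous_intros) (simp add: isom_matrices_eq)
  moreover have "(\<lambda>B. A ** B) ` isom_matrices Real_Field \<subseteq> special_indef_unitary Real_Field"
    using assms isom_matrices_subset special_indef_unitary_mult True by fast
  ultimately have "(\<lambda>B. A ** B) ` isom_matrices Real_Field \<subseteq> isom_matrices Real_Field"
    by (rule isom_matrices_connected[where A = A])
      (use assms True mat_1_in_isom_matrices[of Real_Field] in \<open>auto simp: image_iff intro!: bexI[of _ "mat 1"] simp del: isom_matrices.simps\<close>)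
  then show ?thesis using assms True by blast
next
  case False
  then show ?thesis using assms special_indef_unitary_mult by (simp add: isom_matrices_eq)
qed

lemma isom_matrices_inverse:
  assumes "A \<in> isom_matrices F"
  shows "lorentz_form ** conj_transpose A ** lorentz_form \<in> isom_matrices F"
proof (cases "F = Real_Field")
  case True
  let ?i = "\<lambda>A :: 'a qmat. lorentz_form ** conj_transpose A ** lorentz_form"
  have "connected (?i ` isom_matrices Real_Field)"
    by (intro connected_continuous_image continuous_intros) (simp add: isom_matrices_eq)
  moreover have "?i ` isom_matrices Real_Field \<subseteq> special_indef_unitary Real_Field"
    using isom_matrices_subset special_indef_unitary_inverse True by fast
  ultimately have "?i ` isom_matrices Real_Field \<subseteq> isom_matrices Real_Field"
    by (rule isom_matrices_connected[where A = "mat 1"])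
      (use mat_1_in_isom_matrices[of Real_Field] in \<open>auto simp: image_iff lorentz_form_square intro!: bexI[of _ "mat 1"] simp del: isom_matrices.simps\<close>)
  then show ?thesis using assms True by blast
next
  case False
  then show ?thesis using assms special_indef_unitary_inverse by (simp add: isom_matrices_eq)
qed

lemma isom_group_simps [simp]:
  "carrier (isom_group F) = isom_matrices F" "mult (isom_group F) = (**)" "one (isom_group F) = mat 1"
  by (simp_all add: isom_group_def)

lemma group_isom_group: "group (isom_group F)"
proof (rule groupI)
  fix A :: "'a qmat" assume A: "A \<in> carrier (isom_group F)"
  then have "A \<in> indef_unitary F" using isom_matrices_subset by (auto simp: special_indef_unitary_def)
  then show "\<exists>B\<in>carrier (isom_group F). B \<otimes>\<^bsub>isom_group F\<^esub> A = \<one>\<^bsub>isom_group F\<^esub>"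
    using A isom_matrices_inverse[of A F] indef_unitary_inverse(1) by auto
qed (auto simp: isom_matrices_mult mat_1_in_isom_matrices matrix_mul_assoc)

lemma isom_group_inv:
  assumes "A \<in> isom_matrices F"
  shows "inv\<^bsub>isom_group F\<^esub> A = lorentz_form ** conj_transpose A ** lorentz_form"
proof -
  interpret group "isom_group F" by (rule group_isom_group)
  have "A \<in> indef_unitary F" using assms isom_matrices_subset by (auto simp: special_indef_unitary_def)
  then show ?thesis
    using inv_equality[of "lorentz_form ** conj_transpose A ** lorentz_form" A] assms
      isom_matrices_inverse[of A F] indef_unitary_inverse(1)[of A F]
    by simp
qed

section \<open>Rotations in coordinate planes\<close>

definition plane_block :: "'n \<Rightarrow> 'n \<Rightarrow> quat \<Rightarrow> quat \<Rightarrow> quat \<Rightarrow> quat \<Rightarrow> 'n::finite qmat" where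
  "plane_block i j a b c e = (\<chi> r s.
     if r = i then (if s = i then a else if s = j then b else 0)
     else if r = j then (if s = i then c else if s = j then e else 0)
     else if r = s then 1 else 0)"

lemma sum_two_indices:
  fixes f :: "'n::finite \<Rightarrow> 'a::comm_monoid_add"
  assumes "i \<noteq> j" "\<And>s. s \<noteq> i \<Longrightarrow> s \<noteq> j \<Longrightarrow> f s = 0"
  shows "(\<Sum>s\<in>UNIV. f s) = f i + f j"
proof -
  have "(\<Sum>s\<in>UNIV. f s) = (\<Sum>s\<in>{i, j}. f s)"
    using assms by (intro sum.mono_neutral_right) auto
  then show ?thesis using assms by simp
qed

lemma sum_one_index:
  fixes f :: "'n::finite \<Rightarrow> 'a::comm_monoid_add"
  assumes "\<And>s. s \<noteq> i \<Longrightarrow> f s = 0"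
  shows "(\<Sum>s\<in>UNIV. f s) = f i"
proof -
  have "(\<Sum>s\<in>UNIV. f s) = (\<Sum>s\<in>{i}. f s)"
    using assms by (intro sum.mono_neutral_right) auto
  then show ?thesis by simp
qed

lemma plane_block_mult_nth:
  assumes "i \<noteq> j"
  shows "(plane_block i j a b c e ** A) $ r $ s =
    (if r = i then a * A $ i $ s + b * A $ j $ s else if r = j then c * A $ i $ s + e * A $ j $ s
     else A $ r $ s)"
proof -
  consider "r = i" | "r = j" | "r \<noteq> i" "r \<noteq> j" by blast
  then show ?thesis
  proof cases
    case 1
    then show ?thesis
      unfolding matrix_mult_nth by (subst sum_two_indices[OF assms]) (auto simp: plane_block_def assms[symmetric])
  next
    case 2
    then show ?thesis
      unfolding matrix_mult_nth
      by (subst sum_two_indices[OF assms]) (use assms in \<open>auto simp: plane_block_def\<close>)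
  next
    case 3
    then show ?thesis
      unfolding matrix_mult_nth
      by (subst sum_one_index[of r]) (auto simp: plane_block_def)
  qed
qed

lemma plane_block_vec_nth:
  assumes "i \<noteq> j"
  shows "(plane_block i j a b c e *v v) $ r =
    (if r = i then a * v $ i + b * v $ j else if r = j then c * v $ i + e * v $ j else v $ r)"
  using plane_block_mult_nth[OF assms, of a b c e "\<chi> r s. v $ r" r i]
  by (simp add: matrix_mult_nth matrix_vector_mult_def)

lemma conj_transpose_plane_block:
  "i \<noteq> j \<Longrightarrow> conj_transpose (plane_block i j a b c e)
    = plane_block i j (qcnj a) (qcnj c) (qcnj b) (qcnj e)"
  by (auto simp: vec_eq_iff plane_block_def)

lemma plane_block_mult:
  "i \<noteq> j \<Longrightarrow> plane_block i j a b c e ** plane_block i j a' b' c' e'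
    = plane_block i j (a * a' + b * c') (a * b' + b * e') (c * a' + e * c') (c * b' + e * e')"
  unfolding vec_eq_iff plane_block_mult_nth by (auto simp: plane_block_def)

lemma plane_block_id: "plane_block i j 1 0 0 1 = mat 1"
  by (auto simp: vec_eq_iff plane_block_def mat_def)

text \<open>In the Leibniz formula only the identity and the transposition of \<open>i\<close> and \<open>j\<close> contribute.\<close>

lemma det_complex_plane_block:
  fixes i j :: "'n::finite"
  assumes "i \<noteq> j"
  shows "det_complex (plane_block i j a b c e)
    = Complex (qRe a) (qI a) * Complex (qRe e) (qI e) - Complex (qRe b) (qI b) * Complex (qRe c) (qI c)"
proof -
  define z where "z r s = Complex (qRe (plane_block i j a b c e $ r $ s)) (qI (plane_block i j a b c e $ r $ s))"
    for r s :: 'n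
  have z0: "z r s = 0" if "r \<notin> {i, j}" "r \<noteq> s" for r s
    using that by (simp add: z_def plane_block_def complex_eq_iff)
  have z1: "z r r = 1" if "r \<notin> {i, j}" for r
    using that by (simp add: z_def plane_block_def complex_eq_iff)
  let ?P = "{p. p permutes (UNIV :: 'n set)}"
  let ?f = "\<lambda>p. of_int (sign p) * (\<Prod>r\<in>UNIV. z r (p r))"
  have tr: "Transposition.transpose i j \<in> ?P" "id \<in> ?P" "Transposition.transpose i j \<noteq> id"
    using assms by (auto simp: permutes_swap_id permutes_id) (metis id_apply transpose_apply_first)
  have "det_complex (plane_block i j a b c e) = sum ?f ?P"
    by (simp add: det_complex_def det_def z_def)
  also have "\<dots> = sum ?f {id, Transposition.transpose i j}"
  proof (rule sum.mono_neutral_right)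
    show "finite ?P" by (simp add: finite_permutations)
    show "\<forall>p\<in>?P - {id, Transposition.transpose i j}. ?f p = 0"
    proof
      fix p assume p: "p \<in> ?P - {id, Transposition.transpose i j}"
      have "\<exists>r. r \<notin> {i, j} \<and> p r \<noteq> r"
      proof (rule ccontr)
        assume *: "\<not> ?thesis"
        have "p permutes {i, j}"
          using p * by (auto simp: permutes_def)
        then show False using p by (simp add: permutes_doubleton_iff)
      qed
      then obtain r where "r \<notin> {i, j}" "p r \<noteq> r" by blast
      then have "z r (p r) = 0" using z0 by metis
      then have "(\<Prod>r\<in>UNIV. z r (p r)) = 0" by (intro prod_zero) auto
      then show "?f p = 0" by simp
    qed
  qed (use tr in auto)
  also have "\<dots> = (\<Prod>r\<in>UNIV. z r r) - (\<Prod>r\<in>UNIV. z r (Transposition.transpose i j r))"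
    using tr(3) assms by (simp add: sign_swap_id sign_id)
  also have "(\<Prod>r\<in>UNIV. z r r) = (\<Prod>r\<in>{i, j}. z r r)"
    by (rule prod.mono_neutral_right) (auto simp: z1)
  also have "(\<Prod>r\<in>UNIV. z r (Transposition.transpose i j r)) = (\<Prod>r\<in>{i, j}. z r (Transposition.transpose i j r))"
    by (rule prod.mono_neutral_right) (auto simp: z1)
  finally show ?thesis
    using assms by (simp add: z_def plane_block_def)
qed

text \<open>The matrices with rows \<open>(a, b)\<close> and \<open>(c, e)\<close> in \<open>SO(2)\<close>, \<open>SU(2)\<close> and \<open>Sp(2)\<close>, respectively.\<close>

definition special_unitary2 :: "base_field \<Rightarrow> quat \<Rightarrow> quat \<Rightarrow> quat \<Rightarrow> quat \<Rightarrow> bool" where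
  "special_unitary2 F a b c e \<longleftrightarrow> {a, b, c, e} \<subseteq> scalars F \<and>
     qcnj a * a + qcnj c * c = 1 \<and> qcnj a * b + qcnj c * e = 0 \<and> qcnj b * b + qcnj e * e = 1 \<and>
     (F \<noteq> Quaternion_Field \<longrightarrow> a * e - b * c = 1)"

lemma unitary_plane_block:
  assumes "i \<noteq> j" "special_unitary2 F a b c e"
  shows "conj_transpose (plane_block i j a b c e) ** plane_block i j a b c e = mat 1"
proof -
  have "qcnj (qcnj a * b + qcnj c * e) = 0" using assms(2) by (simp add: special_unitary2_def)
  then have "qcnj b * a + qcnj e * c = 0" by simp
  then show ?thesis
    using assms by (simp add: conj_transpose_plane_block plane_block_mult special_unitary2_def
      flip: plane_block_id[of i j])
qed

lemma special_plane_block: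
  assumes "i \<noteq> j" "special_unitary2 F a b c e"
  shows "special_over F (plane_block i j a b c e)"
  unfolding special_over_def
proof
  assume F: "F \<noteq> Quaternion_Field"
  have s: "a * e - b * c = 1" "{a, b, c, e} \<subseteq> scalars F" using assms F by (auto simp: special_unitary2_def)
  have "qJ x = 0 \<and> qK x = 0" if "x \<in> scalars F" for x using that F by (cases F) auto
  then have "qJ a = 0 \<and> qK a = 0 \<and> qJ b = 0 \<and> qK b = 0 \<and> qJ c = 0 \<and> qK c = 0 \<and> qJ e = 0 \<and> qK e = 0"
    using s(2) by auto
  then show "det_complex (plane_block i j a b c e) = 1"
    using arg_cong[OF s(1), of qRe] arg_cong[OF s(1), of qI]
    unfolding det_complex_plane_block[OF assms(1)] complex_eq_iff by (simp; algebra)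
qed

lemma plane_block_over:
  "{a, b, c, e} \<subseteq> scalars F \<Longrightarrow> plane_block i j a b c e \<in> matrices_over F"
  by (auto simp: matrices_over_def plane_block_def)

lemma max_compact_eq:
  "max_compact F = {A \<in> block_unitary F. special_over F A \<and>
     (F = Real_Field \<longrightarrow> A $ first_ix $ first_ix = 1)}"
  by (cases F) (auto simp: special_over_def)

lemma block_unitary_mult:
  assumes "A \<in> block_unitary F" "B \<in> block_unitary F"
  shows "A ** B \<in> block_unitary F"
    "(A ** B) $ first_ix $ first_ix = A $ first_ix $ first_ix * B $ first_ix $ first_ix"
proof -
  have *: "(A ** B) $ first_ix $ i = A $ first_ix $ first_ix * B $ first_ix $ i"
    "(A ** B) $ i $ first_ix = A $ i $ first_ix * B $ first_ix $ first_ix" for i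
    unfolding matrix_mult_nth using assms by (subst sum_one_index[of first_ix]; auto simp: block_unitary_def)+
  show "(A ** B) $ first_ix $ first_ix = A $ first_ix $ first_ix * B $ first_ix $ first_ix"
    by (rule *(1))
  have "conj_transpose (A ** B) ** (A ** B) = conj_transpose B ** (conj_transpose A ** A) ** B"
    by (simp add: conj_transpose_mult matrix_mul_assoc)
  then show "A ** B \<in> block_unitary F"
    using assms * by (auto simp: block_unitary_def matrices_over_mult)
qed

lemma max_compact_mult:
  assumes "A \<in> max_compact F" "B \<in> max_compact F"
  shows "A ** B \<in> max_compact F"
  using assms det_complex_mult[of F A B] block_unitary_mult[of A F B]
  by (auto simp: max_compact_eq special_over_def block_unitary_def)

lemma max_compact_inverse:
  assumes "A \<in> max_compact F"
  shows "conj_transpose A \<in> max_compact F" "A ** conj_transpose A = mat 1"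
    "conj_transpose A ** A = mat 1"
proof -
  have A: "A \<in> matrices_over F" "conj_transpose A ** A = mat 1" "special_over F A"
    using assms by (auto simp: max_compact_eq block_unitary_def)
  then show 1: "A ** conj_transpose A = mat 1" "conj_transpose A ** A = mat 1"
    by (auto intro: quat_matrix_left_inverse_right)
  have "special_over F (conj_transpose A)"
    using A 1 det_complex_mult[of F "conj_transpose A" A] by (simp add: special_over_def)
  then show "conj_transpose A \<in> max_compact F"
    using assms 1 by (auto simp: max_compact_eq block_unitary_def)
qed

lemma mat_1_in_max_compact: "mat 1 \<in> max_compact F"
  by (auto simp: max_compact_eq block_unitary_def special_over_def) (auto simp: mat_def)

lemma max_compact_subset_special: "max_compact F \<subseteq> special_indef_unitary F"
proof
  fix A :: "'a qmat" assume A: "A \<in> max_compact F"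
  then have *: "A $ first_ix $ i = 0" "A $ i $ first_ix = 0" if "i \<noteq> first_ix" for i
    using that by (auto simp: max_compact_eq block_unitary_def)
  have "lorentz_form ** A = A ** lorentz_form"
    unfolding vec_eq_iff lorentz_form_mult_nth using * by auto
  then have "conj_transpose A ** lorentz_form ** A = lorentz_form"
    using max_compact_inverse(3)[OF A] by (metis matrix_mul_assoc matrix_mul_lid)
  then show "A \<in> special_indef_unitary F"
    using A by (auto simp: special_indef_unitary_def indef_unitary_def max_compact_eq block_unitary_def)
qed

lemma plane_block_in_max_compact:
  assumes "i \<noteq> j" "i \<noteq> first_ix" "j \<noteq> first_ix" "special_unitary2 F a b c e"
  shows "plane_block i j a b c e \<in> max_compact F"
  using assms unitary_plane_block[OF assms(1,4)] special_plane_block[OF assms(1,4)]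
    plane_block_over[of a b c e F i j]
  by (auto simp: max_compact_eq block_unitary_def special_unitary2_def plane_block_def)

lemma special_unitary2_real:
  assumes "special_unitary2 Real_Field a b c e"
  obtains t where "a = of_real (cos t)" "b = of_real (- sin t)" "c = of_real (sin t)" "e = of_real (cos t)"
proof -
  have real: "x = of_real (qRe x)" if "x \<in> scalars Real_Field" for x
    using that by (auto simp: quat_eq_iff)
  obtain a' b' c' e' where *: "a = of_real a'" "b = of_real b'" "c = of_real c'" "e = of_real e'"
    using assms real unfolding special_unitary2_def by blast
  have s: "a' * a' + c' * c' = 1" "a' * b' + c' * e' = 0" "b' * b' + e' * e' = 1" "a' * e' - b' * c' = 1"
    using assms unfolding special_unitary2_def * by (simp_all add: quat_eq_iff)
  obtain t where t: "a' = cos t" "c' = sin t"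
    using sincos_total_2pi[of a' c'] s(1) by (auto simp: power2_eq_square)
  have "b' = - c'" "e' = a'" using s by algebra+
  then show ?thesis using that[of t] * t by simp
qed

lemma special_unitary2_rotation:
  "special_unitary2 F (of_real (cos t)) (of_real (- sin t)) (of_real (sin t)) (of_real (cos t))"
proof -
  have "of_real (cos t) * of_real (cos t) + of_real (sin t) * of_real (sin t) = (1 :: quat)"
    by (metis of_real_1 of_real_add of_real_mult power2_eq_square sin_cos_squared_add2)
  moreover have "of_real (cos t) * of_real (sin t) = (of_real (sin t) * of_real (cos t) :: quat)"
    by (rule of_real_quat_commute)
  ultimately show ?thesis by (simp add: special_unitary2_def add.commute)
qed

text \<open>Over the reals, turning the angle back to zero stays inside the group.\<close>

lemma plane_block_in_isom_matrices:
  assumes "i \<noteq> j" "i \<noteq> first_ix" "j \<noteq> first_ix" "special_unitary2 F a b c e"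
  shows "plane_block i j a b c e \<in> isom_matrices F"
proof (cases "F = Real_Field")
  case True
  obtain t where t: "a = of_real (cos t)" "b = of_real (- sin t)" "c = of_real (sin t)" "e = of_real (cos t)"
    using assms(4) unfolding True by (rule special_unitary2_real)
  define \<gamma> where "\<gamma> s = plane_block i j (of_real (cos s)) (of_real (- sin s)) (of_real (sin s)) (of_real (cos s))"
    for s :: real
  have "continuous_on UNIV (\<lambda>s. \<gamma> s $ p $ q)" for p q
    unfolding \<gamma>_def plane_block_def
    by (cases "p = i"; cases "q = i"; cases "p = j"; cases "q = j"; simp add: continuous_intros)
  then have "continuous_on UNIV (\<lambda>s. \<chi> p q. \<gamma> s $ p $ q)"
    by (intro continuous_on_vec_lambda)
  then have "continuous_on UNIV \<gamma>" by (simp add: vec_lambda_eta)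
  then have "connected (range \<gamma>)" by (intro connected_continuous_image) auto
  moreover have "range \<gamma> \<subseteq> special_indef_unitary Real_Field"
    using plane_block_in_max_compact[OF assms(1-3) special_unitary2_rotation] max_compact_subset_special
    unfolding \<gamma>_def by blast
  moreover have "mat 1 \<in> range \<gamma>"
    by (rule image_eqI[of _ _ 0]) (auto simp: \<gamma>_def plane_block_id)
  ultimately have "range \<gamma> \<subseteq> isom_matrices Real_Field"
    using isom_matrices_connected mat_1_in_isom_matrices by blast
  then show ?thesis unfolding t True \<gamma>_def by blast
next
  case False
  then show ?thesis
    using plane_block_in_max_compact[OF assms] max_compact_subset_special by (auto simp: isom_matrices_eq)
qed

text \<open>The subgroup of \<open>K\<close> generated by rotations in coordinate planes acts transitively on spheres, and
  each of its generators can be seen to lie in \<open>G\<close>. Only from this does it follow below that \<open>K\<close> is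
  contained in \<open>G\<close> in the real case.\<close>

inductive_set plane_rotations :: "base_field \<Rightarrow> 'n set \<Rightarrow> 'n::finite qmat set" for F T where
  one: "mat 1 \<in> plane_rotations F T"
| block: "R \<in> plane_rotations F T \<Longrightarrow> i \<in> T \<Longrightarrow> j \<in> T \<Longrightarrow> i \<noteq> j \<Longrightarrow> special_unitary2 F a b c e
    \<Longrightarrow> plane_block i j a b c e ** R \<in> plane_rotations F T"

lemma plane_rotations_group:
  assumes "R \<in> plane_rotations F T" "first_ix \<notin> T"
  shows "R \<in> max_compact F \<and> R \<in> isom_matrices F"
  using assms
proof induction
  case one
  then show ?case using mat_1_in_max_compact mat_1_in_isom_matrices by blast
next
  case (block R i j a b c e)
  then have "i \<noteq> first_ix" "j \<noteq> first_ix" by auto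
  then show ?case
    using block plane_block_in_max_compact[of i j F a b c e] plane_block_in_isom_matrices[of i j F a b c e]
      max_compact_mult isom_matrices_mult by blast
qed

lemma plane_rotations_unitary:
  assumes "R \<in> plane_rotations F T"
  shows "conj_transpose R ** R = mat 1 \<and> R \<in> matrices_over F"
  using assms
proof induction
  case (block R i j a b c e)
  let ?B = "plane_block i j a b c e"
  have "conj_transpose (?B ** R) ** (?B ** R) = conj_transpose R ** (conj_transpose ?B ** ?B) ** R"
    by (simp add: conj_transpose_mult matrix_mul_assoc)
  then show ?case
    using block unitary_plane_block[of i j F a b c e] plane_block_over[of a b c e F i j]
    by (auto simp: special_unitary2_def matrices_over_mult)
qed simp

lemma plane_rotations_fix:
  assumes "R \<in> plane_rotations F T" "r \<notin> T"
  shows "(R *v v) $ r = v $ r"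
  using assms
proof induction
  case (block R i j a b c e)
  then show ?case by (auto simp: plane_block_vec_nth simp flip: matrix_vector_mul_assoc)
qed simp

lemma plane_rotations_fix_axis:
  assumes "R \<in> plane_rotations F T" "i \<notin> T"
  shows "R *v axis i 1 = axis i 1"
  using assms
proof induction
  case (block R p q a b c e)
  then have "(plane_block p q a b c e *v axis i 1) $ r = axis i 1 $ r" for r
    by (auto simp: plane_block_vec_nth axis_def)
  then have "plane_block p q a b c e *v axis i 1 = axis i 1" by (simp add: vec_eq_iff)
  then show ?case using block by (simp flip: matrix_vector_mul_assoc)
qed simp

lemma matrix_vec_over:
  "R \<in> matrices_over F \<Longrightarrow> (\<And>i. v $ i \<in> scalars F) \<Longrightarrow> (R *v v) $ r \<in> scalars F"
  by (auto simp: matrix_vector_mult_def matrices_over_def intro!: scalars_sum)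

lemma unitary_norm_sum:
  fixes R :: "'n::finite qmat"
  assumes "conj_transpose R ** R = mat 1"
  shows "(\<Sum>r\<in>UNIV. (norm ((R *v v) $ r))\<^sup>2) = (\<Sum>r\<in>UNIV. (norm (v $ r))\<^sup>2)"
proof -
  obtain f :: 'n where True by blast
  \<comment> \<open>A matrix all of whose columns are \<open>w\<close> turns the norm of \<open>w\<close> into a matrix entry.\<close>
  have sq: "of_real (\<Sum>r\<in>UNIV. (norm (w $ r))\<^sup>2)
      = (conj_transpose (\<chi> r s. w $ r) ** ((\<chi> r s. w $ r) :: 'n qmat)) $ f $ f" for w :: "(quat, 'n) vec"
    by (simp add: matrix_mult_nth quat_mult_cnj)
  let ?V = "(\<chi> r s. v $ r) :: 'n qmat"
  have "(\<chi> r s. (R *v v) $ r) = R ** ?V"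
    by (simp add: vec_eq_iff matrix_mult_nth matrix_vector_mult_def)
  then have "of_real (\<Sum>r\<in>UNIV. (norm ((R *v v) $ r))\<^sup>2) = (conj_transpose (R ** ?V) ** (R ** ?V)) $ f $ f"
    by (simp only: sq)
  also have "conj_transpose (R ** ?V) ** (R ** ?V) = conj_transpose ?V ** (conj_transpose R ** R) ** ?V"
    by (simp add: conj_transpose_mult matrix_mul_assoc)
  also have "\<dots> $ f $ f = of_real (\<Sum>r\<in>UNIV. (norm (v $ r))\<^sup>2)"
    by (simp only: assms matrix_mul_rid sq)
  finally show ?thesis by (simp only: of_real_eq_iff)
qed

lemma plane_rotations_norm_sum:
  assumes "R \<in> plane_rotations F T"
  shows "(\<Sum>r\<in>T. (norm ((R *v v) $ r))\<^sup>2) = (\<Sum>r\<in>T. (norm (v $ r))\<^sup>2)"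
proof -
  have split: "(\<Sum>r\<in>UNIV. g r) = (\<Sum>r\<in>T. g r) + (\<Sum>r\<in>-T. g r)" for g :: "'a \<Rightarrow> real"
    by (metis Compl_eq_Diff_UNIV add.commute finite finite_UNIV subset_UNIV sum.subset_diff)
  have "(\<Sum>r\<in>-T. (norm ((R *v v) $ r))\<^sup>2) = (\<Sum>r\<in>-T. (norm (v $ r))\<^sup>2)"
    using plane_rotations_fix[OF assms] by (intro sum.cong) auto
  then show ?thesis
    using unitary_norm_sum[of R v] plane_rotations_unitary[OF assms] by (simp add: split)
qed

text \<open>One matrix serves all three fields: its rows are \<open>(x y x\<^sup>-\<^sup>1, - x) / n\<close> and \<open>(x\<^sup>*, y\<^sup>*) / n\<close>. The conjugation by
  \<open>x\<close> keeps the rows orthogonal over the quaternions; over a commutative field it cancels and the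
  determinant is one.\<close>

lemma special_unitary2_eliminate:
  assumes "x \<in> scalars F" "y \<in> scalars F" "x \<noteq> 0"
  obtains a b c e where "special_unitary2 F a b c e" "a * x + b * y = 0"
proof -
  define n where "n = sqrt ((norm x)\<^sup>2 + (norm y)\<^sup>2)"
  have n2: "n\<^sup>2 = (norm x)\<^sup>2 + (norm y)\<^sup>2" unfolding n_def by simp
  have n0: "n \<noteq> 0" using n2 assms(3) by (metis add_nonneg_eq_0_iff norm_eq_zero power_eq_0_iff zero_le_power2 zero_power2)
  define a where "a = (x * y * inverse x) /\<^sub>R n"
  define b where "b = - x /\<^sub>R n"
  define c where "c = qcnj x /\<^sub>R n"
  define e where "e = qcnj y /\<^sub>R n"
  note defs = a_def b_def c_def e_def
  have inv: "qcnj (inverse x) = x /\<^sub>R (norm x)\<^sup>2" by (simp add: quat_inverse_eq)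
  have scale: "(u /\<^sub>R n) * (w /\<^sub>R n) = (u * w) /\<^sub>R n\<^sup>2" for u w :: quat
    by (simp add: power2_eq_square)
  have one: "((norm x)\<^sup>2 + (norm y)\<^sup>2) / n\<^sup>2 = 1" using n0 by (simp flip: n2)
  have na: "norm (x * y * inverse x) = norm y" using assms(3) by (simp add: norm_mult norm_inverse)
  have unit: "(of_real (norm x ^ 2) + of_real (norm y ^ 2)) /\<^sub>R n\<^sup>2 = (1 :: quat)"
    "(of_real (norm y ^ 2) + of_real (norm x ^ 2)) /\<^sub>R n\<^sup>2 = (1 :: quat)"
    unfolding scaleR_conv_of_real of_real_add[symmetric] of_real_mult[symmetric]
    using one by (simp_all only: add.commute[of "norm y ^ 2"] mult.commute[of "inverse (n ^ 2)"] divide_inverse[symmetric] of_real_1)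
  have 1: "qcnj a * a + qcnj c * c = 1"
  proof -
    have "qcnj (x * y * inverse x) * (x * y * inverse x) = of_real (norm y ^ 2)"
      by (simp only: quat_mult_cnj na)
    then show ?thesis
      unfolding a_def c_def qcnj_simps(8) scale qcnj_simps(3) quat_mult_cnj(1)
      by (simp only: scaleR_add_right[symmetric] unit)
  qed
  have 2: "qcnj b * b + qcnj e * e = 1"
    unfolding b_def e_def qcnj_simps(8) scale
    by (simp only: qcnj_simps(3,5) quat_mult_cnj scaleR_add_right[symmetric] unit minus_mult_minus)
  have 3: "qcnj a * b + qcnj c * e = 0"
  proof -
    have "qcnj (x * y * inverse x) * (- x) = - ((qcnj (inverse x) * qcnj y) * (qcnj x * x))"
      by (simp add: mult.assoc)
    also have "\<dots> = - (x * qcnj y)"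
      using assms(3) by (simp only: inv quat_mult_cnj of_real_def) simp
    finally show ?thesis unfolding defs qcnj_simps(8) scale by simp
  qed
  have 4: "a * x + b * y = 0"
    unfolding defs using assms(3) by (simp add: mult.assoc)
  have 5: "a * e - b * c = 1" if "F \<noteq> Quaternion_Field"
  proof -
    have "x * y * inverse x = y"
      using scalars_commute[OF that assms(1,2)] assms(3) by (simp add: mult.assoc)
    then show ?thesis
      unfolding defs scale
      by (simp only: quat_mult_cnj mult_minus_left scaleR_minus_right diff_minus_eq_add
          scaleR_add_right[symmetric] unit)
  qed
  have "special_unitary2 F a b c e"
    unfolding special_unitary2_def using 1 2 3 5 assms unfolding defs by simp
  then show ?thesis using that 4 by blast
qed

lemma eliminate_coordinates:
  assumes "finite T'" "T' \<subseteq> T" "l \<in> T" "l \<notin> T'" "\<And>i. v $ i \<in> scalars F"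
  shows "\<exists>R\<in>plane_rotations F T. \<forall>i\<in>T'. (R *v v) $ i = 0"
  using assms(1,2,4)
proof (induction T')
  case empty
  then show ?case using plane_rotations.one by blast
next
  case (insert i T')
  then obtain R where R: "R \<in> plane_rotations F T" "\<forall>i\<in>T'. (R *v v) $ i = 0" by auto
  show ?case
  proof (cases "(R *v v) $ i = 0")
    case True
    then show ?thesis using R by auto
  next
    case False
    have il: "i \<noteq> l" "i \<in> T" using insert by auto
    obtain a b c e where u: "special_unitary2 F a b c e" "a * (R *v v) $ i + b * (R *v v) $ l = 0"
      using special_unitary2_eliminate[OF matrix_vec_over matrix_vec_over False] assms(5)
        plane_rotations_unitary[OF R(1)] by metis
    have "plane_block i l a b c e ** R \<in> plane_rotations F T"
      using R(1) il assms(3) u(1) by (intro plane_rotations.block)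
    moreover have "((plane_block i l a b c e ** R) *v v) $ r = 0" if "r \<in> insert i T'" for r
      using that il R(2) u(2) insert.prems
      by (auto simp: plane_block_vec_nth simp flip: matrix_vector_mul_assoc)
    ultimately show ?thesis by blast
  qed
qed

text \<open>The second index \<open>m\<close> absorbs the phase or sign that corrects the last nonzero coordinate; in
  dimension one the determinant condition would forbid this.\<close>

lemma plane_rotations_transitive:
  assumes "l \<in> T" "m \<in> T" "m \<noteq> l" "\<And>i. v $ i \<in> scalars F" "u \<in> scalars F"
    and norm: "(norm u)\<^sup>2 = (\<Sum>i\<in>T. (norm (v $ i))\<^sup>2)"
  shows "\<exists>R\<in>plane_rotations F T. (R *v v) $ l = u \<and> (\<forall>i\<in>T - {l}. (R *v v) $ i = 0)"
proof -
  obtain R where R: "R \<in> plane_rotations F T" "\<forall>i\<in>T - {l}. (R *v v) $ i = 0"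
    using eliminate_coordinates[of "T - {l}" T l v F] assms by auto
  define y where "y = (R *v v) $ l"
  have y: "y \<in> scalars F" unfolding y_def
    using matrix_vec_over assms(4) plane_rotations_unitary[OF R(1)] by blast
  have "(\<Sum>i\<in>T. (norm (v $ i))\<^sup>2) = (\<Sum>i\<in>T. (norm ((R *v v) $ i))\<^sup>2)"
    using plane_rotations_norm_sum[OF R(1)] by metis
  also have "\<dots> = (\<Sum>i\<in>{l}. (norm ((R *v v) $ i))\<^sup>2)"
    using assms(1) R(2) by (intro sum.mono_neutral_right) auto
  finally have ny: "norm y = norm u"
    using norm by (simp add: y_def)
  \<comment> \<open>If \<open>y = 0\<close>, then \<open>u = 0\<close> and any phase will do.\<close>
  define q where "q = (if y = 0 then 1 else u * inverse y)"
  have q: "q * y = u" "norm q = 1" "q \<in> scalars F"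
    using ny y assms(5) by (auto simp: q_def norm_mult norm_inverse mult.assoc) (metis norm_eq_zero right_inverse)
  have "special_unitary2 F (qcnj q) 0 0 q"
    using q scalars_commute[of F q "qcnj q"] by (auto simp: special_unitary2_def quat_mult_cnj)
  then have "plane_block m l (qcnj q) 0 0 q ** R \<in> plane_rotations F T"
    using R(1) assms by (intro plane_rotations.block)
  moreover have "((plane_block m l (qcnj q) 0 0 q ** R) *v v) $ l = u"
    using assms(2,3) q(1)
    by (auto simp: plane_block_vec_nth y_def simp flip: matrix_vector_mul_assoc)
  moreover have "((plane_block m l (qcnj q) 0 0 q ** R) *v v) $ i = 0" if "i \<in> T - {l}" for i
    using assms(2,3) R(2) that
    by (auto simp: plane_block_vec_nth simp flip: matrix_vector_mul_assoc)
  ultimately show ?thesis by blast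
qed

lemma isom_matrices_left_cancel:
  assumes "R \<in> isom_matrices F" "R ** m \<in> isom_matrices F"
  shows "m \<in> isom_matrices F"
proof -
  let ?B = "lorentz_form ** conj_transpose R ** lorentz_form"
  have "R \<in> indef_unitary F" using assms isom_matrices_subset by (auto simp: special_indef_unitary_def)
  then have "?B ** (R ** m) = m" using indef_unitary_inverse(1) by (metis matrix_mul_assoc matrix_mul_lid)
  then show ?thesis using isom_matrices_mult[OF isom_matrices_inverse[OF assms(1)] assms(2)] by metis
qed

lemma matrix_mult_axis: "(A *v axis i 1) $ r = (A $ r $ i :: quat)"
  unfolding matrix_vector_mult_def by (simp, subst sum_one_index[of i]) (auto simp: axis_def)

text \<open>\<open>SO(k)\<close> is connected: plane rotations, all of which lie in the identity component, turn one
  column after the other into a unit vector.\<close>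

lemma SO_in_isom_matrices:
  assumes "m \<in> max_compact Real_Field"
  shows "m \<in> isom_matrices Real_Field"
  using assms
proof (induction "card {i. m *v axis i 1 \<noteq> axis i 1}" arbitrary: m rule: less_induct)
  case less
  let ?T = "{i. m *v axis i 1 \<noteq> axis i 1}"
  have m: "conj_transpose m ** m = mat 1" "m \<in> matrices_over Real_Field" "det_complex m = 1"
    using less.prems by (auto simp: block_unitary_def)
  have f: "first_ix \<notin> ?T"
    using less.prems unfolding mem_Collect_eq vec_eq_iff matrix_mult_axis
    by (auto simp: axis_def block_unitary_def)
  have fixed: "m $ r $ i = (if r = i then 1 else 0)" if "i \<notin> ?T" for r i
    using that matrix_mult_axis[of m i r] by (auto simp: axis_def)
  have fixed_row: "m $ i $ l = (if i = l then 1 else 0)" if "i \<notin> ?T" for i l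
  proof -
    have "(conj_transpose m ** m) $ i $ l = m $ i $ l"
      unfolding matrix_mult_nth by (subst sum_one_index[of i]) (auto simp: fixed[OF that])
    then show ?thesis using m(1) by (simp add: mat_def)
  qed
  show ?case
  proof (cases "\<exists>l\<in>?T. \<exists>p\<in>?T. p \<noteq> l")
    case True
    then obtain l p where lp: "l \<in> ?T" "p \<in> ?T" "p \<noteq> l" by blast
    let ?v = "m *v axis l 1"
    have "(\<Sum>r\<in>UNIV. (norm (?v $ r))\<^sup>2) = (\<Sum>r\<in>UNIV. (norm (axis l 1 $ r :: quat))\<^sup>2)"
      by (rule unitary_norm_sum[OF m(1)])
    also have "\<dots> = 1" by (subst sum_one_index[of l]) (auto simp: axis_def)
    also have "(\<Sum>r\<in>UNIV. (norm (?v $ r))\<^sup>2) = (\<Sum>r\<in>?T. (norm (?v $ r))\<^sup>2)"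
      using lp fixed_row by (intro sum.mono_neutral_right) (auto simp: matrix_mult_axis)
    finally have norm: "(norm (1 :: quat))\<^sup>2 = (\<Sum>r\<in>?T. (norm (?v $ r))\<^sup>2)" by simp
    have over: "?v $ i \<in> scalars Real_Field" for i
      using m(2) by (simp only: matrix_mult_axis) (simp add: matrices_over_def)
    obtain R where R: "R \<in> plane_rotations Real_Field ?T" "(R *v ?v) $ l = 1"
      "\<forall>i\<in>?T - {l}. (R *v ?v) $ i = 0"
      using plane_rotations_transitive[OF lp over _ norm] by auto
    have "(R *v ?v) $ r = axis l 1 $ r" for r
    proof (cases "r \<in> ?T")
      case True then show ?thesis using R by (auto simp: axis_def)
    next
      case False
      then have "(R *v ?v) $ r = ?v $ r" using plane_rotations_fix[OF R(1)] by blast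
      moreover have "r \<noteq> l" using False lp(1) by blast
      ultimately show ?thesis
        using fixed_row[OF False, of l] unfolding matrix_mult_axis by (simp add: axis_def)
    qed
    then have Rl: "(R ** m) *v axis l 1 = axis l 1" by (simp add: vec_eq_iff matrix_vector_mul_assoc)
    have Ri: "(R ** m) *v axis i 1 = axis i 1" if "i \<notin> ?T" for i
    proof -
      have "R *v axis i 1 = axis i 1" using plane_rotations_fix_axis[OF R(1) that] .
      then show ?thesis using that by (simp flip: matrix_vector_mul_assoc)
    qed
    have "{i. (R ** m) *v axis i 1 \<noteq> axis i 1} \<subset> ?T" using Rl Ri lp(1) by blast
    then have "card {i. (R ** m) *v axis i 1 \<noteq> axis i 1} < card ?T" by (intro psubset_card_mono) auto
    then have "R ** m \<in> isom_matrices Real_Field"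
      using less plane_rotations_group[OF R(1) f] max_compact_mult by blast
    then show ?thesis using isom_matrices_left_cancel plane_rotations_group[OF R(1) f] by blast
  next
    case False
    have "m = mat 1"
    proof (cases "?T = {}")
      case True
      then show ?thesis using fixed by (auto simp: vec_eq_iff mat_def)
    next
      case nonempty: False
      then obtain l where l: "?T = {l}" using False by blast
      \<comment> \<open>A single column that is not fixed could only change its sign, which the determinant excludes.\<close>
      define z where "z = (\<chi> r s. Complex (qRe (m $ r $ s)) (qI (m $ r $ s)))"
      have "det z = (\<Prod>i\<in>UNIV. z $ i $ i)"
        using fixed fixed_row l by (intro det_diagonal) (force simp: z_def complex_eq_iff)
      also have "\<dots> = (\<Prod>i\<in>{l}. z $ i $ i)"
        using fixed l by (intro prod.mono_neutral_right) (auto simp: z_def complex_eq_iff)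
      finally have "z $ l $ l = 1" using m(3) by (simp add: det_complex_def z_def)
      moreover have "m $ l $ l \<in> scalars Real_Field" using m(2) by (simp add: matrices_over_def)
      ultimately have "m $ l $ l = 1" by (simp add: z_def complex_eq_iff quat_eq_iff)
      then have "m $ r $ s = mat 1 $ r $ s" for r s
        using fixed[of s r] l by (cases "s = l"; cases "r = l") (auto simp: mat_def fixed_row)
      then show ?thesis by (simp add: vec_eq_iff)
    qed
    then show ?thesis using mat_1_in_isom_matrices by blast
  qed
qed

lemma max_compact_subset_isom: "max_compact F \<subseteq> isom_matrices F"
  using SO_in_isom_matrices max_compact_subset_special[of F] by (cases "F = Real_Field") (simp_all only: isom_matrices_eq if_False, blast)

section \<open>Points and distances\<close>

abbreviation coset :: "base_field \<Rightarrow> 'n::{finite,linorder} qmat \<Rightarrow> 'n qmat set" where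
  "coset F g \<equiv> g <#\<^bsub>isom_group F\<^esub> max_compact F"

lemma coset_iff: "x \<in> coset F g \<longleftrightarrow> (\<exists>h\<in>max_compact F. x = g ** h)"
  by (auto simp: l_coset_def)

lemma coset_self: "g \<in> coset F g"
  using mat_1_in_max_compact[of F] by (auto simp: coset_iff intro!: bexI[of _ "mat 1"])

lemma coset_mult_compact:
  assumes "h \<in> max_compact F"
  shows "coset F (g ** h) = coset F g"
proof -
  have "x \<in> coset F (g ** h)" if x: "x \<in> coset F g" for x
  proof -
    obtain h' where h': "h' \<in> max_compact F" "x = g ** h'" using x by (auto simp: coset_iff)
    then have "x = g ** h ** (conj_transpose h ** h')"
      using max_compact_inverse(2)[OF assms] by (metis matrix_mul_assoc matrix_mul_lid)
    then show ?thesis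
      using h' max_compact_mult max_compact_inverse(1)[OF assms] by (auto simp: coset_iff)
  qed
  moreover have "x \<in> coset F g" if "x \<in> coset F (g ** h)" for x
    using that assms max_compact_mult by (force simp: coset_iff simp flip: matrix_mul_assoc)
  ultimately show ?thesis by blast
qed

lemma act_coset: "a <#\<^bsub>isom_group F\<^esub> coset F g = coset F (a ** g)"
  by (force simp: l_coset_def matrix_mul_assoc)

lemma hyp_space_iff: "X \<in> hyp_space F \<longleftrightarrow> (\<exists>g\<in>isom_matrices F. X = coset F g)"
  by (auto simp: hyp_space_def LCOSETS_def)

lemma hyp_origin_eq: "hyp_origin F = coset F (mat 1)"
  by (simp add: hyp_origin_def)

lemma hyp_origin_in_space: "hyp_origin F \<in> hyp_space F"
  using mat_1_in_isom_matrices by (auto simp: hyp_origin_eq hyp_space_iff)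

lemma hyp_space_mem:
  assumes "X \<in> hyp_space F" "g \<in> X"
  shows "X = coset F g" "g \<in> isom_matrices F"
proof -
  obtain a where a: "a \<in> isom_matrices F" "X = coset F a" using assms(1) by (auto simp: hyp_space_iff)
  then obtain h where "h \<in> max_compact F" "g = a ** h" using assms(2) by (auto simp: coset_iff)
  then show "X = coset F g" "g \<in> isom_matrices F"
    using a coset_mult_compact isom_matrices_mult max_compact_subset_isom by blast+
qed

text \<open>The first column of a representative is defined up to a right unit scalar factor, which
  cancels in its Gram matrix.\<close>

definition column_gram :: "'n::{finite,linorder} qmat set \<Rightarrow> 'n \<Rightarrow> 'n \<Rightarrow> quat" where
  "column_gram X i j = (let g = SOME g. g \<in> X in g $ i $ first_ix * qcnj (g $ j $ first_ix))"

lemma max_compact_first: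
  assumes "h \<in> max_compact F"
  shows "(g ** h) $ i $ first_ix = g $ i $ first_ix * h $ first_ix $ first_ix"
    "(h ** g) $ first_ix $ i = h $ first_ix $ first_ix * g $ first_ix $ i"
    "norm (h $ first_ix $ first_ix) = 1"
    "h $ first_ix $ first_ix * qcnj (h $ first_ix $ first_ix) = 1"
proof -
  have h: "h $ j $ first_ix = 0" "h $ first_ix $ j = 0" if "j \<noteq> first_ix" for j
    using that assms by (auto simp: max_compact_eq block_unitary_def)
  show "(g ** h) $ i $ first_ix = g $ i $ first_ix * h $ first_ix $ first_ix"
    "(h ** g) $ first_ix $ i = h $ first_ix $ first_ix * g $ first_ix $ i"
    unfolding matrix_mult_nth using h by (subst sum_one_index[of first_ix]; auto)+
  have "(h ** conj_transpose h) $ first_ix $ first_ix = h $ first_ix $ first_ix * qcnj (h $ first_ix $ first_ix)"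
    unfolding matrix_mult_nth using h by (subst sum_one_index[of first_ix]) auto
  then show one: "h $ first_ix $ first_ix * qcnj (h $ first_ix $ first_ix) = 1"
    using max_compact_inverse(2)[OF assms] by (simp add: mat_def)
  then have "norm (h $ first_ix $ first_ix) * norm (h $ first_ix $ first_ix) = 1"
    by (metis norm_mult norm_one norm_qcnj)
  then show "norm (h $ first_ix $ first_ix) = 1"
    using abs_square_eq_1[of "norm (h $ first_ix $ first_ix)"] by (simp add: power2_eq_square)
qed

lemma column_gram_coset: "column_gram (coset F g) i j = g $ i $ first_ix * qcnj (g $ j $ first_ix)"
proof -
  have "(SOME x. x \<in> coset F g) \<in> coset F g" using coset_self by (rule someI)
  then obtain h where h: "h \<in> max_compact F" "(SOME x. x \<in> coset F g) = g ** h"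
    by (auto simp: coset_iff)
  then have "column_gram (coset F g) i j = g $ i $ first_ix *
      (h $ first_ix $ first_ix * qcnj (h $ first_ix $ first_ix)) * qcnj (g $ j $ first_ix)"
    by (simp only: column_gram_def Let_def h(2) max_compact_first(1)[OF h(1)] qcnj_simps(7) mult.assoc)
  then show ?thesis by (simp only: max_compact_first(4)[OF h(1)] mult_1_right)
qed

lemma double_coset_iff:
  "y \<in> double_coset F x \<longleftrightarrow> (\<exists>a\<in>max_compact F. \<exists>b\<in>max_compact F. y = a ** x ** b)"
  by (auto simp: double_coset_def set_mult_def l_coset_def matrix_mul_assoc)

lemma double_coset_self: "x \<in> double_coset F x"
  using mat_1_in_max_compact[of F] by (auto simp: double_coset_iff intro!: bexI[of _ "mat 1"])

lemma double_coset_first: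
  assumes "y \<in> double_coset F x"
  shows "norm (y $ first_ix $ first_ix) = norm (x $ first_ix $ first_ix)"
proof -
  obtain a b where ab: "a \<in> max_compact F" "b \<in> max_compact F" "y = a ** x ** b"
    using assms by (auto simp: double_coset_iff)
  show ?thesis
    unfolding ab(3) max_compact_first(1)[OF ab(2)] max_compact_first(2)[OF ab(1)]
    using max_compact_first(3)[OF ab(1)] max_compact_first(3)[OF ab(2)] by (simp add: norm_mult)
qed

lemma double_coset_mult:
  assumes "a \<in> max_compact F" "b \<in> max_compact F"
  shows "double_coset F (a ** x ** b) = double_coset F x"
proof -
  have "a' ** (a ** x ** b) ** b' = (a' ** a) ** x ** (b ** b')" for a' b'
    by (simp add: matrix_mul_assoc)
  then have 1: "double_coset F (a ** x ** b) \<subseteq> double_coset F x" if "a \<in> max_compact F" "b \<in> max_compact F" for a b x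
    using that max_compact_mult unfolding subset_iff double_coset_iff
    by (metis (no_types, lifting) matrix_mul_assoc)
  have "x = conj_transpose a ** (a ** x ** b) ** conj_transpose b"
    using max_compact_inverse[OF assms(1)] max_compact_inverse[OF assms(2)]
    by (metis matrix_mul_assoc matrix_mul_lid matrix_mul_rid)
  then have "double_coset F x \<subseteq> double_coset F (a ** x ** b)"
    using 1[OF max_compact_inverse(1)[OF assms(1)] max_compact_inverse(1)[OF assms(2)], of "a ** x ** b"] by simp
  then show ?thesis using 1[OF assms] by blast
qed

lemma indef_unitary_column:
  assumes "A \<in> indef_unitary F"
  shows "(norm (A $ first_ix $ first_ix))\<^sup>2 = 1 + (\<Sum>i\<in>-{first_ix}. (norm (A $ i $ first_ix))\<^sup>2)"
proof -
  have "conj_transpose A ** (lorentz_form ** A) = lorentz_form"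
    using assms by (simp add: indef_unitary_def matrix_mul_assoc)
  then have "1 = (conj_transpose A ** (lorentz_form ** A)) $ first_ix $ first_ix"
    by (simp add: lorentz_form_def)
  also have "\<dots> = (\<Sum>i\<in>UNIV. of_real ((if i = first_ix then 1 else -1) * (norm (A $ i $ first_ix))\<^sup>2))"
    unfolding matrix_mult_nth[of "conj_transpose A"] lorentz_form_mult_nth
    by (intro sum.cong) (auto simp: quat_mult_cnj)
  finally have "(of_real 1 :: quat)
      = of_real (\<Sum>i\<in>UNIV. (if i = first_ix then 1 else -1) * (norm (A $ i $ first_ix))\<^sup>2)"
    by (simp only: of_real_sum of_real_1)
  then have "1 = (\<Sum>i\<in>UNIV. (if i = first_ix then 1 else -1) * (norm (A $ i $ first_ix))\<^sup>2)"
    by (simp only: of_real_eq_iff)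
  also have "\<dots> = (norm (A $ first_ix $ first_ix))\<^sup>2 - (\<Sum>i\<in>-{first_ix}. (norm (A $ i $ first_ix))\<^sup>2)"
    by (subst sum.remove[of _ first_ix]) (auto simp: Compl_eq_Diff_UNIV sum_negf[symmetric] intro!: sum.cong)
  finally show ?thesis by simp
qed

lemma isom_indef: "g \<in> isom_matrices F \<Longrightarrow> g \<in> indef_unitary F"
  using isom_matrices_subset by (auto simp: special_indef_unitary_def)

lemma isom_first_ge_1: "g \<in> isom_matrices F \<Longrightarrow> 1 \<le> norm (g $ first_ix $ first_ix)"
proof -
  assume g: "g \<in> isom_matrices F"
  have "1 \<le> (norm (g $ first_ix $ first_ix))\<^sup>2"
    unfolding indef_unitary_column[OF isom_indef[OF g]] by (simp add: sum_nonneg)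
  then show ?thesis using abs_le_square_iff[of 1 "norm (g $ first_ix $ first_ix)"] by simp
qed

lemma isom_over: "g \<in> isom_matrices F \<Longrightarrow> g $ i $ j \<in> scalars F"
  using isom_indef[of g F] by (auto simp: indef_unitary_def matrices_over_def)

text \<open>On \<open>SO(1,k)\<close> this entry has no zero, so on the identity component it keeps its sign.\<close>

lemma isom_real_first_pos:
  assumes "g \<in> isom_matrices Real_Field"
  shows "0 < qRe (g $ first_ix $ first_ix)"
proof (rule ccontr)
  assume neg: "\<not> ?thesis"
  let ?S = "(\<lambda>g. qRe (g $ first_ix $ first_ix)) ` (isom_matrices Real_Field :: 'a qmat set)"
  have "connected (isom_matrices Real_Field :: 'a qmat set)"
    by (simp add: isom_matrices_eq del: isom_matrices.simps)
  then have "connected ?S" by (intro connected_continuous_image continuous_intros)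
  moreover have "1 \<in> ?S"
    by (rule image_eqI[OF _ mat_1_in_isom_matrices]) (simp add: mat_def)
  moreover have "qRe (g $ first_ix $ first_ix) \<in> ?S" using assms by blast
  ultimately have zero: "0 \<in> ?S" using neg connectedD_interval[of ?S "qRe (g $ first_ix $ first_ix)" 1 0] by linarith
  obtain h :: "'a qmat" where h: "h \<in> isom_matrices Real_Field" "0 = qRe (h $ first_ix $ first_ix)"
    by (rule imageE[OF zero])
  then have "h $ first_ix $ first_ix = 0" using isom_over[OF h(1), of first_ix first_ix] by (simp add: quat_eq_iff)
  then show False using isom_first_ge_1[OF h(1)] by simp
qed

lemma first_ix_neq_last_ix:
  assumes "3 \<le> CARD('n::{finite,linorder})"
  shows "first_ix \<noteq> (last_ix :: 'n::{finite,linorder})"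
proof
  assume eq: "first_ix = (last_ix :: 'n)"
  have "i = first_ix" for i :: 'n
  proof (rule antisym)
    show "first_ix \<le> i" by (simp add: first_ix_def)
    show "i \<le> first_ix" unfolding eq by (simp add: last_ix_def)
  qed
  then have "(UNIV :: 'n set) = {first_ix}" by blast
  then have "CARD('n) = card {first_ix :: 'n}" by simp
  then show False using assms by simp
qed

lemma third_index:
  fixes i j :: "'n::finite"
  assumes "3 \<le> CARD('n)"
  obtains m where "m \<noteq> i" "m \<noteq> j"
proof -
  have "card {i, j} \<le> 2" by (simp add: card_insert_if)
  then have "{i, j} \<noteq> (UNIV :: 'n set)" using assms by force
  then show ?thesis using that by blast
qed

lemma hyp_translation_eq:
  fixes t :: real
  assumes "first_ix \<noteq> (last_ix :: 'n::{finite,linorder})"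
  shows "hyp_translation t = (plane_block first_ix last_ix
    (of_real (cosh t)) (of_real (sinh t)) (of_real (sinh t)) (of_real (cosh t)) :: 'n::{finite,linorder} qmat)"
  using assms by (auto simp: vec_eq_iff hyp_translation_def plane_block_def doubleton_eq_iff)

lemma quat_cosh_sinh:
  "of_real (cosh t) * of_real (cosh t) - of_real (sinh t) * of_real (sinh t) = (1 :: quat)"
  by (metis cosh_square_eq add_diff_cancel_left' of_real_1 of_real_diff of_real_mult power2_eq_square)

lemma hyp_translation_special:
  fixes t :: real
  assumes "first_ix \<noteq> (last_ix :: 'n::{finite,linorder})"
  shows "hyp_translation t \<in> (special_indef_unitary F :: 'n::{finite,linorder} qmat set)"
    "hyp_translation (- t) ** hyp_translation t = (mat 1 :: 'n::{finite,linorder} qmat)"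
    "hyp_translation t ** hyp_translation (- t) = (mat 1 :: 'n::{finite,linorder} qmat)"
proof -
  note T = hyp_translation_eq[OF assms]
  have comm: "of_real (sinh t) * of_real (cosh t) = (of_real (cosh t) * of_real (sinh t) :: quat)"
    by (rule of_real_quat_commute)
  show 1: "hyp_translation (- t) ** hyp_translation t = (mat 1 :: 'n qmat)"
    using quat_cosh_sinh[of t] comm
    by (simp add: T plane_block_mult[OF assms] flip: plane_block_id[of first_ix last_ix])
  then show "hyp_translation t ** hyp_translation (- t) = (mat 1 :: 'n qmat)"
    by (rule quat_matrix_left_inverse_right)
  have c: "conj_transpose (hyp_translation t) = (hyp_translation t :: 'n qmat)"
    by (simp add: T conj_transpose_plane_block[OF assms])
  have "lorentz_form ** hyp_translation t = (hyp_translation (- t) ** lorentz_form :: 'n qmat)"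
    unfolding vec_eq_iff lorentz_form_mult_nth by (auto simp: T plane_block_def assms assms[symmetric])
  then have "conj_transpose (hyp_translation t) ** lorentz_form ** hyp_translation t = (lorentz_form :: 'n qmat)"
    unfolding c by (metis 1 quat_matrix_left_inverse_right matrix_mul_assoc matrix_mul_lid)
  moreover have "hyp_translation t \<in> (matrices_over F :: 'n qmat set)"
    unfolding T by (rule plane_block_over) simp
  moreover have "special_over F (hyp_translation t :: 'n qmat)"
    unfolding special_over_def T det_complex_plane_block[OF assms]
    by (simp add: complex_eq_iff) (metis cosh_square_eq add_diff_cancel_left' power2_eq_square)
  ultimately show "hyp_translation t \<in> (special_indef_unitary F :: 'n qmat set)"
    by (simp add: special_indef_unitary_def indef_unitary_def)
qed

text \<open>The decomposition \<open>G = K A K\<close>: a rotation moves the first column into the plane of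
  \<open>a\<^sub>t\<close>, and what remains after removing \<open>a\<^sub>t\<close> fixes the first basis vector up to a phase.\<close>

lemma cartan_decomposition:
  fixes g :: "'n::{finite,linorder} qmat"
  assumes card: "3 \<le> CARD('n)" and g: "g \<in> isom_matrices F"
  shows "double_coset F g = double_coset F (hyp_translation (arcosh (norm (g $ first_ix $ first_ix))))"
proof -
  note fl = first_ix_neq_last_ix[OF card]
  define n where "n = norm (g $ first_ix $ first_ix)"
  define t where "t = arcosh n"
  have n1: "1 \<le> n" unfolding n_def using isom_first_ge_1[OF g] .
  have ch: "cosh t = n" unfolding t_def using n1 by simp
  define p where "p = g $ first_ix $ first_ix /\<^sub>R n"
  have p: "norm p = 1" "p \<in> scalars F" "g $ first_ix $ first_ix = of_real (cosh t) * p"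
  proof -
    show "norm p = 1" using n1 by (simp add: p_def flip: n_def)
    show "p \<in> scalars F" using isom_over[OF g] by (simp add: p_def)
    show "g $ first_ix $ first_ix = of_real (cosh t) * p"
      using n1 by (simp add: p_def ch flip: scaleR_conv_of_real)
  qed
  define v where "v = g *v axis first_ix 1"
  have v: "v $ i = g $ i $ first_ix" for i unfolding v_def by (rule matrix_mult_axis)
  define u where "u = of_real (sinh t) * p"
  have "(norm u)\<^sup>2 = (cosh t)\<^sup>2 - 1"
    by (simp add: u_def norm_mult p power_mult_distrib cosh_square_eq)
  also have "\<dots> = (\<Sum>i\<in>-{first_ix}. (norm (v $ i))\<^sup>2)"
    using indef_unitary_column[OF isom_indef[OF g]] by (simp add: ch n_def v)
  finally have nu: "(norm u)\<^sup>2 = (\<Sum>i\<in>-{first_ix}. (norm (v $ i))\<^sup>2)" .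
  obtain m0 :: 'n where m0: "m0 \<noteq> first_ix" "m0 \<noteq> last_ix" using third_index[OF card] by metis
  obtain R where R: "R \<in> plane_rotations F (-{first_ix})" "(R *v v) $ last_ix = u"
    "\<forall>i\<in>-{first_ix} - {last_ix}. (R *v v) $ i = 0"
    using plane_rotations_transitive[of last_ix "-{first_ix}" m0 v F u] nu m0 fl isom_over[OF g] p(2)
    by (auto simp: v u_def)
  have RK: "R \<in> max_compact F" "R \<in> isom_matrices F" using plane_rotations_group[OF R(1)] by auto
  have Rf: "(R *v v) $ first_ix = of_real (cosh t) * p"
    using plane_rotations_fix[OF R(1), of first_ix v] p(3) by (simp add: v)
  define m where "m = hyp_translation (- t) ** (R ** g)"
  have col: "m $ i $ first_ix = (if i = first_ix then p else 0)" for i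
  proof -
    have "m $ i $ first_ix = (hyp_translation (- t) *v (R *v v)) $ i"
      by (simp add: m_def v_def matrix_vector_mul_assoc matrix_mul_assoc flip: matrix_mult_axis)
    also have "\<dots> = (if i = first_ix then p else 0)"
      using R(2,3) Rf quat_cosh_sinh[of t] of_real_quat_commute[of "sinh t" "of_real (cosh t)"]
      by (auto simp: hyp_translation_eq[OF fl] plane_block_vec_nth[OF fl] u_def mult.assoc[symmetric] simp flip: left_diff_distrib)
    finally show ?thesis .
  qed
  have ms: "m \<in> special_indef_unitary F"
    unfolding m_def using hyp_translation_special(1)[OF fl] isom_matrices_mult[OF RK(2) g] isom_matrices_subset
      special_indef_unitary_mult by blast
  then have form: "conj_transpose m ** (lorentz_form ** m) = lorentz_form" "m \<in> matrices_over F" "special_over F m"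
    by (auto simp: special_indef_unitary_def indef_unitary_def matrix_mul_assoc)
  have row: "m $ first_ix $ s = 0" if "s \<noteq> first_ix" for s
  proof -
    have "(conj_transpose m ** (lorentz_form ** m)) $ first_ix $ s = qcnj p * m $ first_ix $ s"
      unfolding matrix_mult_nth[of "conj_transpose m"] lorentz_form_mult_nth
      by (subst sum_one_index[of first_ix]) (auto simp: col)
    then have "qcnj p * m $ first_ix $ s = 0" using form(1) that by (simp add: lorentz_form_def)
    then show ?thesis using p(1) by (metis mult_eq_0_iff norm_qcnj norm_zero zero_neq_one)
  qed
  have "lorentz_form ** m = m ** lorentz_form"
    unfolding vec_eq_iff lorentz_form_mult_nth using col row by auto
  then have "conj_transpose m ** m = mat 1"
    using form(1) by (metis lorentz_form_square matrix_mul_assoc matrix_mul_rid)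
  moreover have "p = 1" if "F = Real_Field"
  proof -
    have "p = of_real (qRe p)" using p(2) that by (auto simp: quat_eq_iff)
    moreover have "0 < qRe p"
      using isom_real_first_pos[of g] g n1 unfolding that p_def quat_sel by (intro mult_pos_pos) simp_all
    ultimately show ?thesis using p(1) by (metis abs_of_pos norm_of_real of_real_1)
  qed
  ultimately have mK: "m \<in> max_compact F"
    using form col row by (auto simp: max_compact_eq block_unitary_def)
  have "R ** g = hyp_translation t ** m"
    unfolding m_def using hyp_translation_special(3)[OF fl, of t] by (metis matrix_mul_assoc matrix_mul_lid)
  then have "g = conj_transpose R ** hyp_translation t ** m"
    using max_compact_inverse(3)[OF RK(1)] by (metis matrix_mul_assoc matrix_mul_lid)
  then have "double_coset F g = double_coset F (hyp_translation t)"
    using double_coset_mult[OF max_compact_inverse(1)[OF RK(1)] mK] by simp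
  then show ?thesis by (simp add: t_def n_def)
qed

definition lorentz_inverse :: "'n::{finite,linorder} qmat \<Rightarrow> 'n qmat" where
  "lorentz_inverse h = lorentz_form ** conj_transpose h ** lorentz_form"

lemma hyp_dist_coset:
  fixes g h :: "'n::{finite,linorder} qmat"
  assumes card: "3 \<le> CARD('n)" and g: "g \<in> isom_matrices F" and h: "h \<in> isom_matrices F"
  shows "hyp_dist F (coset F g) (coset F h) = arcosh (norm ((lorentz_inverse h ** g) $ first_ix $ first_ix))"
proof -
  note fl = first_ix_neq_last_ix[OF card]
  define D where "D x y = norm ((lorentz_inverse y ** x) $ first_ix $ first_ix)" for x y :: "'n qmat"
  have D_cong: "D x y = D g h" if xy: "coset F g = coset F x" "coset F h = coset F y" for x y
  proof -
    obtain a where a: "a \<in> max_compact F" "x = g ** a" using xy coset_self by (metis coset_iff)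
    obtain b where b: "b \<in> max_compact F" "y = h ** b" using xy coset_self by (metis coset_iff)
    have b': "b \<in> isom_matrices F" using b max_compact_subset_isom by blast
    have "lorentz_form ** conj_transpose b ** lorentz_form = conj_transpose b"
      using quat_matrix_left_inverse_right max_compact_inverse[OF b(1)] indef_unitary_inverse(1)[OF isom_indef[OF b']]
      by (metis matrix_mul_assoc matrix_mul_lid matrix_mul_rid)
    then have "lorentz_inverse y = conj_transpose b ** lorentz_inverse h"
      unfolding lorentz_inverse_def b(2) conj_transpose_mult
      by (metis lorentz_form_square matrix_mul_assoc matrix_mul_rid)
    then have "lorentz_inverse y ** x = conj_transpose b ** (lorentz_inverse h ** g) ** a"
      unfolding a(2) by (simp add: matrix_mul_assoc)
    then show ?thesis
      using max_compact_first[OF a(1)] max_compact_first[OF max_compact_inverse(1)[OF b(1)]]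
      unfolding D_def by (simp add: norm_mult)
  qed
  have inv: "inv\<^bsub>isom_group F\<^esub> y = lorentz_inverse y" if "y \<in> isom_matrices F" for y
    using isom_group_inv[OF that] by (simp add: lorentz_inverse_def)
  have iso: "lorentz_inverse y ** x \<in> isom_matrices F" if "x \<in> isom_matrices F" "y \<in> isom_matrices F" for x y
    using that isom_matrices_inverse isom_matrices_mult unfolding lorentz_inverse_def by blast
  have D1: "1 \<le> D g h" unfolding D_def using isom_first_ge_1[OF iso[OF g h]] .
  show ?thesis
    unfolding hyp_dist_def
  proof (rule the_equality)
    show "0 \<le> arcosh (norm ((lorentz_inverse h ** g) $ first_ix $ first_ix)) \<and>
      (\<exists>x\<in>carrier (isom_group F). \<exists>y\<in>carrier (isom_group F).
         coset F g = coset F x \<and> coset F h = coset F y \<and>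
         double_coset F (inv\<^bsub>isom_group F\<^esub> y \<otimes>\<^bsub>isom_group F\<^esub> x)
           = double_coset F (hyp_translation (arcosh (norm ((lorentz_inverse h ** g) $ first_ix $ first_ix)))))"
    proof (intro conjI)
      show "0 \<le> arcosh (norm ((lorentz_inverse h ** g) $ first_ix $ first_ix))"
        using D1 by (simp add: D_def)
      have B: "double_coset F (inv\<^bsub>isom_group F\<^esub> h \<otimes>\<^bsub>isom_group F\<^esub> g)
        = double_coset F (hyp_translation (arcosh (norm ((lorentz_inverse h ** g) $ first_ix $ first_ix))))"
        unfolding inv[OF h] isom_group_simps(2) by (rule cartan_decomposition[OF card iso[OF g h]])
      show "\<exists>x\<in>carrier (isom_group F). \<exists>y\<in>carrier (isom_group F).
         coset F g = coset F x \<and> coset F h = coset F y \<and>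
         double_coset F (inv\<^bsub>isom_group F\<^esub> y \<otimes>\<^bsub>isom_group F\<^esub> x)
           = double_coset F (hyp_translation (arcosh (norm ((lorentz_inverse h ** g) $ first_ix $ first_ix))))"
        by (rule bexI[of _ g], rule bexI[of _ h], intro conjI refl B) (use g h in simp_all)
    qed
  next
    fix t assume "0 \<le> t \<and> (\<exists>x\<in>carrier (isom_group F). \<exists>y\<in>carrier (isom_group F).
         coset F g = coset F x \<and> coset F h = coset F y \<and>
         double_coset F (inv\<^bsub>isom_group F\<^esub> y \<otimes>\<^bsub>isom_group F\<^esub> x) = double_coset F (hyp_translation t))"
    then obtain x y where t: "0 \<le> t" and xy: "x \<in> isom_matrices F" "y \<in> isom_matrices F"
      "coset F g = coset F x" "coset F h = coset F y"
      "double_coset F (inv\<^bsub>isom_group F\<^esub> y ** x) = double_coset F (hyp_translation t)"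
      by auto
    have "D x y = norm ((hyp_translation t :: 'n qmat) $ first_ix $ first_ix)"
      unfolding D_def using double_coset_first double_coset_self xy(5) inv[OF xy(2)] by metis
    also have "\<dots> = cosh t" by (simp add: hyp_translation_def)
    finally show "t = arcosh (norm ((lorentz_inverse h ** g) $ first_ix $ first_ix))"
      using D_cong[OF xy(3,4)] arcosh_cosh_real[OF t] unfolding D_def by metis
  qed
qed

lemma lorentz_inverse_1 [simp]: "lorentz_inverse (mat 1) = mat 1"
  by (simp add: lorentz_inverse_def lorentz_form_square)

lemma hyp_dist_origin:
  fixes g :: "'n::{finite,linorder} qmat"
  assumes "3 \<le> CARD('n)" "g \<in> isom_matrices F"
  shows "hyp_dist F (coset F g) (hyp_origin F) = arcosh (norm (g $ first_ix $ first_ix))"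
    "hyp_dist F (hyp_origin F) (coset F g) = arcosh (norm (g $ first_ix $ first_ix))"
proof -
  show "hyp_dist F (coset F g) (hyp_origin F) = arcosh (norm (g $ first_ix $ first_ix))"
    using hyp_dist_coset[OF assms mat_1_in_isom_matrices] by (simp add: hyp_origin_eq)
  have "lorentz_inverse g $ first_ix $ first_ix = qcnj (g $ first_ix $ first_ix)"
    by (simp add: lorentz_inverse_def lorentz_form_mult_nth flip: matrix_mul_assoc)
  then show "hyp_dist F (hyp_origin F) (coset F g) = arcosh (norm (g $ first_ix $ first_ix))"
    using hyp_dist_coset[OF assms(1) mat_1_in_isom_matrices assms(2)] by (simp add: hyp_origin_eq)
qed

text \<open>The modulus squared of the entry \<open>(h\<^sup>-\<^sup>1 g)\<^sub>0\<^sub>0\<close> is bilinear in the two Gram matrices. This makes the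
  distance jointly measurable.\<close>

lemma hyp_dist_gram:
  fixes X Y :: "'n::{finite,linorder} qmat set"
  assumes "3 \<le> CARD('n)" "X \<in> hyp_space F" "Y \<in> hyp_space F"
  shows "hyp_dist F X Y = arcosh (sqrt (\<Sum>i\<in>UNIV. \<Sum>j\<in>UNIV. (if i = first_ix then 1 else -1) *
    (if j = first_ix then 1 else -1) * qRe (column_gram X i j * column_gram Y j i)))"
proof -
  obtain g h where gh: "g \<in> isom_matrices F" "X = coset F g" "h \<in> isom_matrices F" "Y = coset F h"
    using assms by (auto simp: hyp_space_iff)
  define s :: "'n \<Rightarrow> real" where "s i = (if i = first_ix then 1 else -1)" for i
  let ?d = "(lorentz_inverse h ** g) $ first_ix $ first_ix"
  have d: "?d = (\<Sum>i\<in>UNIV. s i *\<^sub>R (qcnj (h $ i $ first_ix) * g $ i $ first_ix))"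
  proof -
    have "?d = (conj_transpose h ** (lorentz_form ** g)) $ first_ix $ first_ix"
      unfolding lorentz_inverse_def by (simp add: lorentz_form_mult_nth flip: matrix_mul_assoc)
    then show ?thesis
      unfolding matrix_mult_nth[of "conj_transpose h"] lorentz_form_mult_nth
      by (auto simp: s_def intro!: sum.cong)
  qed
  have "(norm ?d)\<^sup>2 = qRe (?d * qcnj ?d)" by (simp only: quat_mult_cnj quat_of_real_sel)
  also have "\<dots> = (\<Sum>i\<in>UNIV. \<Sum>j\<in>UNIV. s i * s j * qRe ((qcnj (h $ i $ first_ix) * g $ i $ first_ix)
      * qcnj (qcnj (h $ j $ first_ix) * g $ j $ first_ix)))"
    unfolding d qcnj_sum sum_product qRe_sum
    by (intro sum.cong refl) (simp only: qcnj_simps(8) mult_scaleR_left mult_scaleR_right quat_sel scaleR_scaleR ac_simps)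
  also have "\<dots> = (\<Sum>i\<in>UNIV. \<Sum>j\<in>UNIV. s i * s j * qRe (column_gram X i j * column_gram Y j i))"
  proof (intro sum.cong refl arg_cong2[of _ _ _ _ "(*)"])
    fix i j :: 'n
    have "qRe ((qcnj (h $ i $ first_ix) * g $ i $ first_ix) * qcnj (qcnj (h $ j $ first_ix) * g $ j $ first_ix))
      = qRe (qcnj (h $ i $ first_ix) * (g $ i $ first_ix * qcnj (g $ j $ first_ix) * h $ j $ first_ix))"
      by (simp only: qcnj_simps mult.assoc)
    also have "\<dots> = qRe ((g $ i $ first_ix * qcnj (g $ j $ first_ix) * h $ j $ first_ix) * qcnj (h $ i $ first_ix))"
      by (rule qRe_commute)
    finally show "qRe ((qcnj (h $ i $ first_ix) * g $ i $ first_ix) * qcnj (qcnj (h $ j $ first_ix) * g $ j $ first_ix))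
      = qRe (column_gram X i j * column_gram Y j i)"
      by (simp only: gh column_gram_coset mult.assoc)
  qed
  finally have "norm ?d = sqrt (\<Sum>i\<in>UNIV. \<Sum>j\<in>UNIV. s i * s j * qRe (column_gram X i j * column_gram Y j i))"
    by (metis norm_ge_zero real_sqrt_unique)
  then show ?thesis
    using hyp_dist_coset[OF assms(1) gh(1,3)] by (simp only: gh s_def)
qed

section \<open>Measurability on the quotient\<close>

lemma space_hyp_borel [simp]: "space (hyp_borel F) = hyp_space F"
  unfolding hyp_borel_def by (rule space_measure_of) auto

lemma open_in_hyp_borel:
  assumes "U \<subseteq> hyp_space F" "openin (top_of_set (isom_matrices F)) (\<Union>U)"
  shows "U \<in> sets (hyp_borel F)"
  unfolding hyp_borel_def using assms by (auto intro!: in_measure_of)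

lemma Union_cosets:
  assumes "U \<subseteq> hyp_space F"
  shows "\<Union>U = {g \<in> isom_matrices F. coset F g \<in> U}"
proof (intro equalityI subsetI)
  fix x assume "x \<in> \<Union>U"
  then obtain X where "X \<in> U" "x \<in> X" by blast
  then show "x \<in> {g \<in> isom_matrices F. coset F g \<in> U}"
    using hyp_space_mem[of X F x] assms by auto
qed (use coset_self in blast)

text \<open>As \<open>K\<close> lies in \<open>G\<close>, the union of a set of cosets consists of all elements of \<open>G\<close> whose coset belongs
  to it; for the preimage of an open set this union is open in \<open>G\<close>.\<close>

lemma measurable_hyp_borel_continuous:
  fixes f :: "'n::{finite,linorder} qmat \<Rightarrow> 'b::topological_space"
  assumes "continuous_on (isom_matrices F) f" "\<And>g. g \<in> isom_matrices F \<Longrightarrow> h (coset F g) = f g"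
  shows "h \<in> borel_measurable (hyp_borel F)"
proof (rule borel_measurableI)
  fix S :: "'b set" assume S: "open S"
  let ?U = "h -` S \<inter> space (hyp_borel F)"
  have "\<Union>?U = isom_matrices F \<inter> f -` S"
    by (subst Union_cosets) (auto simp: assms(2) hyp_space_iff)
  moreover have "openin (top_of_set (isom_matrices F)) (isom_matrices F \<inter> f -` S)"
    using assms(1) S by (simp add: continuous_openin_preimage_gen)
  ultimately show "?U \<in> sets (hyp_borel F)" by (intro open_in_hyp_borel) auto
qed

lemma measurable_act:
  fixes a :: "'n::{finite,linorder} qmat"
  assumes a: "a \<in> isom_matrices F"
  shows "(\<lambda>X. a <#\<^bsub>isom_group F\<^esub> X) \<in> measurable (hyp_borel F) (hyp_borel F)"
proof -
  have "(\<lambda>X. a <#\<^bsub>isom_group F\<^esub> X) \<in> measurable (hyp_borel F) (sigma (hyp_space F)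
     {U. U \<subseteq> hyp_space F \<and> openin (top_of_set (carrier (isom_group F))) (\<Union>U)})"
  proof (rule measurable_measure_of)
    have act: "a <#\<^bsub>isom_group F\<^esub> X \<in> hyp_space F" if "X \<in> hyp_space F" for X
      using that isom_matrices_mult[OF a] by (auto simp: hyp_space_iff act_coset)
    then show "(\<lambda>X. a <#\<^bsub>isom_group F\<^esub> X) \<in> space (hyp_borel F) \<rightarrow> hyp_space F" by auto
    fix U :: "'n qmat set set" assume U: "U \<in> {U. U \<subseteq> hyp_space F \<and> openin (top_of_set (carrier (isom_group F))) (\<Union>U)}"
    let ?V = "(\<lambda>X. a <#\<^bsub>isom_group F\<^esub> X) -` U \<inter> space (hyp_borel F)"
    obtain O' where O': "open O'" "\<Union>U = isom_matrices F \<inter> O'"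
      using U by (auto simp: openin_open)
    have "\<Union>?V = isom_matrices F \<inter> (\<lambda>g. a ** g) -` O'"
    proof -
      have "coset F (a ** g) \<in> U \<longleftrightarrow> a ** g \<in> O'" if "g \<in> isom_matrices F" for g
        using Union_cosets[of U F] U O'(2) isom_matrices_mult[OF a that] by auto
      then show ?thesis by (subst Union_cosets) (auto simp: act_coset hyp_space_iff)
    qed
    moreover have "openin (top_of_set (isom_matrices F)) (isom_matrices F \<inter> (\<lambda>g. a ** g) -` O')"
      using O'(1) by (intro continuous_openin_preimage_gen) (auto intro: continuous_intros)
    ultimately show "?V \<in> sets (hyp_borel F)" by (intro open_in_hyp_borel) auto
  qed auto
  then show ?thesis unfolding hyp_borel_def .
qed

lemma measurable_column_gram [measurable]:
  "(\<lambda>X. column_gram X i j) \<in> borel_measurable (hyp_borel F)"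
proof (rule measurable_hyp_borel_continuous)
  show "continuous_on (isom_matrices F) (\<lambda>g. g $ i $ first_ix * qcnj (g $ j $ first_ix))"
    by (intro continuous_intros)
qed (rule column_gram_coset)

lemma measurable_arcosh_sqrt: "(\<lambda>x :: real. arcosh (sqrt x)) \<in> borel_measurable borel"
  unfolding arcosh_def by measurable

lemma measurable_hyp_dist:
  assumes "3 \<le> CARD('n::{finite,linorder})"
  shows "(\<lambda>(X, Y). hyp_dist F X Y) \<in> borel_measurable (hyp_borel F \<Otimes>\<^sub>M (hyp_borel F :: 'n::{finite,linorder} qmat set measure))"
proof -
  have "(\<lambda>p :: 'n qmat set \<times> 'n qmat set. arcosh (sqrt (\<Sum>i\<in>UNIV. \<Sum>j\<in>UNIV. (if i = first_ix then 1 else -1) *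
    (if j = first_ix then 1 else -1) * qRe (column_gram (fst p) i j * column_gram (snd p) j i))))
    \<in> borel_measurable (hyp_borel F \<Otimes>\<^sub>M hyp_borel F)"
    by (rule measurable_compose[OF _ measurable_arcosh_sqrt]) measurable
  then show ?thesis
    by (rule measurable_cong[THEN iffD1, rotated])
      (auto simp: space_pair_measure hyp_dist_gram[OF assms])
qed

section \<open>The ball model and the Busemann function\<close>

text \<open>The ball model: the first column, divided on the right by its first entry. That entry of the
  quotient is \<open>1\<close> and the remaining ones form a point of the open unit ball of \<open>F\<^sup>k\<close>.\<close>

definition ball_point :: "'n::{finite,linorder} qmat set \<Rightarrow> (quat, 'n) vec" where
  "ball_point X = (\<chi> i. column_gram X i first_ix /\<^sub>R qRe (column_gram X first_ix first_ix))"

text \<open>For a representative with first column \<open>x\<close> this is \<open>log |x\<^sub>0 + x\<^sub>k|\<close>; the two summands are written in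
  terms of quantities that do not depend on the representative.\<close>

definition busemann :: "'n::{finite,linorder} qmat set \<Rightarrow> real" where
  "busemann X = ln (norm (1 + ball_point X $ last_ix)) + ln (qRe (column_gram X first_ix first_ix)) / 2"

lemma ball_point_coset: "ball_point (coset F g) $ i = g $ i $ first_ix * inverse (g $ first_ix $ first_ix)"
  by (simp only: ball_point_def vec_lambda_beta column_gram_coset quat_mult_cnj quat_of_real_sel
      quat_inverse_eq mult_scaleR_right)

lemma isom_first_nonzero: "g \<in> isom_matrices F \<Longrightarrow> g $ first_ix $ first_ix \<noteq> 0"
  using isom_first_ge_1[of g F] by auto

context
  fixes g :: "'n::{finite,linorder} qmat" and F
  assumes card: "3 \<le> CARD('n)" and g: "g \<in> isom_matrices F"
begin

lemma cosh_hyp_dist: "cosh (hyp_dist F (coset F g) (hyp_origin F)) = norm (g $ first_ix $ first_ix)"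
  "0 \<le> hyp_dist F (coset F g) (hyp_origin F)"
  using isom_first_ge_1[OF g] by (simp_all add: hyp_dist_origin[OF card g])

lemma sinh_hyp_dist:
  "(sinh (hyp_dist F (coset F g) (hyp_origin F)))\<^sup>2 = (\<Sum>i\<in>-{first_ix}. (norm (g $ i $ first_ix))\<^sup>2)"
  using indef_unitary_column[OF isom_indef[OF g]] cosh_square_eq[of "hyp_dist F (coset F g) (hyp_origin F)"]
  unfolding cosh_hyp_dist by simp

lemma first_plus_last:
  "exp (- hyp_dist F (coset F g) (hyp_origin F)) \<le> norm (g $ first_ix $ first_ix + g $ last_ix $ first_ix)"
  "norm (g $ first_ix $ first_ix + g $ last_ix $ first_ix) \<le> exp (hyp_dist F (coset F g) (hyp_origin F))"
proof -
  let ?t = "hyp_dist F (coset F g) (hyp_origin F)"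
  have "(norm (g $ last_ix $ first_ix))\<^sup>2 \<le> (sinh ?t)\<^sup>2"
    unfolding sinh_hyp_dist using first_ix_neq_last_ix[OF card]
    by (intro member_le_sum) auto
  then have "norm (g $ last_ix $ first_ix) \<le> sinh ?t"
    by (rule power2_le_imp_le) (simp only: sinh_real_nonneg_iff cosh_hyp_dist(2))
  then have *: "norm (g $ first_ix $ first_ix) - norm (g $ last_ix $ first_ix) \<ge> exp (- ?t)"
    "norm (g $ first_ix $ first_ix) + norm (g $ last_ix $ first_ix) \<le> exp ?t"
    unfolding cosh_hyp_dist(1)[symmetric] cosh_minus_sinh[symmetric] cosh_plus_sinh[symmetric] by simp_all
  show "exp (- ?t) \<le> norm (g $ first_ix $ first_ix + g $ last_ix $ first_ix)"
    using *(1) norm_diff_ineq by (rule order_trans)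
  show "norm (g $ first_ix $ first_ix + g $ last_ix $ first_ix) \<le> exp ?t"
    using norm_triangle_ineq *(2) by (rule order_trans)
qed

lemma first_plus_last_nonzero: "g $ first_ix $ first_ix + g $ last_ix $ first_ix \<noteq> 0"
  using first_plus_last(1) exp_gt_zero[of "- hyp_dist F (coset F g) (hyp_origin F)"] by force

lemma one_plus_ball_point:
  "g $ first_ix $ first_ix + g $ last_ix $ first_ix = (1 + ball_point (coset F g) $ last_ix) * g $ first_ix $ first_ix"
  by (simp add: ball_point_coset distrib_right mult.assoc isom_first_nonzero[OF g])

lemma gram_first: "qRe (column_gram (coset F g) first_ix first_ix) = (norm (g $ first_ix $ first_ix))\<^sup>2"
  by (simp only: column_gram_coset quat_mult_cnj quat_of_real_sel)

lemma one_plus_ball_point_nonzero: "1 + ball_point (coset F g) $ last_ix \<noteq> 0"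
  using one_plus_ball_point first_plus_last_nonzero by auto

lemma busemann_coset: "busemann (coset F g) = ln (norm (g $ first_ix $ first_ix + g $ last_ix $ first_ix))"
  unfolding one_plus_ball_point norm_mult busemann_def gram_first
  using one_plus_ball_point_nonzero isom_first_nonzero[OF g] by (simp add: ln_mult ln_realpow)

lemma abs_busemann_coset: "\<bar>busemann (coset F g)\<bar> \<le> hyp_dist F (coset F g) (hyp_origin F)"
proof -
  have "0 < norm (g $ first_ix $ first_ix + g $ last_ix $ first_ix)"
    using first_plus_last_nonzero by simp
  then have "ln (exp (- hyp_dist F (coset F g) (hyp_origin F))) \<le> busemann (coset F g)"
    "busemann (coset F g) \<le> ln (exp (hyp_dist F (coset F g) (hyp_origin F)))"
    unfolding busemann_coset using first_plus_last by (auto simp del: ln_exp)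
  then show ?thesis by simp
qed

lemma busemann_coset_dist:
  "busemann (coset F g) = ln (norm (1 + ball_point (coset F g) $ last_ix)) + ln (cosh (hyp_dist F (coset F g) (hyp_origin F)))"
  unfolding busemann_def gram_first cosh_hyp_dist by (simp add: ln_realpow isom_first_nonzero[OF g])

lemma ball_point_norm:
  "(\<Sum>i\<in>-{first_ix}. (norm (ball_point (coset F g) $ i))\<^sup>2) = (tanh (hyp_dist F (coset F g) (hyp_origin F)))\<^sup>2"
  unfolding tanh_def power_divide sinh_hyp_dist cosh_hyp_dist ball_point_coset
  by (simp add: norm_mult norm_inverse power_mult_distrib power_inverse divide_inverse sum_distrib_right)

lemma ball_point_scalars: "ball_point (coset F g) $ i \<in> scalars F"
  by (simp add: ball_point_coset isom_over[OF g])

end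

text \<open>Since \<open>|x\<^sub>0 + x\<^sub>k| = cosh t |1 + \<zeta>|\<close> and \<open>2 cosh t \<ge> e\<^sup>t\<close>, the Busemann function is far below the
  distance only near the boundary point \<open>\<zeta> = -1\<close>.\<close>

lemma dist_minus_busemann:
  fixes X :: "'n::{finite,linorder} qmat set"
  assumes "3 \<le> CARD('n)" "X \<in> hyp_space F"
  shows "hyp_dist F X (hyp_origin F) - busemann X \<le> ln 2 - ln (norm (1 + ball_point X $ last_ix))"
    and "\<bar>busemann X\<bar> \<le> hyp_dist F X (hyp_origin F)"
proof -
  obtain g where g: "g \<in> isom_matrices F" "X = coset F g" using assms(2) by (auto simp: hyp_space_iff)
  show "\<bar>busemann X\<bar> \<le> hyp_dist F X (hyp_origin F)"
    using abs_busemann_coset[OF assms(1) g(1)] g(2) by simp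
  let ?t = "hyp_dist F X (hyp_origin F)"
  have "exp ?t \<le> 2 * cosh ?t" by (simp add: cosh_def)
  then have "ln (exp ?t) \<le> ln (2 * cosh ?t)" by (subst ln_le_cancel_iff) (auto intro: cosh_real_pos)
  then have "?t \<le> ln 2 + ln (cosh ?t)" by (simp add: ln_mult)
  then show "?t - busemann X \<le> ln 2 - ln (norm (1 + ball_point X $ last_ix))"
    unfolding g(2) busemann_coset_dist[OF assms(1) g(1)] by simp
qed

lemma measurable_ball_point [measurable]: "(\<lambda>X. ball_point X $ i) \<in> borel_measurable (hyp_borel F)"
  unfolding ball_point_def vec_lambda_beta by measurable

lemma measurable_busemann [measurable]: "busemann \<in> borel_measurable (hyp_borel F)"
  unfolding busemann_def by measurable

lemma measurable_hyp_dist_origin: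
  assumes "3 \<le> CARD('n::{finite,linorder})"
  shows "(\<lambda>X. hyp_dist F X (hyp_origin F)) \<in> borel_measurable (hyp_borel F :: 'n::{finite,linorder} qmat set measure)"
proof -
  have "(\<lambda>X. (X, hyp_origin F)) \<in> hyp_borel F \<rightarrow>\<^sub>M hyp_borel F \<Otimes>\<^sub>M (hyp_borel F :: 'n qmat set measure)"
    by (intro measurable_Pair measurable_const) (auto simp: hyp_origin_in_space)
  from measurable_compose[OF this measurable_hyp_dist[OF assms]] show ?thesis by simp
qed

lemma act_hyp_space:
  "a \<in> isom_matrices F \<Longrightarrow> X \<in> hyp_space F \<Longrightarrow> a <#\<^bsub>isom_group F\<^esub> X \<in> hyp_space F"
  using isom_matrices_mult[of a F] by (auto simp: hyp_space_iff act_coset)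

lemma act_mult:
  "X \<in> hyp_space F \<Longrightarrow> a <#\<^bsub>isom_group F\<^esub> (b <#\<^bsub>isom_group F\<^esub> X) = (a ** b) <#\<^bsub>isom_group F\<^esub> X"
  by (auto simp: hyp_space_iff act_coset matrix_mul_assoc)

lemma act_1: "X \<in> hyp_space F \<Longrightarrow> mat 1 <#\<^bsub>isom_group F\<^esub> X = X"
  by (auto simp: hyp_space_iff act_coset)

lemma act_compact_origin:
  "R \<in> max_compact F \<Longrightarrow> R <#\<^bsub>isom_group F\<^esub> hyp_origin F = hyp_origin F"
  using coset_mult_compact[of R F "mat 1"] by (simp add: hyp_origin_eq act_coset)

text \<open>Rotations act linearly on the ball model.\<close>

lemma ball_point_rotation:
  fixes X :: "'n::{finite,linorder} qmat set"
  assumes "3 \<le> CARD('n)" "X \<in> hyp_space F" "R \<in> plane_rotations F (-{first_ix})"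
  shows "ball_point (R <#\<^bsub>isom_group F\<^esub> X) = R *v ball_point X"
    "hyp_dist F (R <#\<^bsub>isom_group F\<^esub> X) (hyp_origin F) = hyp_dist F X (hyp_origin F)"
proof -
  obtain g where g: "g \<in> isom_matrices F" "X = coset F g" using assms(2) by (auto simp: hyp_space_iff)
  have R: "R \<in> max_compact F" "R \<in> isom_matrices F" using plane_rotations_group[OF assms(3)] by auto
  have "R $ first_ix $ first_ix = 1"
    using plane_rotations_fix_axis[OF assms(3), of first_ix] matrix_mult_axis[of R first_ix first_ix]
    by (simp add: axis_def)
  then have first: "(R ** g) $ first_ix $ first_ix = g $ first_ix $ first_ix"
    using max_compact_first(2)[OF R(1), of g first_ix] by simp
  show "ball_point (R <#\<^bsub>isom_group F\<^esub> X) = R *v ball_point X"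
    unfolding g(2) act_coset vec_eq_iff ball_point_coset first
    by (simp add: matrix_mult_nth matrix_vector_mult_def ball_point_coset sum_distrib_right mult.assoc)
  show "hyp_dist F (R <#\<^bsub>isom_group F\<^esub> X) (hyp_origin F) = hyp_dist F X (hyp_origin F)"
    unfolding g(2) act_coset
    using first hyp_dist_origin[OF assms(1)] g(1) isom_matrices_mult[OF R(2) g(1)] by metis
qed

text \<open>The function \<open>busemann\<close> is the logarithm of the pairing with a null vector. Moving by \<open>g\<close> turns
  this null vector into another one, which a suitable choice of the representative makes
  proportional to the original one; hence increments of the Busemann function do not depend on the
  current position.\<close>

lemma busemann_cocycle:
  fixes g :: "'n::{finite,linorder} qmat"
  assumes card: "3 \<le> CARD('n)" and g: "g \<in> isom_matrices F"
  shows "\<exists>g'\<in>isom_matrices F. coset F g' = coset F g \<and>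
    (\<forall>Y\<in>hyp_space F. busemann (g' <#\<^bsub>isom_group F\<^esub> Y) = busemann (coset F g) + busemann Y)"
proof -
  note fl = first_ix_neq_last_ix[OF card]
  \<comment> \<open>The coordinates of the null vector that \<open>g\<close> produces: pairing them with \<open>y\<close> is pairing the original one with \<open>g y\<close>.\<close>
  define nv where "nv j = g $ first_ix $ j + g $ last_ix $ j" for j
  define v :: "(quat, 'n) vec" where "v = (\<chi> j. qcnj (nv j))"
  have form: "(\<Sum>j\<in>UNIV. (if j = first_ix then 1 else -1) * (g $ a $ j * qcnj (g $ b $ j))) = lorentz_form $ a $ b" for a b
  proof -
    have "(g ** lorentz_form ** conj_transpose g) $ a $ b = lorentz_form $ a $ b"
      by (simp only: indef_unitary_inverse(3)[OF isom_indef[OF g]])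
    moreover have "(g ** lorentz_form ** conj_transpose g) $ a $ b
      = (\<Sum>j\<in>UNIV. (if j = first_ix then 1 else -1) * (g $ a $ j * qcnj (g $ b $ j)))"
      unfolding matrix_mult_nth[of "g ** lorentz_form"] lorentz_form_mult_nth by (intro sum.cong) auto
    ultimately show ?thesis by simp
  qed
  have "(\<Sum>j\<in>UNIV. (if j = first_ix then 1 else -1) * (nv j * qcnj (nv j)))
    = (\<Sum>j\<in>UNIV. (if j = first_ix then 1 else -1) * (g $ first_ix $ j * qcnj (g $ first_ix $ j)))
      + (\<Sum>j\<in>UNIV. (if j = first_ix then 1 else -1) * (g $ first_ix $ j * qcnj (g $ last_ix $ j)))
      + (\<Sum>j\<in>UNIV. (if j = first_ix then 1 else -1) * (g $ last_ix $ j * qcnj (g $ first_ix $ j)))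
      + (\<Sum>j\<in>UNIV. (if j = first_ix then 1 else -1) * (g $ last_ix $ j * qcnj (g $ last_ix $ j)))"
    unfolding nv_def sum.distrib[symmetric] by (intro sum.cong) (auto simp: algebra_simps)
  also have "\<dots> = lorentz_form $ first_ix $ (first_ix :: 'n) + lorentz_form $ first_ix $ (last_ix :: 'n)
      + lorentz_form $ last_ix $ (first_ix :: 'n) + lorentz_form $ last_ix $ (last_ix :: 'n)"
    by (simp only: form)
  also have "\<dots> = 0" using fl fl[symmetric] by (simp add: lorentz_form_def)
  finally have "(of_real 0 :: quat) = of_real (\<Sum>j\<in>UNIV. (if j = first_ix then 1 else -1) * (norm (nv j))\<^sup>2)"
    by (simp only: of_real_sum of_real_0 quat_mult_cnj if_distrib[of of_real] of_real_mult of_real_1 of_real_minus)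
  then have "0 = (\<Sum>j\<in>UNIV. (if j = first_ix then 1 else -1) * (norm (nv j))\<^sup>2)"
    by (simp only: of_real_eq_iff)
  also have "\<dots> = (norm (nv first_ix))\<^sup>2 - (\<Sum>j\<in>-{first_ix}. (norm (nv j))\<^sup>2)"
    by (subst sum.remove[of _ first_ix]) (auto simp: Compl_eq_Diff_UNIV sum_negf[symmetric] intro!: sum.cong)
  finally have norm: "(norm (qcnj (nv first_ix)))\<^sup>2 = (\<Sum>j\<in>-{first_ix}. (norm (v $ j))\<^sup>2)"
    by (simp add: v_def)
  obtain m0 :: 'n where m0: "m0 \<noteq> first_ix" "m0 \<noteq> last_ix" using third_index[OF card] by metis
  obtain R where R: "R \<in> plane_rotations F (-{first_ix})" "(R *v v) $ last_ix = qcnj (nv first_ix)"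
    "\<forall>i\<in>-{first_ix} - {last_ix}. (R *v v) $ i = 0"
    using plane_rotations_transitive[of last_ix "-{first_ix}" m0 v F, OF _ _ _ _ _ norm] m0 fl isom_over[OF g]
    by (auto simp: v_def nv_def)
  have RK: "R \<in> max_compact F" using plane_rotations_group[OF R(1)] by auto
  have Rf: "(R *v v) $ first_ix = qcnj (nv first_ix)"
    using plane_rotations_fix[OF R(1), of first_ix v] by (simp add: v_def)
  define k where "k = conj_transpose R"
  have k: "k \<in> max_compact F" unfolding k_def using max_compact_inverse(1)[OF RK] .
  define g' where "g' = g ** k"
  have row: "g' $ first_ix $ s + g' $ last_ix $ s = (if s = first_ix \<or> s = last_ix then nv first_ix else 0)" for s
  proof -
    have "g' $ first_ix $ s + g' $ last_ix $ s = (\<Sum>j\<in>UNIV. nv j * qcnj (R $ s $ j))"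
      by (simp add: g'_def k_def matrix_mult_nth nv_def distrib_right sum.distrib)
    also have "\<dots> = qcnj ((R *v v) $ s)"
      by (simp add: matrix_vector_mult_def v_def qcnj_sum)
    also have "\<dots> = (if s = first_ix \<or> s = last_ix then nv first_ix else 0)"
      using R(2,3) Rf by auto
    finally show ?thesis .
  qed
  have g': "g' \<in> isom_matrices F"
    unfolding g'_def using isom_matrices_mult g k max_compact_subset_isom by blast
  have gk: "coset F g' = coset F g" unfolding g'_def by (rule coset_mult_compact[OF k])
  have "busemann (g' <#\<^bsub>isom_group F\<^esub> Y) = busemann (coset F g) + busemann Y" if Y: "Y \<in> hyp_space F" for Y
  proof -
    obtain y where y: "y \<in> isom_matrices F" "Y = coset F y" using Y by (auto simp: hyp_space_iff)
    have "(g' ** y) $ first_ix $ first_ix + (g' ** y) $ last_ix $ first_ix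
      = (\<Sum>s\<in>UNIV. (g' $ first_ix $ s + g' $ last_ix $ s) * y $ s $ first_ix)"
      by (simp add: matrix_mult_nth distrib_right sum.distrib)
    also have "\<dots> = nv first_ix * (y $ first_ix $ first_ix + y $ last_ix $ first_ix)"
      unfolding row by (subst sum_two_indices[OF fl]) (auto simp: distrib_left)
    finally have *: "(g' ** y) $ first_ix $ first_ix + (g' ** y) $ last_ix $ first_ix
      = nv first_ix * (y $ first_ix $ first_ix + y $ last_ix $ first_ix)" .
    have "nv first_ix \<noteq> 0" using first_plus_last_nonzero[OF card g] by (simp add: nv_def)
    then show ?thesis
      unfolding y(2) act_coset busemann_coset[OF card isom_matrices_mult[OF g' y(1)]]
        busemann_coset[OF card g] busemann_coset[OF card y(1)] *
      using first_plus_last_nonzero[OF card y(1)] by (simp add: norm_mult ln_mult nv_def)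
  qed
  then show ?thesis using g' gk by blast
qed

text \<open>Plane rotations by different angles carry the region near one boundary point to disjoint
  regions of equal mass.\<close>

lemma boundary_mass:
  assumes card: "3 \<le> CARD('n::{finite,linorder})" and "0 < \<eta>"
  shows "\<exists>\<delta>>0. \<forall>\<mu> :: 'n::{finite,linorder} qmat set measure. prob_space \<mu> \<longrightarrow> sets \<mu> = sets (hyp_borel F) \<longrightarrow>
    (\<forall>R\<in>plane_rotations F (-{first_ix}). distr \<mu> (hyp_borel F) (\<lambda>X. R <#\<^bsub>isom_group F\<^esub> X) = \<mu>) \<longrightarrow>
    measure \<mu> {X \<in> hyp_space F. norm (1 + ball_point X $ last_ix) < \<delta>} \<le> \<eta>"
proof -
  note fl = first_ix_neq_last_ix[OF card]
  obtain m :: 'n where m: "m \<noteq> first_ix" "m \<noteq> last_ix" using third_index[OF card] by metis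
  obtain N :: nat where N: "0 < N" "1 / N \<le> \<eta>"
    using reals_Archimedean[OF \<open>0 < \<eta>\<close>] by (metis inverse_eq_divide less_imp_le zero_less_Suc)
  \<comment> \<open>\<open>N\<close> angles in \<open>[0, \<pi>]\<close>, where the cosine is injective.\<close>
  define \<theta> where "\<theta> j = real j / N" for j :: nat
  have cos_ne: "cos (\<theta> i) \<noteq> cos (\<theta> j)" if "i < N" "j < N" "i \<noteq> j" for i j
  proof
    assume eq: "cos (\<theta> i) = cos (\<theta> j)"
    have "\<theta> i \<le> 1" "\<theta> j \<le> 1" "0 \<le> \<theta> i" "0 \<le> \<theta> j" using that N by (auto simp: \<theta>_def)
    then have "\<theta> i = \<theta> j" using cos_inj_pi[of "\<theta> i" "\<theta> j"] pi_ge_two eq by linarith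
    then show False using that N by (simp add: \<theta>_def)
  qed
  define D where "D = Min (insert 1 ((\<lambda>(i, j). (cos (\<theta> i) - cos (\<theta> j))\<^sup>2) ` {(i, j). i < N \<and> j < N \<and> i \<noteq> j}))"
  have fin: "finite {(i, j). i < N \<and> j < N \<and> i \<noteq> j}"
    by (rule finite_subset[of _ "{..<N} \<times> {..<N}"]) auto
  have D: "0 < D" "\<And>i j. i < N \<Longrightarrow> j < N \<Longrightarrow> i \<noteq> j \<Longrightarrow> D \<le> (cos (\<theta> i) - cos (\<theta> j))\<^sup>2"
  proof -
    show "0 < D" unfolding D_def using fin cos_ne by (subst Min_gr_iff) auto
    show "D \<le> (cos (\<theta> i) - cos (\<theta> j))\<^sup>2" if "i < N" "j < N" "i \<noteq> j" for i j
      unfolding D_def using fin that by (intro Min_le) auto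
  qed
  \<comment> \<open>Two vectors at distance less than the root of \<open>2\<delta>\<close> from a third one have squared distance less than \<open>8\<delta>\<close>.\<close>
  define \<delta> where "\<delta> = D / 8"
  show ?thesis
  proof (intro exI[of _ \<delta>] conjI allI impI)
    show "0 < \<delta>" using D(1) by (simp add: \<delta>_def)
    fix \<mu> :: "'n qmat set measure"
    assume \<mu>: "prob_space \<mu>" "sets \<mu> = sets (hyp_borel F)"
      and inv: "\<forall>R\<in>plane_rotations F (-{first_ix}). distr \<mu> (hyp_borel F) (\<lambda>X. R <#\<^bsub>isom_group F\<^esub> X) = \<mu>"
    interpret prob_space \<mu> by fact
    have sp: "space \<mu> = hyp_space F" using sets_eq_imp_space_eq[OF \<mu>(2)] by simp
    define A where "A j = {X \<in> hyp_space F. norm (1 + (of_real (sin (\<theta> j)) * ball_point X $ m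
      + of_real (cos (\<theta> j)) * ball_point X $ last_ix)) < \<delta>}" for j
    have A_sets: "A j \<in> sets \<mu>" for j
    proof -
      have "{X \<in> space (hyp_borel F). norm (1 + (of_real (sin (\<theta> j)) * ball_point X $ m
        + of_real (cos (\<theta> j)) * ball_point X $ last_ix)) < \<delta>} \<in> sets (hyp_borel F)" by measurable
      then show ?thesis by (simp add: A_def \<mu>(2))
    qed
    have A0: "A 0 = {X \<in> hyp_space F. norm (1 + ball_point X $ last_ix) < \<delta>}" by (simp add: A_def \<theta>_def)
    have same: "prob (A j) = prob (A 0)" for j
    proof -
      define R :: "'n qmat" where "R = plane_block m last_ix (of_real (cos (\<theta> j))) (of_real (- sin (\<theta> j)))
        (of_real (sin (\<theta> j))) (of_real (cos (\<theta> j))) ** mat 1"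
      have R: "R \<in> plane_rotations F (-{first_ix})"
        unfolding R_def using m fl special_unitary2_rotation by (intro plane_rotations.intros) auto
      then have meas: "(\<lambda>X. R <#\<^bsub>isom_group F\<^esub> X) \<in> measurable \<mu> (hyp_borel F)"
        using measurable_act[of R F] plane_rotations_group[OF R] measurable_cong_sets[OF \<mu>(2) refl] by blast
      have "prob (A 0) = measure (distr \<mu> (hyp_borel F) (\<lambda>X. R <#\<^bsub>isom_group F\<^esub> X)) (A 0)"
        using inv R by simp
      also have "\<dots> = prob ((\<lambda>X. R <#\<^bsub>isom_group F\<^esub> X) -` A 0 \<inter> space \<mu>)"
        using A_sets \<mu>(2) by (intro measure_distr[OF meas]) auto
      also have "(\<lambda>X. R <#\<^bsub>isom_group F\<^esub> X) -` A 0 \<inter> space \<mu> = A j"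
      proof -
        have "R <#\<^bsub>isom_group F\<^esub> X \<in> A 0 \<longleftrightarrow> X \<in> A j" if X: "X \<in> hyp_space F" for X
          using ball_point_rotation(1)[OF card X R] act_hyp_space[of R F X] plane_rotations_group[OF R] X
          unfolding A0 unfolding A_def by (simp add: R_def plane_block_vec_nth[OF m(2)] m(2)[symmetric])
        then show ?thesis by (auto simp: sp A_def)
      qed
      finally show ?thesis by simp
    qed
    have "disjoint_family_on A {..<N}"
      unfolding disjoint_family_on_def
    proof (intro ballI impI, rule ccontr)
      fix i j assume ij: "i \<in> {..<N}" "j \<in> {..<N}" "i \<noteq> j" and "A i \<inter> A j \<noteq> {}"
      then obtain X where X: "X \<in> A i" "X \<in> A j" by blast
      then obtain g where g: "g \<in> isom_matrices F" "X = coset F g" by (auto simp: A_def hyp_space_iff)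
      define x where "x = qRe (ball_point X $ m)"
      define y where "y = qRe (ball_point X $ last_ix)"
      have "x\<^sup>2 + y\<^sup>2 \<le> (norm (ball_point X $ m))\<^sup>2 + (norm (ball_point X $ last_ix))\<^sup>2"
        unfolding x_def y_def using abs_qRe_le_norm
        by (intro add_mono) (simp_all add: abs_le_square_iff[symmetric])
      also have "\<dots> = (\<Sum>i\<in>{m, last_ix}. (norm (ball_point X $ i))\<^sup>2)" using m by simp
      also have "\<dots> \<le> (\<Sum>i\<in>-{first_ix}. (norm (ball_point X $ i))\<^sup>2)"
        using m fl by (intro sum_mono2) auto
      also have "\<dots> = (tanh (hyp_dist F X (hyp_origin F)))\<^sup>2"
        unfolding g(2) by (rule ball_point_norm[OF card g(1)])
      also have "\<dots> \<le> 1" using tanh_real_bounds[of "hyp_dist F X (hyp_origin F)"]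
        by (simp add: abs_square_le_1 abs_le_iff less_imp_le)
      finally have xy: "x\<^sup>2 + y\<^sup>2 \<le> 1" .
      have close: "(sin (\<theta> l) + x)\<^sup>2 + (cos (\<theta> l) + y)\<^sup>2 < 2 * \<delta>" if "X \<in> A l" for l
      proof -
        let ?q = "1 + (of_real (sin (\<theta> l)) * ball_point X $ m + of_real (cos (\<theta> l)) * ball_point X $ last_ix)"
        have "1 + (sin (\<theta> l) * x + cos (\<theta> l) * y) = qRe ?q" by (simp add: x_def y_def)
        also have "\<dots> \<le> norm ?q" using abs_qRe_le_norm[of ?q] by linarith
        also have "\<dots> < \<delta>" using that by (simp add: A_def)
        finally have "1 + (sin (\<theta> l) * x + cos (\<theta> l) * y) < \<delta>" .
        moreover have "(sin (\<theta> l) + x)\<^sup>2 + (cos (\<theta> l) + y)\<^sup>2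
          = ((sin (\<theta> l))\<^sup>2 + (cos (\<theta> l))\<^sup>2) + 2 * (sin (\<theta> l) * x + cos (\<theta> l) * y) + (x\<^sup>2 + y\<^sup>2)"
          by (simp add: power2_eq_square algebra_simps)
        ultimately show ?thesis using xy by simp
      qed
      have "(cos (\<theta> i) - cos (\<theta> j))\<^sup>2 \<le> 2 * (cos (\<theta> i) + y)\<^sup>2 + 2 * (cos (\<theta> j) + y)\<^sup>2"
      proof -
        have "0 \<le> ((cos (\<theta> i) + y) + (cos (\<theta> j) + y))\<^sup>2" by simp
        then show ?thesis by (simp add: power2_eq_square algebra_simps)
      qed
      also have "\<dots> < 8 * \<delta>"
        using close[OF X(1)] close[OF X(2)] zero_le_power2[of "sin (\<theta> i) + x"] zero_le_power2[of "sin (\<theta> j) + x"]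
        by linarith
      finally show False using D(2)[of i j] ij by (simp add: \<delta>_def)
    qed
    then have "prob (\<Union>j\<in>{..<N}. A j) = (\<Sum>j\<in>{..<N}. prob (A j))"
      using A_sets by (intro finite_measure_finite_Union) auto
    also have "\<dots> = (\<Sum>j\<in>{..<N}. prob (A 0))" by (intro sum.cong refl same)
    also have "\<dots> = N * prob (A 0)" by simp
    finally have "N * prob (A 0) \<le> 1" using prob_le_1 by metis
    then have "prob (A 0) \<le> 1 / N" using N(1) by (simp add: field_simps)
    then show "prob {X \<in> hyp_space F. norm (1 + ball_point X $ last_ix) < \<delta>} \<le> \<eta>"
      using N(2) unfolding A0 by linarith
  qed
qed

section \<open>Laws of a radial random walk\<close>

text \<open>Invariance of the kernel is stated for images of sets; since \<open>g\<close> acts bijectively, it is the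
  equivariance of the measures.\<close>

lemma invariant_kernel_push:
  fixes \<kappa> :: "'n::{finite,linorder} qmat set \<Rightarrow> 'n qmat set measure"
  assumes inv: "invariant_kernel F \<kappa>" and \<kappa>: "\<kappa> \<in> measurable (hyp_borel F) (prob_algebra (hyp_borel F))"
    and g: "g \<in> isom_matrices F" and X: "X \<in> hyp_space F"
  shows "\<kappa> (g <#\<^bsub>isom_group F\<^esub> X) = distr (\<kappa> X) (hyp_borel F) (\<lambda>Y. g <#\<^bsub>isom_group F\<^esub> Y)"
proof (rule measure_eqI)
  have sets: "sets (\<kappa> Y) = sets (hyp_borel F)" if "Y \<in> hyp_space F" for Y
    using measurable_space[OF \<kappa>, of Y] that by (simp add: space_prob_algebra)
  have gX: "g <#\<^bsub>isom_group F\<^esub> X \<in> hyp_space F" using act_hyp_space[OF g X] .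
  show "sets (\<kappa> (g <#\<^bsub>isom_group F\<^esub> X)) = sets (distr (\<kappa> X) (hyp_borel F) (\<lambda>Y. g <#\<^bsub>isom_group F\<^esub> Y))"
    using sets[OF gX] by simp
  fix A assume "A \<in> sets (\<kappa> (g <#\<^bsub>isom_group F\<^esub> X))"
  then have A: "A \<in> sets (hyp_borel F)" using sets[OF gX] by simp
  then have A_sub: "A \<subseteq> hyp_space F" using sets.sets_into_space by fastforce
  define B where "B = (\<lambda>Y. g <#\<^bsub>isom_group F\<^esub> Y) -` A \<inter> space (hyp_borel F)"
  have B: "B \<in> sets (hyp_borel F)" unfolding B_def using measurable_act[OF g] A by (rule measurable_sets)
  have "(\<lambda>Y. g <#\<^bsub>isom_group F\<^esub> Y) ` B = A"
  proof (intro equalityI subsetI)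
    fix Y assume Y: "Y \<in> A"
    let ?h = "lorentz_form ** conj_transpose g ** lorentz_form"
    have Ys: "Y \<in> hyp_space F" using Y A_sub by blast
    have "g <#\<^bsub>isom_group F\<^esub> (?h <#\<^bsub>isom_group F\<^esub> Y) = Y"
      using act_mult[OF Ys] act_1[OF Ys] indef_unitary_inverse(2)[OF isom_indef[OF g]] by simp
    moreover have "?h <#\<^bsub>isom_group F\<^esub> Y \<in> hyp_space F"
      by (rule act_hyp_space[OF isom_matrices_inverse[OF g] Ys])
    ultimately show "Y \<in> (\<lambda>Y. g <#\<^bsub>isom_group F\<^esub> Y) ` B"
      using Y by (intro image_eqI[of _ _ "?h <#\<^bsub>isom_group F\<^esub> Y"]) (auto simp: B_def)
  qed (auto simp: B_def)
  then have "emeasure (\<kappa> (g <#\<^bsub>isom_group F\<^esub> X)) A = emeasure (\<kappa> X) B"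
    using inv g X B unfolding invariant_kernel_def by (metis isom_group_simps(1))
  also have "\<dots> = emeasure (distr (\<kappa> X) (hyp_borel F) (\<lambda>Y. g <#\<^bsub>isom_group F\<^esub> Y)) A"
    using A measurable_act[OF g] sets_eq_imp_space_eq[OF sets[OF X]]
    by (subst emeasure_distr) (auto simp: B_def measurable_cong_sets[OF sets[OF X] refl])
  finally show "emeasure (\<kappa> (g <#\<^bsub>isom_group F\<^esub> X)) A
    = emeasure (distr (\<kappa> X) (hyp_borel F) (\<lambda>Y. g <#\<^bsub>isom_group F\<^esub> Y)) A" .
qed

lemma hyp_dist_nonneg:
  fixes X Y :: "'n::{finite,linorder} qmat set"
  assumes "3 \<le> CARD('n)" "X \<in> hyp_space F" "Y \<in> hyp_space F"
  shows "0 \<le> hyp_dist F X Y"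
proof -
  obtain g h where gh: "g \<in> isom_matrices F" "X = coset F g" "h \<in> isom_matrices F" "Y = coset F h"
    using assms by (auto simp: hyp_space_iff)
  have "lorentz_inverse h ** g \<in> isom_matrices F"
    using gh isom_matrices_inverse isom_matrices_mult unfolding lorentz_inverse_def by blast
  then have "1 \<le> norm ((lorentz_inverse h ** g) $ first_ix $ first_ix)" by (rule isom_first_ge_1)
  then show ?thesis using hyp_dist_coset[OF assms(1) gh(1,3)] gh by simp
qed

locale radial_walk =
  fixes F :: base_field and P :: "'w measure" and S :: "nat \<Rightarrow> 'w \<Rightarrow> 'n::{finite,linorder} qmat set"
    and \<kappa> :: "'n qmat set \<Rightarrow> 'n qmat set measure"
  assumes card: "3 \<le> CARD('n)"
    and invariant: "invariant_kernel F \<kappa>"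
    and chain: "markov_chain P (hyp_borel F) \<kappa> (hyp_origin F) S"
begin

sublocale prob_space P
  using chain by (simp add: markov_chain_def)

abbreviation E :: "'n qmat set measure" where "E \<equiv> hyp_borel F"

lemma kernel: "\<kappa> \<in> measurable E (prob_algebra E)"
  and measurable_S [measurable]: "S n \<in> measurable P E"
  and S_0: "AE \<omega> in P. S 0 \<omega> = hyp_origin F"
  using chain by (auto simp: markov_chain_def)

lemma kernel_sets: "X \<in> hyp_space F \<Longrightarrow> sets (\<kappa> X) = sets E"
  and kernel_prob: "X \<in> hyp_space F \<Longrightarrow> prob_space (\<kappa> X)"
  using measurable_space[OF kernel, of X] by (simp_all add: space_prob_algebra)

definition law :: "nat \<Rightarrow> 'n qmat set measure" where
  "law n = distr P E (S n)"

lemma sets_law [simp, measurable_cong]: "sets (law n) = sets E"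
  and space_law [simp]: "space (law n) = hyp_space F"
  by (simp_all add: law_def)

lemma prob_space_law: "prob_space (law n)"
  unfolding law_def by (rule prob_space_distr) measurable

lemma law_0: "law 0 = return E (hyp_origin F)"
proof -
  have "law 0 = distr P E (\<lambda>_. hyp_origin F)"
    unfolding law_def using S_0 hyp_origin_in_space[of F]
    by (intro distr_cong_AE measurable_const) auto
  also have "\<dots> = return E (hyp_origin F)" by (rule distr_const) (simp add: hyp_origin_in_space)
  finally show ?thesis .
qed

text \<open>Integrating the conditional probabilities of the Markov property gives the one-dimensional laws.
  These suffice for the characteristic functions below.\<close>

lemma law_Suc: "law (Suc n) = law n \<bind> \<kappa>"
proof (rule measure_eqI)
  have sb: "sets (law n \<bind> \<kappa>) = sets E"
    by (rule sets_bind) (use kernel_sets hyp_origin_in_space in auto)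
  then show "sets (law (Suc n)) = sets (law n \<bind> \<kappa>)" by simp
  fix A assume "A \<in> sets (law (Suc n))"
  then have A: "A \<in> sets E" by simp
  let ?past = "sigma (space P) (\<Union>i\<in>{..n}. {S i -` B \<inter> space P |B. B \<in> sets E})"
  let ?I = "indicator (S (Suc n) -` A \<inter> space P) :: 'w \<Rightarrow> real"
  have "subalgebra P ?past"
  proof -
    have "(\<Union>i\<in>{..n}. {S i -` B \<inter> space P |B. B \<in> sets E}) \<subseteq> sets P"
      using measurable_S by (auto intro: measurable_sets)
    moreover have "(\<Union>i\<in>{..n}. {S i -` B \<inter> space P |B. B \<in> sets E}) \<subseteq> Pow (space P)" by auto
    ultimately show ?thesis
      by (simp add: subalgebra_def space_measure_of sets_measure_of sets.sigma_sets_subset)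
  qed
  then interpret sub: finite_measure_subalgebra P ?past
    by unfold_locales
  have cond: "AE \<omega> in P. real_cond_exp P ?past ?I \<omega> = measure (\<kappa> (S n \<omega>)) A"
    using chain A unfolding markov_chain_def by blast
  have inS: "S n \<omega> \<in> hyp_space F" if "\<omega> \<in> space P" for \<omega>
    using measurable_space[OF measurable_S that] by simp
  have meas: "(\<lambda>X. measure (\<kappa> X) A) \<in> borel_measurable E"
    using measurable_compose[OF kernel measurable_measure_prob_algebra[OF A]] .
  have mS: "(\<lambda>\<omega>. measure (\<kappa> (S n \<omega>)) A) \<in> borel_measurable P"
    by (rule measurable_compose[OF measurable_S meas])
  have bounded: "measure (\<kappa> (S n \<omega>)) A \<le> 1" if "\<omega> \<in> space P" for \<omega>
    using prob_space.prob_le_1[OF kernel_prob[OF inS[OF that]]] .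
  have SA: "S (Suc n) -` A \<inter> space P \<in> sets P" using measurable_S A by (rule measurable_sets)
  have "emeasure (law (Suc n)) A = emeasure P (S (Suc n) -` A \<inter> space P)"
    unfolding law_def using A by (intro emeasure_distr) auto
  also have "\<dots> = ennreal (\<integral>\<omega>. ?I \<omega> \<partial>P)"
    using SA by (simp add: emeasure_eq_measure)
  also have "(\<integral>\<omega>. ?I \<omega> \<partial>P) = (\<integral>\<omega>. real_cond_exp P ?past ?I \<omega> \<partial>P)"
    using SA by (intro sub.real_cond_exp_int(2)[symmetric]) (auto simp: integrable_indicator_iff emeasure_eq_measure)
  also have "\<dots> = (\<integral>\<omega>. measure (\<kappa> (S n \<omega>)) A \<partial>P)"
    using cond mS by (intro integral_cong_AE) auto
  also have "ennreal \<dots> = (\<integral>\<^sup>+\<omega>. ennreal (measure (\<kappa> (S n \<omega>)) A) \<partial>P)"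
    using mS bounded
    by (intro nn_integral_eq_integral[symmetric] integrable_const_bound[of _ 1]) auto
  also have "\<dots> = (\<integral>\<^sup>+\<omega>. emeasure (\<kappa> (S n \<omega>)) A \<partial>P)"
    by (intro nn_integral_cong)
      (simp add: finite_measure.emeasure_eq_measure[OF prob_space.finite_measure[OF kernel_prob[OF inS]]])
  also have "\<dots> = (\<integral>\<^sup>+X. emeasure (\<kappa> X) A \<partial>law n)"
    unfolding law_def
    by (rule nn_integral_distr[symmetric])
       (use measurable_compose[OF measurable_prob_algebraD[OF kernel] measurable_emeasure_subprob_algebra[OF A]] in simp_all)
  also have "\<dots> = emeasure (law n \<bind> \<kappa>) A"
    using hyp_origin_in_space[of F] measurable_prob_algebraD[OF kernel] A
    by (intro emeasure_bind[symmetric, where N = E]) (auto simp: measurable_cong_sets[OF sets_law refl])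
  finally show "emeasure (law (Suc n)) A = emeasure (law n \<bind> \<kappa>) A" .
qed

lemma law_1: "law (Suc 0) = \<kappa> (hyp_origin F)"
  unfolding law_Suc law_0
  by (rule bind_return[OF measurable_prob_algebraD[OF kernel]]) (simp add: hyp_origin_in_space)

lemma kernel': "\<kappa> \<in> measurable (law n) (subprob_algebra E)"
  using measurable_prob_algebraD[OF kernel] by (simp add: measurable_cong_sets[OF sets_law refl])

lemma law_nonempty: "space (law n) \<noteq> {}"
  using hyp_origin_in_space[of F] by auto

text \<open>The origin is fixed by \<open>K\<close> and the kernel commutes with \<open>K\<close>.\<close>

lemma law_invariant:
  assumes R: "R \<in> max_compact F"
  shows "distr (law n) E (\<lambda>X. R <#\<^bsub>isom_group F\<^esub> X) = law n"
proof (induction n)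
  case 0
  have Ri: "R \<in> isom_matrices F" using R max_compact_subset_isom by blast
  show ?case
    unfolding law_0 using act_compact_origin[OF R] hyp_origin_in_space[of F]
    by (subst distr_return[OF measurable_act[OF Ri]]) auto
next
  case (Suc n)
  have Ri: "R \<in> isom_matrices F" using R max_compact_subset_isom by blast
  note act = measurable_act[OF Ri]
  have act': "(\<lambda>X. R <#\<^bsub>isom_group F\<^esub> X) \<in> measurable (law n) E"
    using act by (simp add: measurable_cong_sets[OF sets_law refl])
  have "distr (law (Suc n)) E (\<lambda>X. R <#\<^bsub>isom_group F\<^esub> X)
    = law n \<bind> (\<lambda>X. distr (\<kappa> X) E (\<lambda>X. R <#\<^bsub>isom_group F\<^esub> X))"
    unfolding law_Suc by (rule distr_bind[OF kernel' law_nonempty act])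
  also have "\<dots> = law n \<bind> (\<lambda>X. \<kappa> (R <#\<^bsub>isom_group F\<^esub> X))"
    using invariant_kernel_push[OF invariant kernel Ri] by (intro bind_cong) auto
  also have "\<dots> = distr (law n) E (\<lambda>X. R <#\<^bsub>isom_group F\<^esub> X) \<bind> \<kappa>"
    by (rule bind_distr[OF act' measurable_prob_algebraD[OF kernel] law_nonempty, symmetric])
  also have "\<dots> = law (Suc n)" by (simp add: Suc law_Suc)
  finally show ?case .
qed

definition busemann_law :: "nat \<Rightarrow> real measure" where
  "busemann_law n = distr (law n) borel busemann"

lemma real_distribution_busemann_law: "real_distribution (busemann_law n)"
  unfolding busemann_law_def real_distribution_def real_distribution_axioms_def
  by (auto intro!: prob_space.prob_space_distr[OF prob_space_law])

text \<open>Seen from any point, the increment of the Busemann function has the law of the first step; this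
  makes the laws of the Busemann function along the walk convolution powers.\<close>

lemma kernel_busemann:
  assumes X: "X \<in> hyp_space F"
  shows "distr (\<kappa> X) borel busemann = distr (busemann_law (Suc 0)) borel (\<lambda>y. busemann X + y)"
proof -
  obtain g where g: "g \<in> isom_matrices F" "X = coset F g" using X by (auto simp: hyp_space_iff)
  obtain g' where g': "g' \<in> isom_matrices F" "coset F g' = coset F g"
    "\<And>Y. Y \<in> hyp_space F \<Longrightarrow> busemann (g' <#\<^bsub>isom_group F\<^esub> Y) = busemann (coset F g) + busemann Y"
    using busemann_cocycle[OF card g(1)] by blast
  have Xg: "X = g' <#\<^bsub>isom_group F\<^esub> hyp_origin F" using g g' by (simp add: hyp_origin_eq act_coset)
  have act: "(\<lambda>Y. g' <#\<^bsub>isom_group F\<^esub> Y) \<in> measurable (law (Suc 0)) E"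
    using measurable_act[OF g'(1)] by (simp add: measurable_cong_sets[OF sets_law refl])
  have "distr (\<kappa> X) borel busemann = distr (distr (law (Suc 0)) E (\<lambda>Y. g' <#\<^bsub>isom_group F\<^esub> Y)) borel busemann"
    unfolding law_1 Xg invariant_kernel_push[OF invariant kernel g'(1) hyp_origin_in_space] ..
  also have "\<dots> = distr (law (Suc 0)) borel (\<lambda>Y. busemann (g' <#\<^bsub>isom_group F\<^esub> Y))"
    using act by (subst distr_distr) (auto simp: comp_def)
  also have "\<dots> = distr (law (Suc 0)) borel (\<lambda>Y. busemann X + busemann Y)"
    using g'(3) g(2) by (intro distr_cong) auto
  also have "\<dots> = distr (busemann_law (Suc 0)) borel (\<lambda>y. busemann X + y)"
    unfolding busemann_law_def by (subst distr_distr) (auto simp: comp_def)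
  finally show ?thesis .
qed

lemma busemann_law_Suc: "busemann_law (Suc n) = (busemann_law n \<star> busemann_law (Suc 0))"
proof (rule measure_eqI)
  show "sets (busemann_law (Suc n)) = sets (busemann_law n \<star> busemann_law (Suc 0))"
    by (simp add: busemann_law_def)
  fix A assume "A \<in> sets (busemann_law (Suc n))"
  then have A: "A \<in> sets borel" by (simp add: busemann_law_def)
  interpret B1: real_distribution "busemann_law (Suc 0)" by (rule real_distribution_busemann_law)
  interpret Bn: real_distribution "busemann_law n" by (rule real_distribution_busemann_law)
  have bA: "busemann -` A \<inter> hyp_space F \<in> sets E"
    using measurable_sets[OF measurable_busemann[of F] A] by simp
  have "emeasure (busemann_law (Suc n)) A = emeasure (law (Suc n)) (busemann -` A \<inter> hyp_space F)"
    unfolding busemann_law_def using A by (subst emeasure_distr) auto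
  also have "\<dots> = (\<integral>\<^sup>+X. emeasure (\<kappa> X) (busemann -` A \<inter> hyp_space F) \<partial>law n)"
    unfolding law_Suc by (rule emeasure_bind[OF law_nonempty kernel' bA])
  also have "\<dots> = (\<integral>\<^sup>+X. emeasure (busemann_law (Suc 0)) {a. a + busemann X \<in> A} \<partial>law n)"
  proof (rule nn_integral_cong)
    fix X assume "X \<in> space (law n)"
    then have X: "X \<in> hyp_space F" by simp
    have "emeasure (\<kappa> X) (busemann -` A \<inter> hyp_space F) = emeasure (distr (\<kappa> X) borel busemann) A"
      using A kernel_sets[OF X] sets_eq_imp_space_eq[OF kernel_sets[OF X]]
      by (subst emeasure_distr) (auto simp: measurable_cong_sets[OF kernel_sets[OF X] refl])
    also have "\<dots> = emeasure (busemann_law (Suc 0)) {a. a + busemann X \<in> A}"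
      unfolding kernel_busemann[OF X] using A
      by (subst emeasure_distr) (auto simp: vimage_def add.commute)
    finally show "emeasure (\<kappa> X) (busemann -` A \<inter> hyp_space F)
      = emeasure (busemann_law (Suc 0)) {a. a + busemann X \<in> A}" .
  qed
  also have "\<dots> = (\<integral>\<^sup>+x. emeasure (busemann_law (Suc 0)) {a. a + x \<in> A} \<partial>busemann_law n)"
  proof -
    have "(\<lambda>p. snd p + fst p) -` A \<inter> space (borel \<Otimes>\<^sub>M busemann_law (Suc 0)) \<in> sets (borel \<Otimes>\<^sub>M busemann_law (Suc 0))"
      using A by (rule measurable_sets[rotated]) measurable
    from B1.measurable_emeasure_Pair[OF this] have "(\<lambda>x. emeasure (busemann_law (Suc 0)) {a. a + x \<in> A}) \<in> borel_measurable borel"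
      by (simp add: space_pair_measure vimage_def)
    then show ?thesis
      unfolding busemann_law_def[of n] by (intro nn_integral_distr[symmetric]) (auto simp: busemann_law_def)
  qed
  also have "\<dots> = emeasure (busemann_law n \<star> busemann_law (Suc 0)) A"
    by (rule convolution_emeasure[symmetric]) (use A in \<open>auto intro: B1.finite_measure_axioms Bn.finite_measure_axioms\<close>)
  finally show "emeasure (busemann_law (Suc n)) A = emeasure (busemann_law n \<star> busemann_law (Suc 0)) A" .
qed

end

lemma char_convolution:
  assumes "real_distribution M" "real_distribution N"
  shows "char (M \<star> N) t = char M t * char N t"
proof -
  interpret M: real_distribution M by fact
  interpret N: real_distribution N by fact
  interpret MN: pair_prob_space M N ..
  have int: "integrable (M \<Otimes>\<^sub>M N) (\<lambda>(x, y). iexp (t * (x + y)))"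
    by (rule MN.integrable_const_bound[of _ 1]) auto
  have "char (M \<star> N) t = (\<integral>p. (case p of (x, y) \<Rightarrow> iexp (t * (x + y))) \<partial>(M \<Otimes>\<^sub>M N))"
    unfolding char_def convolution_def
    by (subst integral_distr) (auto simp: split_beta')
  also have "\<dots> = (\<integral>x. \<integral>y. iexp (t * (x + y)) \<partial>N \<partial>M)"
    using MN.integral_fst'[OF int] by simp
  also have "\<dots> = (\<integral>x. iexp (t * x) * (\<integral>y. iexp (t * y) \<partial>N) \<partial>M)"
    by (simp add: distrib_left exp_add)
  also have "\<dots> = char M t * char N t" by (simp add: char_def)
  finally show ?thesis .
qed

context radial_walk
begin

lemma char_busemann_law: "char (busemann_law n) t = char (busemann_law (Suc 0)) t ^ n"
proof (induction n)
  case 0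
  have "busemann (coset F (mat 1 :: 'n qmat))
      = ln (norm ((mat 1 :: 'n qmat) $ first_ix $ first_ix + (mat 1 :: 'n qmat) $ last_ix $ first_ix))"
    by (rule busemann_coset[OF card mat_1_in_isom_matrices])
  also have "\<dots> = 0" using first_ix_neq_last_ix[OF card] by (simp add: mat_def)
  finally have "busemann (hyp_origin F :: 'n qmat set) = 0" by (simp only: hyp_origin_eq)
  then have "busemann_law 0 = return borel 0"
    unfolding busemann_law_def law_0 by (subst distr_return) (auto simp: hyp_origin_in_space)
  then show ?case by (simp add: char_def integral_return)
next
  case (Suc n)
  then show ?case
    using busemann_law_Suc[of n] char_convolution[OF real_distribution_busemann_law real_distribution_busemann_law]
    by simp
qed

lemma step_distance:
  assumes "associated_with F P S \<nu>"
  shows "distr (law (Suc 0)) borel_half_line (\<lambda>X. hyp_dist F X (hyp_origin F)) = \<nu>"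
proof -
  have \<nu>: "distr P borel_half_line (\<lambda>\<omega>. hyp_dist F (S 0 \<omega>) (S (Suc 0) \<omega>)) = \<nu>"
    using assms by (simp add: associated_with_def)
  have inS: "S n \<omega> \<in> hyp_space F" if "\<omega> \<in> space P" for n \<omega>
    using measurable_space[OF measurable_S that] by simp
  have m1: "(\<lambda>X. hyp_dist F X (hyp_origin F)) \<in> measurable E borel_half_line"
    using measurable_hyp_dist_origin[OF card] hyp_dist_nonneg[OF card _ hyp_origin_in_space]
    by (intro measurable_restrict_space2) auto
  have "(\<lambda>\<omega>. (S 0 \<omega>, S (Suc 0) \<omega>)) \<in> measurable P (E \<Otimes>\<^sub>M E)" by measurable
  from measurable_compose[OF this measurable_hyp_dist[OF card]]
  have m2: "(\<lambda>\<omega>. hyp_dist F (S 0 \<omega>) (S (Suc 0) \<omega>)) \<in> measurable P borel_half_line"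
    using hyp_dist_nonneg[OF card] inS by (intro measurable_restrict_space2) auto
  have "distr (law (Suc 0)) borel_half_line (\<lambda>X. hyp_dist F X (hyp_origin F))
      = distr P borel_half_line (\<lambda>\<omega>. hyp_dist F (S (Suc 0) \<omega>) (hyp_origin F))"
    unfolding law_def using m1 by (subst distr_distr) (auto simp: comp_def)
  also have "\<dots> = distr P borel_half_line (\<lambda>\<omega>. hyp_dist F (S 0 \<omega>) (S (Suc 0) \<omega>))"
  proof (rule distr_cong_AE)
    have sym: "hyp_dist F X (hyp_origin F) = hyp_dist F (hyp_origin F) X" if "X \<in> hyp_space F" for X :: "'n qmat set"
      using that hyp_dist_origin[OF card] by (auto simp: hyp_space_iff)
    show "AE \<omega> in P. hyp_dist F (S (Suc 0) \<omega>) (hyp_origin F) = hyp_dist F (S 0 \<omega>) (S (Suc 0) \<omega>)"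
      using S_0 AE_space by eventually_elim (use sym inS in auto)
    show "(\<lambda>\<omega>. hyp_dist F (S (Suc 0) \<omega>) (hyp_origin F)) \<in> measurable P borel_half_line"
      by (rule measurable_compose[OF measurable_S m1])
  qed (use m2 in auto)
  finally show ?thesis using \<nu> by simp
qed

lemma law_rotation_invariant:
  assumes "R \<in> plane_rotations F (-{first_ix})"
  shows "distr (law n) E (\<lambda>X. R <#\<^bsub>isom_group F\<^esub> X) = law n"
  using law_invariant plane_rotations_group[OF assms] by auto

end

text \<open>All laws of all walks are rotation invariant, so a single bound for the mass near the boundary
  point applies to them.\<close>

lemma dist_minus_busemann_tight:
  assumes card: "3 \<le> CARD('n::{finite,linorder})" and "0 < \<eta>"
  shows "\<exists>C>0. \<forall>(P :: 'w measure) (S :: nat \<Rightarrow> 'w \<Rightarrow> 'n::{finite,linorder} qmat set) \<kappa> n.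
    radial_walk F P S \<kappa> \<longrightarrow>
    measure (radial_walk.law F P S n) {X \<in> hyp_space F. C < \<bar>hyp_dist F X (hyp_origin F) - busemann X\<bar>} \<le> \<eta>"
proof -
  from boundary_mass[OF assms, of F]
  obtain \<delta> where \<delta>: "0 < \<delta>" "\<forall>\<mu> :: 'n qmat set measure. prob_space \<mu> \<longrightarrow> sets \<mu> = sets (hyp_borel F) \<longrightarrow>
    (\<forall>R\<in>plane_rotations F (-{first_ix}). distr \<mu> (hyp_borel F) (\<lambda>X. R <#\<^bsub>isom_group F\<^esub> X) = \<mu>) \<longrightarrow>
    measure \<mu> {X \<in> hyp_space F. norm (1 + ball_point X $ last_ix) < \<delta>} \<le> \<eta>"
    by (elim exE conjE)
  define C where "C = max 1 (ln 2 - ln \<delta>)"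
  show ?thesis
  proof (intro exI[of _ C] conjI allI impI)
    show "0 < C" by (simp add: C_def)
    fix P :: "'w measure" and S :: "nat \<Rightarrow> 'w \<Rightarrow> 'n qmat set" and \<kappa> n
    assume w: "radial_walk F P S \<kappa>"
    interpret radial_walk F P S \<kappa> by fact
    interpret L: prob_space "law n" by (rule prob_space_law)
    have "{X \<in> hyp_space F :: 'n qmat set set. C < \<bar>hyp_dist F X (hyp_origin F) - busemann X\<bar>}
      \<subseteq> {X \<in> hyp_space F. norm (1 + ball_point X $ last_ix) < \<delta>}"
    proof
      fix X :: "'n qmat set" assume "X \<in> {X \<in> hyp_space F. C < \<bar>hyp_dist F X (hyp_origin F) - busemann X\<bar>}"
      then have X: "X \<in> hyp_space F" "C < \<bar>hyp_dist F X (hyp_origin F) - busemann X\<bar>" by auto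
      obtain g where g: "g \<in> isom_matrices F" "X = coset F g" using X(1) by (auto simp: hyp_space_iff)
      have nz: "0 < norm (1 + ball_point X $ last_ix)"
        using one_plus_ball_point_nonzero[OF card g(1)] g(2) by simp
      have "ln 2 - ln \<delta> < ln 2 - ln (norm (1 + ball_point X $ last_ix))"
        using X(2) dist_minus_busemann[OF card X(1)] unfolding C_def by linarith
      then show "X \<in> {X \<in> hyp_space F. norm (1 + ball_point X $ last_ix) < \<delta>}"
        using nz \<delta>(1) X(1) by simp
    qed
    moreover have "{X \<in> hyp_space F. norm (1 + ball_point X $ last_ix) < \<delta>} \<in> sets (law n)"
    proof -
      have "{X \<in> space E. norm (1 + ball_point X $ last_ix) < \<delta>} \<in> sets E" by measurable
      then show ?thesis by simp
    qed
    ultimately have "L.prob {X \<in> hyp_space F. C < \<bar>hyp_dist F X (hyp_origin F) - busemann X\<bar>}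
      \<le> L.prob {X \<in> hyp_space F. norm (1 + ball_point X $ last_ix) < \<delta>}"
      by (rule L.finite_measure_mono)
    also have "\<dots> \<le> \<eta>"
      using \<delta>(2)[THEN spec, of "law n"] prob_space_law[of n] law_rotation_invariant[of _ n] by simp
    finally show "L.prob {X \<in> hyp_space F. C < \<bar>hyp_dist F X (hyp_origin F) - busemann X\<bar>} \<le> \<eta>" .
  qed
qed

section \<open>Taylor expansions\<close>

text \<open>Turns an asymptotic expansion at zero into an inequality with explicit constants on an interval,
  which can then be integrated.\<close>

lemma bigo_zero_bound:
  fixes f :: "real \<Rightarrow> real"
  assumes "f \<in> O[at_right 0](\<lambda>x. x ^ m)" "f 0 = 0"
  obtains C \<delta> where "0 \<le> C" "0 < \<delta>" "\<And>x. 0 \<le> x \<Longrightarrow> x \<le> \<delta> \<Longrightarrow> \<bar>f x\<bar> \<le> C * x ^ m"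
proof -
  obtain c where c: "0 < c" "eventually (\<lambda>x. norm (f x) \<le> c * norm (x ^ m)) (at_right 0)"
    using assms(1) by (rule landau_o.bigE)
  then obtain b where b: "0 < b" "\<And>x. 0 < x \<Longrightarrow> x < b \<Longrightarrow> norm (f x) \<le> c * norm (x ^ m)"
    by (auto simp: eventually_at_right_field)
  show ?thesis
  proof (rule that[of c "b / 2"])
    fix x :: real assume "0 \<le> x" "x \<le> b / 2"
    then show "\<bar>f x\<bar> \<le> c * x ^ m"
      using b c(1) assms(2) by (cases "x = 0") (auto simp: abs_of_nonneg)
  qed (use b c in auto)
qed

lemma ln_one_plus_expansion:
  "\<exists>C\<ge>0. \<exists>\<delta>>0. \<forall>q :: real. \<bar>q\<bar> \<le> \<delta> \<longrightarrow>
     \<bar>ln (1 + q) - (q - q\<^sup>2 / 2 + q ^ 3 / 3 - q ^ 4 / 4)\<bar> \<le> C * \<bar>q\<bar> ^ 5"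
proof -
  have "(\<lambda>q::real. ln (1 + q) - (q - q\<^sup>2 / 2 + q ^ 3 / 3 - q ^ 4 / 4)) \<in> O[at_right 0](\<lambda>q. q ^ 5)"
    by real_asymp
  from bigo_zero_bound[OF this] obtain C \<delta> where 1: "0 \<le> C" "0 < \<delta>"
    "\<And>q :: real. 0 \<le> q \<Longrightarrow> q \<le> \<delta> \<Longrightarrow> \<bar>ln (1 + q) - (q - q\<^sup>2 / 2 + q ^ 3 / 3 - q ^ 4 / 4)\<bar> \<le> C * q ^ 5"
    by auto
  have "(\<lambda>q::real. ln (1 - q) - (- q - q\<^sup>2 / 2 - q ^ 3 / 3 - q ^ 4 / 4)) \<in> O[at_right 0](\<lambda>q. q ^ 5)"
    by real_asymp
  from bigo_zero_bound[OF this] obtain C' \<delta>' where 2: "0 \<le> C'" "0 < \<delta>'"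
    "\<And>q :: real. 0 \<le> q \<Longrightarrow> q \<le> \<delta>' \<Longrightarrow> \<bar>ln (1 - q) - (- q - q\<^sup>2 / 2 - q ^ 3 / 3 - q ^ 4 / 4)\<bar> \<le> C' * q ^ 5"
    by auto
  have "\<bar>ln (1 + q) - (q - q\<^sup>2 / 2 + q ^ 3 / 3 - q ^ 4 / 4)\<bar> \<le> max C C' * \<bar>q\<bar> ^ 5"
    if q: "\<bar>q\<bar> \<le> min \<delta> \<delta>'" for q
    proof (cases "0 \<le> q")
      case True
      have "\<bar>ln (1 + q) - (q - q\<^sup>2 / 2 + q ^ 3 / 3 - q ^ 4 / 4)\<bar> \<le> C * q ^ 5" using 1(3)[of q] q True by simp
      also have "\<dots> \<le> max C C' * \<bar>q\<bar> ^ 5" using True by (intro mult_mono) (auto simp: 1 le_max_iff_disj)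
      finally show ?thesis .
    next
      case False
      have "\<bar>ln (1 + q) - (q - q\<^sup>2 / 2 + q ^ 3 / 3 - q ^ 4 / 4)\<bar> \<le> C' * (- q) ^ 5"
        using 2(3)[of "- q"] q False by (simp add: power_minus_odd)
      also have "\<dots> \<le> max C C' * \<bar>q\<bar> ^ 5" using False by (intro mult_mono) (auto simp: 2 le_max_iff_disj)
      finally show ?thesis .
    qed
  moreover have "0 \<le> max C C'" "0 < min \<delta> \<delta>'" using 1 2 by auto
  ultimately show ?thesis by blast
qed

lemma tanh_square_expansion:
  "\<exists>C\<ge>0. \<exists>\<delta>>0. \<forall>h :: real. 0 \<le> h \<longrightarrow> h \<le> \<delta> \<longrightarrow> \<bar>(tanh h)\<^sup>2 - (h\<^sup>2 - 2 / 3 * h ^ 4)\<bar> \<le> C * h ^ 5"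
proof -
  have "(\<lambda>h::real. (tanh h)\<^sup>2 - (h\<^sup>2 - 2 / 3 * h ^ 4)) \<in> O[at_right 0](\<lambda>h. h ^ 5)"
    unfolding tanh_altdef by real_asymp
  from bigo_zero_bound[OF this] obtain C \<delta> where "0 \<le> C" "0 < \<delta>"
    "\<And>h :: real. 0 \<le> h \<Longrightarrow> h \<le> \<delta> \<Longrightarrow> \<bar>(tanh h)\<^sup>2 - (h\<^sup>2 - 2 / 3 * h ^ 4)\<bar> \<le> C * h ^ 5"
    by auto
  then show ?thesis by blast
qed

lemma ln_cosh_expansion:
  "\<exists>C\<ge>0. \<exists>\<delta>>0. \<forall>h :: real. 0 \<le> h \<longrightarrow> h \<le> \<delta> \<longrightarrow> \<bar>ln (cosh h) - (h\<^sup>2 / 2 - h ^ 4 / 12)\<bar> \<le> C * h ^ 5"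
proof -
  have "(\<lambda>h::real. ln (cosh h) - (h\<^sup>2 / 2 - h ^ 4 / 12)) \<in> O[at_right 0](\<lambda>h. h ^ 5)"
    unfolding cosh_field_def by real_asymp
  from bigo_zero_bound[OF this] obtain C \<delta> where "0 \<le> C" "0 < \<delta>"
    "\<And>h :: real. 0 \<le> h \<Longrightarrow> h \<le> \<delta> \<Longrightarrow> \<bar>ln (cosh h) - (h\<^sup>2 / 2 - h ^ 4 / 12)\<bar> \<le> C * h ^ 5"
    by auto
  then show ?thesis by blast
qed

text \<open>The Busemann function in terms of \<open>u = Re \<zeta>\<close>, \<open>w = |\<zeta>|\<^sup>2\<close> and the distance \<open>h\<close>; all monomials
  whose total degree exceeds four are absorbed into the remainder.\<close>

definition busemann_poly :: "real \<Rightarrow> real \<Rightarrow> real \<Rightarrow> real" where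
  "busemann_poly u w h = u + w / 2 - u\<^sup>2 - u * w - w\<^sup>2 / 4 + 4 / 3 * u ^ 3 + 2 * (u\<^sup>2 * w) - 2 * u ^ 4
     + h\<^sup>2 / 2 - h ^ 4 / 12"

lemma busemann_poly_expansion:
  "\<exists>C\<ge>0. \<exists>\<delta>>0. \<forall>u w h :: real. 0 \<le> h \<longrightarrow> h \<le> \<delta> \<longrightarrow> \<bar>u\<bar> \<le> h \<longrightarrow> 0 \<le> w \<longrightarrow> w \<le> h\<^sup>2 \<longrightarrow>
      \<bar>ln (1 + (2 * u + w)) / 2 + ln (cosh h) - busemann_poly u w h\<bar> \<le> C * h ^ 5"
proof -
  obtain C1 \<delta>1 where 1: "0 \<le> C1" "0 < \<delta>1"
    "\<And>q :: real. \<bar>q\<bar> \<le> \<delta>1 \<Longrightarrow> \<bar>ln (1 + q) - (q - q\<^sup>2 / 2 + q ^ 3 / 3 - q ^ 4 / 4)\<bar> \<le> C1 * \<bar>q\<bar> ^ 5"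
    using ln_one_plus_expansion by blast
  obtain C2 \<delta>2 where 2: "0 \<le> C2" "0 < \<delta>2"
    "\<And>h :: real. 0 \<le> h \<Longrightarrow> h \<le> \<delta>2 \<Longrightarrow> \<bar>ln (cosh h) - (h\<^sup>2 / 2 - h ^ 4 / 12)\<bar> \<le> C2 * h ^ 5"
    using ln_cosh_expansion by blast
  have "\<bar>ln (1 + (2 * u + w)) / 2 + ln (cosh h) - busemann_poly u w h\<bar> \<le> (C1 * 243 + C2 + 100) * h ^ 5"
    if h: "0 \<le> h" "h \<le> min 1 (min (\<delta>1 / 3) \<delta>2)" and u: "\<bar>u\<bar> \<le> h" and w: "0 \<le> w" "w \<le> h\<^sup>2"
    for u w h :: real
  proof -
    have h1: "h \<le> 1" and h2: "h \<le> \<delta>2" and h3: "3 * h \<le> \<delta>1" using h by auto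
    define q where "q = 2 * u + w"
    have "h\<^sup>2 \<le> h" using h(1) h1 power_le_one_iff by (simp add: power2_eq_square mult_left_le)
    then have q: "\<bar>q\<bar> \<le> 3 * h" using u w unfolding q_def by linarith
    \<comment> \<open>The constants are \<open>3\<^sup>5 = 243\<close> and a crude bound, \<open>100\<close>, for the sum of the coefficients of the dropped monomials.\<close>
    have "\<bar>ln (1 + q) - (q - q\<^sup>2 / 2 + q ^ 3 / 3 - q ^ 4 / 4)\<bar> \<le> C1 * \<bar>q\<bar> ^ 5"
      using 1(3)[of q] q h3 by simp
    also have "\<dots> \<le> C1 * (3 * h) ^ 5" using q by (intro mult_left_mono power_mono 1) auto
    also have "\<dots> = C1 * 243 * h ^ 5" by (simp add: power_mult_distrib)
    finally have A: "\<bar>ln (1 + q) - (q - q\<^sup>2 / 2 + q ^ 3 / 3 - q ^ 4 / 4)\<bar> \<le> C1 * 243 * h ^ 5" .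
    have B: "\<bar>ln (cosh h) - (h\<^sup>2 / 2 - h ^ 4 / 12)\<bar> \<le> C2 * h ^ 5" using 2(3)[of h] h(1) h2 .
    have mono: "\<bar>u ^ a * w ^ b\<bar> \<le> h ^ 5" if "5 \<le> a + 2 * b" for a b
    proof -
      have "\<bar>u ^ a * w ^ b\<bar> \<le> h ^ a * (h\<^sup>2) ^ b"
        unfolding abs_mult power_abs using u w by (intro mult_mono power_mono) (auto simp: h(1))
      also have "\<dots> = h ^ (a + 2 * b)" by (simp add: power_add power_mult)
      also have "\<dots> \<le> h ^ 5" using h(1) h1 that by (rule power_decreasing[rotated 1])
      finally show ?thesis .
    qed
    have C: "(q - q\<^sup>2 / 2 + q ^ 3 / 3 - q ^ 4 / 4) / 2 + (h\<^sup>2 / 2 - h ^ 4 / 12) - busemann_poly u w h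
      = u ^ 1 * w ^ 2 + (u ^ 0 * w ^ 3) / 6 - 4 * (u ^ 3 * w ^ 1) - 3 * (u ^ 2 * w ^ 2) - u ^ 1 * w ^ 3 - (u ^ 0 * w ^ 4) / 8"
      unfolding q_def busemann_poly_def by (simp add: power2_eq_square power3_eq_cube power4_eq_xxxx field_simps)
    have D: "\<bar>(q - q\<^sup>2 / 2 + q ^ 3 / 3 - q ^ 4 / 4) / 2 + (h\<^sup>2 / 2 - h ^ 4 / 12) - busemann_poly u w h\<bar> \<le> 100 * h ^ 5"
      unfolding C using mono[of 1 2] mono[of 0 3] mono[of 3 1] mono[of 2 2] mono[of 1 3] mono[of 0 4]
      by (simp only: abs_le_iff) linarith
    have "\<bar>a / 2 + c - b\<bar> \<le> x + y + z" if "\<bar>a - p\<bar> \<le> x" "\<bar>c - r\<bar> \<le> y" "\<bar>p / 2 + r - b\<bar> \<le> z"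
      for a b c p r x y z :: real
      using that by linarith
    from this[OF A B D]
    have "\<bar>ln (1 + q) / 2 + ln (cosh h) - busemann_poly u w h\<bar> \<le> C1 * 243 * h ^ 5 + C2 * h ^ 5 + 100 * h ^ 5" .
    then show "\<bar>ln (1 + (2 * u + w)) / 2 + ln (cosh h) - busemann_poly u w h\<bar> \<le> (C1 * 243 + C2 + 100) * h ^ 5"
      by (simp add: q_def distrib_right)
  qed
  moreover have "0 \<le> C1 * 243 + C2 + 100" "0 < min 1 (min (\<delta>1 / 3) \<delta>2)" using 1 2 by auto
  ultimately show ?thesis by blast
qed

section \<open>Moments of a rotation invariant law\<close>

lemma special_unitary2_phase:
  assumes "p \<in> scalars F" "norm p = 1"
  shows "special_unitary2 F p 0 0 (qcnj p)"
  using assms by (auto simp: special_unitary2_def quat_mult_cnj)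

definition scalar_units :: "base_field \<Rightarrow> quat set" where
  "scalar_units F = Basis \<inter> scalars F"

lemma scalar_units_cases:
  "scalar_units Real_Field = {Quat 1 0 0 0}"
  "scalar_units Complex_Field = {Quat 1 0 0 0, Quat 0 1 0 0}"
  "scalar_units Quaternion_Field = {Quat 1 0 0 0, Quat 0 1 0 0, Quat 0 0 1 0, Quat 0 0 0 1}"
  by (auto simp: scalar_units_def Basis_quat_def)

lemma card_scalar_units: "card (scalar_units F) = dim (scalars F)"
  by (cases F) (simp_all add: scalar_units_cases dim_scalars del: scalars.simps)

lemma norm_scalar_units: "e \<in> scalar_units F \<Longrightarrow> norm e = 1"
  by (simp add: scalar_units_def)

lemma sum_scalar_units:
  assumes "x \<in> scalars F"
  shows "(\<Sum>e\<in>scalar_units F. (qRe (e * x))\<^sup>2) = (norm x)\<^sup>2"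
  using assms by (cases F) (simp_all add: scalar_units_cases norm_quat_power2)

text \<open>The phases \<open>p\<close> and \<open>p\<^sup>*\<close> on two coordinates multiply the real part of \<open>\<zeta>\<^sub>i \<zeta>\<^sub>j\<^sup>*\<close> by \<open>p\<^sup>2\<close>, so that square roots of units are
  called for.\<close>

lemma scalar_units_sqrt:
  assumes "e \<in> scalar_units F"
  obtains p where "p \<in> scalars F" "norm p = 1" "p * p = e"
proof (cases "e = 1")
  case True
  then show ?thesis using that[of 1] by simp
next
  case False
  define p where "p = (1 + e) /\<^sub>R sqrt 2"
  have e: "e \<in> scalars F" "e * e = - 1"
    using assms False by (auto simp: scalar_units_def Basis_quat_def quat_eq_iff)
  have re: "qRe e = 0" "norm e = 1"
    using assms False by (auto simp: scalar_units_def Basis_quat_def quat_eq_iff norm_quat_def)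
  have "(norm (1 + e))\<^sup>2 = 2"
    using re norm_quat_power2[of e] unfolding norm_quat_power2[of "1 + e"] by simp
  then have "norm (1 + e) = sqrt 2" by (metis norm_ge_zero real_sqrt_unique)
  then have "norm p = 1" by (simp add: p_def)
  moreover have "p \<in> scalars F" unfolding p_def using e(1) by simp
  moreover have "p * p = e"
  proof -
    have "2 * (inverse (sqrt 2) * inverse (sqrt 2)) = 1" by (simp add: field_simps)
    then show ?thesis
      unfolding p_def using e(2) by (simp add: algebra_simps flip: scaleR_add_left scaleR_2)
  qed
  ultimately show ?thesis using that by blast
qed

text \<open>A finite set of units over which fourth powers of real parts average as over the whole unit
  sphere of \<open>F\<close> (for the quaternions, up to sign, the 24 Hurwitz units).\<close>

definition quartic_units :: "base_field \<Rightarrow> quat list" where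
  "quartic_units F = (case F of Real_Field \<Rightarrow> [1]
   | Complex_Field \<Rightarrow> [Quat 1 0 0 0, Quat 0 1 0 0, Quat (1 / sqrt 2) (1 / sqrt 2) 0 0, Quat (1 / sqrt 2) (- 1 / sqrt 2) 0 0]
   | Quaternion_Field \<Rightarrow> [Quat 1 0 0 0, Quat 0 1 0 0, Quat 0 0 1 0, Quat 0 0 0 1] @
       [Quat (1/2) b c e. b \<leftarrow> [1/2, -1/2], c \<leftarrow> [1/2, -1/2], e \<leftarrow> [1/2, -1/2]])"

lemma quartic_units_unit: "p \<in> set (quartic_units F) \<Longrightarrow> p \<in> scalars F \<and> norm p = 1"
  by (cases F) (auto simp: quartic_units_def norm_quat_def power2_eq_square)

lemma hurwitz_quartic_identity:
  fixes a b c e :: real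
  shows "24 * (2 * a) ^ 4 + (24 * (2 * b) ^ 4 + (24 * (2 * c) ^ 4 + (24 * (2 * e) ^ 4 +
    (24 * (a - b - c - e) ^ 4 + (24 * (a - b - c + e) ^ 4 + (24 * (a - b + c - e) ^ 4 +
    (24 * (a - b + c + e) ^ 4 + (24 * (a + b - c - e) ^ 4 + (24 * (a + b - c + e) ^ 4 +
    (24 * (a + b + c - e) ^ 4 + 24 * (a + b + c + e) ^ 4))))))))))
    = 36 * ((2 * a)\<^sup>2 + (2 * b)\<^sup>2 + (2 * c)\<^sup>2 + (2 * e)\<^sup>2)\<^sup>2"
  by algebra

lemma sum_quartic_units:
  assumes "x \<in> scalars F"
  defines "d \<equiv> real (dim (scalars F))"
  shows "d * (d + 2) * (\<Sum>p\<leftarrow>quartic_units F. (qRe (p * x)) ^ 4) = 3 * length (quartic_units F) * ((norm x)\<^sup>2)\<^sup>2"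
proof (cases F)
  case Real_Field
  obtain a where x: "x = Quat a 0 0 0" using assms Real_Field by (cases x) auto
  then show ?thesis
    using Real_Field unfolding d_def
    by (simp add: dim_scalars quartic_units_def norm_quat_power2 del: scalars.simps)
next
  case Complex_Field
  obtain a b where x: "x = Quat a b 0 0" using assms Complex_Field by (cases x) auto
  define s :: real where "s = 1 / sqrt 2"
  have s: "s * s = 1 / 2" by (simp add: s_def)
  have "s ^ 4 = (s * s) * (s * s)" by (simp add: power4_eq_xxxx mult.assoc)
  then have s4: "s ^ 4 = 1 / 4" unfolding s by simp
  have "a ^ 4 + b ^ 4 + (s * a - s * b) ^ 4 + (s * a + s * b) ^ 4 = 3 / 2 * (a\<^sup>2 + b\<^sup>2)\<^sup>2"
    using s4 by algebra
  then show ?thesis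
    using Complex_Field unfolding d_def
    by (simp add: dim_scalars quartic_units_def norm_quat_power2 x s_def del: scalars.simps)
next
  case Quaternion_Field
  show ?thesis
    using Quaternion_Field hurwitz_quartic_identity[of "qRe x / 2" "qI x / 2" "qJ x / 2" "qK x / 2"]
    unfolding d_def
    by (simp add: dim_scalars quartic_units_def norm_quat_power2 del: scalars.simps)
qed

text \<open>Rotations about the origin act linearly on the ball model and preserve the distance. Hence the
  moments of the coordinates of a random point are multiples of those of its radius, with the
  factors of the uniform distribution on a sphere.\<close>

locale rotation_invariant_law = prob_space \<mu>
  for \<mu> :: "'n::{finite,linorder} qmat set measure" +
  fixes F :: base_field and k :: nat
  assumes dim: "2 \<le> k" "CARD('n) = k + 1"
    and sets_eq: "sets \<mu> = sets (hyp_borel F)"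
    and invariant: "R \<in> plane_rotations F (-{first_ix}) \<Longrightarrow>
      distr \<mu> (hyp_borel F) (\<lambda>X. R <#\<^bsub>isom_group F\<^esub> X) = \<mu>"
begin

lemma space_eq [simp]: "space \<mu> = hyp_space F"
  using sets_eq_imp_space_eq[OF sets_eq] by simp

lemma measurable_law [simp]: "measurable \<mu> N = measurable (hyp_borel F) N"
  by (rule measurable_cong_sets[OF sets_eq refl])

abbreviation \<zeta> :: "'n \<Rightarrow> 'n qmat set \<Rightarrow> quat" where "\<zeta> i X \<equiv> ball_point X $ i"
abbreviation \<tau> :: "'n qmat set \<Rightarrow> real" where "\<tau> X \<equiv> tanh (hyp_dist F X (hyp_origin F))"

abbreviation d :: real where "d \<equiv> real (dim (scalars F))"

lemma card: "3 \<le> CARD('n)" using dim by simp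

lemma card_space: "card (-{first_ix :: 'n}) = k"
  using dim by (simp add: Compl_eq_Diff_UNIV card_Diff_singleton)

lemma \<zeta>_scalars: "X \<in> hyp_space F \<Longrightarrow> \<zeta> i X \<in> scalars F"
  using ball_point_scalars[OF card] by (auto simp: hyp_space_iff)

lemma \<zeta>_norm_sum: "X \<in> hyp_space F \<Longrightarrow> (\<Sum>i\<in>-{first_ix}. (norm (\<zeta> i X))\<^sup>2) = (\<tau> X)\<^sup>2"
  using ball_point_norm[OF card] by (auto simp: hyp_space_iff)

lemma \<zeta>_norm: "X \<in> hyp_space F \<Longrightarrow> i \<noteq> first_ix \<Longrightarrow> (norm (\<zeta> i X))\<^sup>2 \<le> (\<tau> X)\<^sup>2"
  unfolding \<zeta>_norm_sum[symmetric] by (intro member_le_sum) auto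

lemma \<tau>_le_1: "(\<tau> X)\<^sup>2 \<le> 1"
  using tanh_real_bounds[of "hyp_dist F X (hyp_origin F)"]
  by (simp add: abs_square_le_1 abs_le_iff less_imp_le)

lemma \<zeta>_norm_1: "X \<in> hyp_space F \<Longrightarrow> i \<noteq> first_ix \<Longrightarrow> norm (\<zeta> i X) \<le> 1"
  using \<zeta>_norm[of X i] \<tau>_le_1[of X] by (metis abs_norm_cancel abs_square_le_1 order_trans)

lemma integrable_bounded:
  fixes f :: "'n qmat set \<Rightarrow> real"
  assumes "f \<in> borel_measurable (hyp_borel F)" "\<And>X. X \<in> hyp_space F \<Longrightarrow> \<bar>f X\<bar> \<le> B"
  shows "integrable \<mu> f"
  using assms by (intro integrable_const_bound[of _ B]) auto

lemma expectation_rotate: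
  fixes \<phi> :: "(quat, 'n) vec \<Rightarrow> real"
  assumes "R \<in> plane_rotations F (-{first_ix})"
    and "(\<lambda>X. \<phi> (ball_point X)) \<in> borel_measurable (hyp_borel F)"
  shows "expectation (\<lambda>X. \<phi> (R *v ball_point X)) = expectation (\<lambda>X. \<phi> (ball_point X))"
proof -
  have act: "(\<lambda>X. R <#\<^bsub>isom_group F\<^esub> X) \<in> measurable \<mu> (hyp_borel F)"
    using measurable_act[of R F] plane_rotations_group[OF assms(1)] by simp
  have "expectation (\<lambda>X. \<phi> (ball_point X))
      = integral\<^sup>L (distr \<mu> (hyp_borel F) (\<lambda>X. R <#\<^bsub>isom_group F\<^esub> X)) (\<lambda>X. \<phi> (ball_point X))"
    by (simp add: invariant[OF assms(1)])
  also have "\<dots> = expectation (\<lambda>X. \<phi> (ball_point (R <#\<^bsub>isom_group F\<^esub> X)))"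
    by (rule integral_distr[OF act assms(2)])
  also have "\<dots> = expectation (\<lambda>X. \<phi> (R *v ball_point X))"
    by (intro Bochner_Integration.integral_cong) (auto simp: ball_point_rotation[OF card _ assms(1)])
  finally show ?thesis by simp
qed

lemma plane_block_rotation:
  "i \<noteq> first_ix \<Longrightarrow> j \<noteq> first_ix \<Longrightarrow> i \<noteq> j \<Longrightarrow> special_unitary2 F a b c e \<Longrightarrow>
    plane_block i j a b c e \<in> plane_rotations F (-{first_ix})"
  using plane_rotations.block[OF plane_rotations.one, of i "-{first_ix}" j F a b c e] by simp

lemma expectation_block:
  fixes \<phi> :: "quat \<Rightarrow> quat \<Rightarrow> real"
  assumes "i \<noteq> first_ix" "j \<noteq> first_ix" "i \<noteq> j" "special_unitary2 F a b c e"
    and "(\<lambda>X. \<phi> (\<zeta> i X) (\<zeta> j X)) \<in> borel_measurable (hyp_borel F)"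
  shows "expectation (\<lambda>X. \<phi> (a * \<zeta> i X + b * \<zeta> j X) (c * \<zeta> i X + e * \<zeta> j X))
    = expectation (\<lambda>X. \<phi> (\<zeta> i X) (\<zeta> j X))"
  using expectation_rotate[OF plane_block_rotation[OF assms(1-4)], of "\<lambda>v. \<phi> (v $ i) (v $ j)"] assms
  by (simp add: plane_block_vec_nth)

text \<open>A second coordinate carries the conjugate phase, which keeps the determinant equal to one.\<close>

lemma expectation_phase:
  fixes \<phi> :: "quat \<Rightarrow> real"
  assumes "i \<noteq> first_ix" "p \<in> scalars F" "norm p = 1" "(\<lambda>X. \<phi> (\<zeta> i X)) \<in> borel_measurable (hyp_borel F)"
  shows "expectation (\<lambda>X. \<phi> (p * \<zeta> i X)) = expectation (\<lambda>X. \<phi> (\<zeta> i X))"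
proof -
  obtain j :: 'n where j: "j \<noteq> first_ix" "j \<noteq> i" using third_index[OF card] by metis
  show ?thesis
    using expectation_block[OF assms(1) j(1) j(2)[symmetric] special_unitary2_phase[OF assms(2,3)], of "\<lambda>x y. \<phi> x"] assms(4)
    by simp
qed

lemma expectation_swap:
  fixes \<phi> :: "real \<Rightarrow> real"
  assumes "i \<noteq> first_ix" "j \<noteq> first_ix" "(\<lambda>X. \<phi> (norm (\<zeta> i X))) \<in> borel_measurable (hyp_borel F)"
  shows "expectation (\<lambda>X. \<phi> (norm (\<zeta> j X))) = expectation (\<lambda>X. \<phi> (norm (\<zeta> i X)))"
proof (cases "i = j")
  case False
  have "special_unitary2 F 0 (- 1) 1 0" by (simp add: special_unitary2_def)
  from expectation_block[OF assms(1,2) False this, of "\<lambda>x y. \<phi> (norm x)"] assms(3)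
  show ?thesis by simp
qed simp

lemma expectation_norm2:
  assumes l: "l \<noteq> first_ix"
  shows "k * expectation (\<lambda>X. (norm (\<zeta> l X))\<^sup>2) = expectation (\<lambda>X. (\<tau> X)\<^sup>2)"
proof -
  have "expectation (\<lambda>X. (\<tau> X)\<^sup>2) = expectation (\<lambda>X. \<Sum>i\<in>-{first_ix}. (norm (\<zeta> i X))\<^sup>2)"
    by (intro Bochner_Integration.integral_cong) (auto simp: \<zeta>_norm_sum)
  also have "\<dots> = (\<Sum>i\<in>-{first_ix}. expectation (\<lambda>X. (norm (\<zeta> i X))\<^sup>2))"
    by (intro Bochner_Integration.integral_sum integrable_bounded[of _ 1])
      (auto simp: power_le_one \<zeta>_norm_1)
  also have "\<dots> = (\<Sum>i\<in>-{first_ix :: 'n}. expectation (\<lambda>X. (norm (\<zeta> l X))\<^sup>2))"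
    by (intro sum.cong refl expectation_swap[OF l, of _ "\<lambda>x. x\<^sup>2"]) auto
  also have "\<dots> = k * expectation (\<lambda>X. (norm (\<zeta> l X))\<^sup>2)"
    by (simp add: card_space)
  finally show ?thesis by simp
qed

text \<open>Turning by 45 degrees relates \<open>E |\<zeta>\<^sub>i|\<^sup>4\<close> to the mixed moments of \<open>\<zeta>\<^sub>i\<close> and \<open>\<zeta>\<^sub>j\<close>; the phases of
  \<open>F\<close> then express \<open>E Re(\<zeta>\<^sub>i \<zeta>\<^sub>j\<^sup>*)\<^sup>2\<close> by \<open>E |\<zeta>\<^sub>i|\<^sup>2 |\<zeta>\<^sub>j|\<^sup>2\<close>.\<close>

lemma expectation_mixed:
  assumes ij: "i \<noteq> first_ix" "j \<noteq> first_ix" "i \<noteq> j"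
  shows "(d + 2) * expectation (\<lambda>X. (norm (\<zeta> i X))\<^sup>2 * (norm (\<zeta> j X))\<^sup>2)
    = d * expectation (\<lambda>X. ((norm (\<zeta> i X))\<^sup>2)\<^sup>2)"
proof -
  let ?r = "\<lambda>X. qRe (\<zeta> i X * qcnj (\<zeta> j X))"
  let ?\<alpha> = "expectation (\<lambda>X. ((norm (\<zeta> i X))\<^sup>2)\<^sup>2)"
  let ?\<beta> = "expectation (\<lambda>X. (norm (\<zeta> i X))\<^sup>2 * (norm (\<zeta> j X))\<^sup>2)"
  let ?R = "expectation (\<lambda>X. (?r X)\<^sup>2)"
  have le1: "norm (\<zeta> i X) \<le> 1" "norm (\<zeta> j X) \<le> 1" if "X \<in> hyp_space F" for X
    using \<zeta>_norm_1 that ij by auto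
  have r1: "\<bar>qRe (e * (\<zeta> i X * qcnj (\<zeta> j X)))\<bar> \<le> 1" if "X \<in> hyp_space F" "norm e = 1" for X e
    using abs_qRe_le_norm[of "e * (\<zeta> i X * qcnj (\<zeta> j X))"] le1[OF that(1)] that(2)
      mult_le_one[of "norm (\<zeta> i X)" "norm (\<zeta> j X)"]
    by (simp only: norm_mult norm_qcnj) simp
  have int: "integrable \<mu> (\<lambda>X. (qRe (e * (\<zeta> i X * qcnj (\<zeta> j X))))\<^sup>2)" if "norm e = 1" for e
    by (rule integrable_bounded[of _ 1]) (use r1[OF _ that] in \<open>auto simp: abs_square_le_1\<close>)
  have intr: "integrable \<mu> (\<lambda>X. (?r X)\<^sup>2)" using int[of 1] by simp
  have inta: "integrable \<mu> (\<lambda>X. ((norm (\<zeta> i X))\<^sup>2)\<^sup>2)" "integrable \<mu> (\<lambda>X. ((norm (\<zeta> j X))\<^sup>2)\<^sup>2)"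
    by (rule integrable_bounded[of _ 1]; use le1 in \<open>auto simp: power_le_one\<close>)+
  have intb: "integrable \<mu> (\<lambda>X. (norm (\<zeta> i X))\<^sup>2 * (norm (\<zeta> j X))\<^sup>2)"
    by (rule integrable_bounded[of _ 1]) (use le1 in \<open>auto simp: power_le_one mult_le_one\<close>)
  have \<alpha>j: "expectation (\<lambda>X. ((norm (\<zeta> j X))\<^sup>2)\<^sup>2) = ?\<alpha>"
    by (rule expectation_swap[OF ij(1,2), of "\<lambda>x. (x\<^sup>2)\<^sup>2"]) auto
  have "?\<alpha> = ?\<beta> + 2 * ?R"
  proof -
    let ?c = "1 / sqrt 2"
    let ?p = "\<lambda>X. of_real ?c * \<zeta> i X + of_real ?c * \<zeta> j X"
    let ?m = "\<lambda>X. of_real ?c * \<zeta> i X + - of_real ?c * \<zeta> j X"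
    have id: "((norm (?p X))\<^sup>2)\<^sup>2 + ((norm (?m X))\<^sup>2)\<^sup>2
      = (((norm (\<zeta> i X))\<^sup>2)\<^sup>2 + ((norm (\<zeta> j X))\<^sup>2)\<^sup>2) / 2 + (norm (\<zeta> i X))\<^sup>2 * (norm (\<zeta> j X))\<^sup>2 + 2 * (?r X)\<^sup>2" for X
    proof -
      have e: "?p X = ?c *\<^sub>R (\<zeta> i X + \<zeta> j X)" "?m X = ?c *\<^sub>R (\<zeta> i X - \<zeta> j X)"
        by (simp_all add: scaleR_conv_of_real algebra_simps)
      have n: "(norm (x + y))\<^sup>2 = (norm x)\<^sup>2 + (norm y)\<^sup>2 + 2 * qRe (x * qcnj y)"
        "(norm (x - y))\<^sup>2 = (norm x)\<^sup>2 + (norm y)\<^sup>2 - 2 * qRe (x * qcnj y)" for x y :: quat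
        unfolding norm_quat_power2 by (simp_all add: power2_eq_square algebra_simps)
      have c2: "?c\<^sup>2 = 1 / 2" by (simp add: power_divide)
      show ?thesis
        unfolding e norm_scaleR power_mult_distrib power2_abs c2 n by (simp add: power2_eq_square field_simps)
    qed
    have p1: "norm (?p X) \<le> 2" "norm (?m X) \<le> 2" if "X \<in> hyp_space F" for X
    proof -
      have "?c * norm (\<zeta> i X) \<le> 1" "?c * norm (\<zeta> j X) \<le> 1"
        using le1[OF that] by (simp_all add: field_simps) (smt (verit) real_sqrt_ge_1_iff)+
      then have b: "norm (of_real ?c * \<zeta> i X) \<le> 1" "norm (of_real ?c * \<zeta> j X) \<le> 1"
        by (simp_all only: norm_mult norm_of_real) simp_all
      show "norm (?p X) \<le> 2" using norm_triangle_ineq[of "of_real ?c * \<zeta> i X" "of_real ?c * \<zeta> j X"] b by linarith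
      show "norm (?m X) \<le> 2"
        using norm_triangle_ineq[of "of_real ?c * \<zeta> i X" "- of_real ?c * \<zeta> j X"] b by (simp add: norm_mult)
    qed
    have intp: "integrable \<mu> (\<lambda>X. ((norm (?p X))\<^sup>2)\<^sup>2)" "integrable \<mu> (\<lambda>X. ((norm (?m X))\<^sup>2)\<^sup>2)"
    proof -
      have *: "\<bar>((norm x)\<^sup>2)\<^sup>2\<bar> \<le> 16" if "norm x \<le> 2" for x :: quat
        using power_mono[OF that, of 4] by simp
      show "integrable \<mu> (\<lambda>X. ((norm (?p X))\<^sup>2)\<^sup>2)" "integrable \<mu> (\<lambda>X. ((norm (?m X))\<^sup>2)\<^sup>2)"
        by (rule integrable_bounded[of _ 16]; use p1 * in auto)+
    qed
    have c: "?c = cos (pi / 4)" "?c = sin (pi / 4)" by (simp_all add: cos_45 sin_45 real_div_sqrt field_simps)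
    have su: "special_unitary2 F (of_real ?c) (- of_real ?c) (of_real ?c) (of_real ?c)"
      "special_unitary2 F (of_real ?c) (of_real ?c) (- of_real ?c) (of_real ?c)"
      using special_unitary2_rotation[of F "pi / 4"] special_unitary2_rotation[of F "- pi / 4"]
      unfolding c[symmetric] by (simp_all add: c[symmetric])
    have m: "expectation (\<lambda>X. ((norm (?m X))\<^sup>2)\<^sup>2) = ?\<alpha>" "expectation (\<lambda>X. ((norm (?p X))\<^sup>2)\<^sup>2) = ?\<alpha>"
      using expectation_block[OF ij su(1), of "\<lambda>x y. ((norm x)\<^sup>2)\<^sup>2"]
        expectation_block[OF ij su(2), of "\<lambda>x y. ((norm x)\<^sup>2)\<^sup>2"] by simp_all
    have "2 * ?\<alpha> = expectation (\<lambda>X. ((norm (?p X))\<^sup>2)\<^sup>2 + ((norm (?m X))\<^sup>2)\<^sup>2)"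
      using m by (subst Bochner_Integration.integral_add[OF intp]) simp
    also have "\<dots> = (?\<alpha> + ?\<alpha>) / 2 + ?\<beta> + 2 * ?R"
      unfolding id using inta intb intr \<alpha>j by simp
    finally show ?thesis by simp
  qed
  moreover have "d * ?R = ?\<beta>"
  proof -
    have phase: "expectation (\<lambda>X. (qRe (e * (\<zeta> i X * qcnj (\<zeta> j X))))\<^sup>2) = ?R" if e: "e \<in> scalar_units F" for e
    proof -
      obtain p where p: "p \<in> scalars F" "norm p = 1" "p * p = e" using scalar_units_sqrt[OF e] .
      have "expectation (\<lambda>X. (qRe ((p * \<zeta> i X) * qcnj (qcnj p * \<zeta> j X)))\<^sup>2) = ?R"
        using expectation_block[OF ij special_unitary2_phase[OF p(1,2)], of "\<lambda>x y. (qRe (x * qcnj y))\<^sup>2"]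
        by simp
      moreover have "qRe ((p * x) * qcnj (qcnj p * y)) = qRe (e * (x * qcnj y))" for x y
      proof -
        have "qRe ((p * x) * qcnj (qcnj p * y)) = qRe ((p * x * qcnj y) * p)"
          by (simp only: qcnj_simps mult.assoc)
        also have "\<dots> = qRe (p * (p * x * qcnj y))" by (rule qRe_commute)
        finally show ?thesis by (simp only: p(3)[symmetric] mult.assoc)
      qed
      ultimately show ?thesis by simp
    qed
    have "?\<beta> = expectation (\<lambda>X. \<Sum>e\<in>scalar_units F. (qRe (e * (\<zeta> i X * qcnj (\<zeta> j X))))\<^sup>2)"
      by (intro Bochner_Integration.integral_cong refl)
        (simp add: sum_scalar_units \<zeta>_scalars norm_mult power_mult_distrib del: quat_sel)
    also have "\<dots> = (\<Sum>e\<in>scalar_units F. expectation (\<lambda>X. (qRe (e * (\<zeta> i X * qcnj (\<zeta> j X))))\<^sup>2))"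
      by (intro Bochner_Integration.integral_sum int norm_scalar_units)
    also have "\<dots> = d * ?R" by (simp add: phase card_scalar_units[symmetric] del: quat_sel)
    finally show ?thesis by simp
  qed
  ultimately show ?thesis by algebra
qed

text \<open>Expand the square of \<open>\<tau>\<^sup>2 = \<Sum> |\<zeta>\<^sub>i|\<^sup>2\<close>: the diagonal terms agree by symmetry, and the mixed ones are the
  fraction \<open>d / (d + 2)\<close> of them.\<close>

lemma expectation_norm4:
  assumes l: "l \<noteq> first_ix"
  shows "k * (d * k + 2) * expectation (\<lambda>X. ((norm (\<zeta> l X))\<^sup>2)\<^sup>2) = (d + 2) * expectation (\<lambda>X. ((\<tau> X)\<^sup>2)\<^sup>2)"
proof -
  let ?T = "-{first_ix :: 'n}"
  let ?\<alpha> = "expectation (\<lambda>X. ((norm (\<zeta> l X))\<^sup>2)\<^sup>2)"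
  have cT: "real (card ?T) = real k" by (simp add: card_space)
  have int: "integrable \<mu> (\<lambda>X. (norm (\<zeta> i X))\<^sup>2 * (norm (\<zeta> j X))\<^sup>2)" if "i \<in> ?T" "j \<in> ?T" for i j
    using that by (intro integrable_bounded[of _ 1]) (auto simp: power_le_one mult_le_one \<zeta>_norm_1)
  have "expectation (\<lambda>X. ((\<tau> X)\<^sup>2)\<^sup>2)
      = expectation (\<lambda>X. \<Sum>i\<in>?T. \<Sum>j\<in>?T. (norm (\<zeta> i X))\<^sup>2 * (norm (\<zeta> j X))\<^sup>2)"
    by (intro Bochner_Integration.integral_cong refl)
      (simp add: \<zeta>_norm_sum[symmetric] power2_eq_square[of "sum _ _"] sum_product)
  also have "\<dots> = (\<Sum>i\<in>?T. expectation (\<lambda>X. \<Sum>j\<in>?T. (norm (\<zeta> i X))\<^sup>2 * (norm (\<zeta> j X))\<^sup>2))"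
    by (rule Bochner_Integration.integral_sum) (intro Bochner_Integration.integrable_sum int)
  also have "\<dots> = (\<Sum>i\<in>?T. \<Sum>j\<in>?T. expectation (\<lambda>X. (norm (\<zeta> i X))\<^sup>2 * (norm (\<zeta> j X))\<^sup>2))"
    by (intro sum.cong refl Bochner_Integration.integral_sum int)
  finally have "(d + 2) * expectation (\<lambda>X. ((\<tau> X)\<^sup>2)\<^sup>2)
      = (\<Sum>i\<in>?T. \<Sum>j\<in>?T. (d + 2) * expectation (\<lambda>X. (norm (\<zeta> i X))\<^sup>2 * (norm (\<zeta> j X))\<^sup>2))"
    by (simp add: sum_distrib_left)
  also have "\<dots> = (\<Sum>i\<in>?T. \<Sum>j\<in>?T. (if j = i then (d + 2) * ?\<alpha> else d * ?\<alpha>))"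
  proof (intro sum.cong refl)
    fix i j assume ij: "i \<in> ?T" "j \<in> ?T"
    have \<alpha>: "expectation (\<lambda>X. ((norm (\<zeta> i X))\<^sup>2)\<^sup>2) = ?\<alpha>"
      using ij by (intro expectation_swap[OF l, of _ "\<lambda>x. (x\<^sup>2)\<^sup>2"]) auto
    show "(d + 2) * expectation (\<lambda>X. (norm (\<zeta> i X))\<^sup>2 * (norm (\<zeta> j X))\<^sup>2)
      = (if j = i then (d + 2) * ?\<alpha> else d * ?\<alpha>)"
    proof (cases "j = i")
      case True
      then show ?thesis using \<alpha> by (simp add: power2_eq_square mult.assoc)
    next
      case False
      then show ?thesis using expectation_mixed[of i j] ij \<alpha> by auto
    qed
  qed
  also have "\<dots> = (\<Sum>i\<in>?T. \<Sum>j\<in>?T. d * ?\<alpha> + (if j = i then 2 * ?\<alpha> else 0))"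
    by (intro sum.cong refl) (auto simp: algebra_simps)
  also have "\<dots> = (\<Sum>i\<in>?T. k * (d * ?\<alpha>) + 2 * ?\<alpha>)"
    by (intro sum.cong refl) (simp only: sum.distrib sum_constant cT, simp)
  also have "\<dots> = k * (k * (d * ?\<alpha>) + 2 * ?\<alpha>)"
    by (simp only: sum_constant cT)
  finally show ?thesis by (simp add: algebra_simps)
qed

text \<open>By the phase \<open>-1\<close>.\<close>

lemma expectation_odd:
  assumes l: "l \<noteq> first_ix"
  shows "expectation (\<lambda>X. qRe (\<zeta> l X)) = 0" "expectation (\<lambda>X. (qRe (\<zeta> l X)) ^ 3) = 0"
    "expectation (\<lambda>X. qRe (\<zeta> l X) * (norm (\<zeta> l X))\<^sup>2) = 0"
  using expectation_phase[OF l, of "- 1" "\<lambda>x. qRe x"] expectation_phase[OF l, of "- 1" "\<lambda>x. (qRe x) ^ 3"]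
    expectation_phase[OF l, of "- 1" "\<lambda>x. qRe x * (norm x)\<^sup>2"]
  by simp_all

text \<open>Average over the units of \<open>F\<close>; the squares of the \<open>d\<close> real coordinates of \<open>\<zeta>\<close> add up to \<open>|\<zeta>|\<^sup>2\<close>.\<close>

lemma expectation_re2:
  assumes l: "l \<noteq> first_ix" and \<phi>: "\<phi> \<in> borel_measurable borel" "\<And>x. \<lbrakk>0 \<le> x; x \<le> 1\<rbrakk> \<Longrightarrow> \<bar>\<phi> x\<bar> \<le> 1"
  shows "d * expectation (\<lambda>X. (qRe (\<zeta> l X))\<^sup>2 * \<phi> (norm (\<zeta> l X)))
    = expectation (\<lambda>X. (norm (\<zeta> l X))\<^sup>2 * \<phi> (norm (\<zeta> l X)))"
proof -
  note [measurable] = \<phi>(1)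
  have b: "\<bar>qRe (e * \<zeta> l X)\<bar> \<le> 1" if "X \<in> hyp_space F" "norm e = 1" for X e
    using abs_qRe_le_norm[of "e * \<zeta> l X"] \<zeta>_norm_1[OF that(1) l] that(2) by (simp add: norm_mult del: quat_sel)
  have int: "integrable \<mu> (\<lambda>X. (qRe (e * \<zeta> l X))\<^sup>2 * \<phi> (norm (\<zeta> l X)))" if "norm e = 1" for e
    by (rule integrable_bounded[of _ 1])
      (use b[OF _ that] \<phi>(2) \<zeta>_norm_1[OF _ l] in \<open>auto simp: abs_mult abs_square_le_1 intro!: mult_le_one simp del: quat_sel\<close>)
  have phase: "expectation (\<lambda>X. (qRe (e * \<zeta> l X))\<^sup>2 * \<phi> (norm (\<zeta> l X)))
    = expectation (\<lambda>X. (qRe (\<zeta> l X))\<^sup>2 * \<phi> (norm (\<zeta> l X)))" if "e \<in> scalar_units F" for e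
  proof -
    have e: "e \<in> scalars F" "norm e = 1" using that norm_scalar_units by (auto simp: scalar_units_def)
    show ?thesis
      using expectation_phase[OF l e, of "\<lambda>x. (qRe x)\<^sup>2 * \<phi> (norm x)"] e(2)
      by (simp add: norm_mult del: quat_sel)
  qed
  have "expectation (\<lambda>X. (norm (\<zeta> l X))\<^sup>2 * \<phi> (norm (\<zeta> l X)))
      = expectation (\<lambda>X. \<Sum>e\<in>scalar_units F. (qRe (e * \<zeta> l X))\<^sup>2 * \<phi> (norm (\<zeta> l X)))"
    by (intro Bochner_Integration.integral_cong refl)
      (simp add: sum_distrib_right[symmetric] sum_scalar_units \<zeta>_scalars del: quat_sel)
  also have "\<dots> = (\<Sum>e\<in>scalar_units F. expectation (\<lambda>X. (qRe (e * \<zeta> l X))\<^sup>2 * \<phi> (norm (\<zeta> l X))))"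
    by (intro Bochner_Integration.integral_sum int norm_scalar_units)
  also have "\<dots> = d * expectation (\<lambda>X. (qRe (\<zeta> l X))\<^sup>2 * \<phi> (norm (\<zeta> l X)))"
    by (simp add: phase card_scalar_units[symmetric] del: quat_sel)
  finally show ?thesis by simp
qed

lemma expectation_re4:
  assumes l: "l \<noteq> first_ix"
  shows "d * (d + 2) * expectation (\<lambda>X. (qRe (\<zeta> l X)) ^ 4) = 3 * expectation (\<lambda>X. ((norm (\<zeta> l X))\<^sup>2)\<^sup>2)"
proof -
  have b: "\<bar>qRe (e * \<zeta> l X)\<bar> \<le> 1" if "X \<in> hyp_space F" "norm e = 1" for X e
    using abs_qRe_le_norm[of "e * \<zeta> l X"] \<zeta>_norm_1[OF that(1) l] that(2) by (simp add: norm_mult del: quat_sel)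
  have int: "integrable \<mu> (\<lambda>X. (qRe (e * \<zeta> l X)) ^ 4)" if "norm e = 1" for e
    by (rule integrable_bounded[of _ 1])
      (use power_le_one[OF abs_ge_zero b[OF _ that], of _ 4] in \<open>auto simp: power_abs simp del: quat_sel\<close>)
  have sum: "expectation (\<lambda>X. \<Sum>p\<leftarrow>ps. (qRe (p * \<zeta> l X)) ^ 4) = length ps * expectation (\<lambda>X. (qRe (\<zeta> l X)) ^ 4)
    \<and> integrable \<mu> (\<lambda>X. \<Sum>p\<leftarrow>ps. (qRe (p * \<zeta> l X)) ^ 4)"
    if "\<forall>p\<in>set ps. p \<in> scalars F \<and> norm p = 1" for ps
    using that
  proof (induction ps)
    case (Cons p ps)
    have "expectation (\<lambda>X. (qRe (p * \<zeta> l X)) ^ 4) = expectation (\<lambda>X. (qRe (\<zeta> l X)) ^ 4)"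
      using expectation_phase[OF l, of p "\<lambda>x. (qRe x) ^ 4"] Cons.prems by (simp del: quat_sel)
    then show ?case
      using Cons int[of p] by (simp add: distrib_right del: quat_sel)
  qed simp
  let ?L = "quartic_units F"
  have "real (length ?L) * (d * (d + 2) * expectation (\<lambda>X. (qRe (\<zeta> l X)) ^ 4))
      = d * (d + 2) * expectation (\<lambda>X. \<Sum>p\<leftarrow>?L. (qRe (p * \<zeta> l X)) ^ 4)"
    using sum[of ?L] quartic_units_unit by simp
  also have "\<dots> = expectation (\<lambda>X. d * (d + 2) * (\<Sum>p\<leftarrow>?L. (qRe (p * \<zeta> l X)) ^ 4))"
    by (simp del: quat_sel)
  also have "\<dots> = expectation (\<lambda>X. 3 * length ?L * ((norm (\<zeta> l X))\<^sup>2)\<^sup>2)"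
    by (intro Bochner_Integration.integral_cong refl sum_quartic_units) (simp add: \<zeta>_scalars)
  also have "\<dots> = real (length ?L) * (3 * expectation (\<lambda>X. ((norm (\<zeta> l X))\<^sup>2)\<^sup>2))" by simp
  finally have "real (length ?L) * (d * (d + 2) * expectation (\<lambda>X. (qRe (\<zeta> l X)) ^ 4))
    = real (length ?L) * (3 * expectation (\<lambda>X. ((norm (\<zeta> l X))\<^sup>2)\<^sup>2))" .
  moreover have "real (length ?L) \<noteq> 0" by (cases F) (simp_all add: quartic_units_def)
  ultimately show ?thesis by simp
qed

end

section \<open>Mean and variance of one step\<close>

lemma tanh_le_self:
  assumes "0 \<le> (x :: real)"
  shows "tanh x \<le> x"
proof -
  have "0 - tanh 0 \<le> x - tanh x"
  proof (rule DERIV_nonneg_imp_nondecreasing[OF assms])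
    fix y :: real
    have "((\<lambda>y. y - tanh y) has_real_derivative (tanh y)\<^sup>2) (at y)"
      by (auto intro!: derivative_eq_intros simp: tanh_def power2_eq_square field_simps)
    then show "\<exists>z. ((\<lambda>y. y - tanh y) has_real_derivative z) (at y) \<and> 0 \<le> z" by force
  qed
  then show ?thesis by simp
qed

lemma real_solve_mult: "c * x = y \<Longrightarrow> 0 < c \<Longrightarrow> x = y / (c :: real)"
  by (simp add: field_simps)

lemma (in prob_space) abs_expectation_le:
  fixes f :: "'a \<Rightarrow> real"
  assumes "f \<in> borel_measurable M" "AE x in M. \<bar>f x\<bar> \<le> B"
  shows "\<bar>expectation f\<bar> \<le> B"
proof -
  have int: "integrable M f" using assms by (intro integrable_const_bound[of _ B]) auto
  have "\<bar>expectation f\<bar> \<le> expectation (\<lambda>x. \<bar>f x\<bar>)" using integral_norm_bound[of M f] by simp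
  also have "\<dots> \<le> expectation (\<lambda>x. B)" using assms int by (intro integral_mono_AE) auto
  finally show ?thesis by (simp add: prob_space)
qed

text \<open>Each unit of \<open>E h\<^sup>2\<close> contributes this amount to the mean of one step of the Busemann function; it is
  half the sum of the positive roots, \<open>\<rho> = d(k+1)/2 - 1\<close>, divided by the dimension \<open>dk\<close>.\<close>

definition drift_coeff :: "real \<Rightarrow> real \<Rightarrow> real" where
  "drift_coeff d k = (d * (k + 1) / 2 - 1) / (d * k)"

text \<open>The corresponding contribution of each unit of \<open>E h\<^sup>4\<close>.\<close>

definition bias_coeff :: "real \<Rightarrow> real \<Rightarrow> real" where
  "bias_coeff d k = - ((d * (k + 1) / 2 - 1) * (d * (k + 3) / 2 - 2) / (6 * d * k * (d * k / 2 + 1)))"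

text \<open>The coefficients of \<open>E \<tau>\<^sup>2\<close> and \<open>E \<tau>\<^sup>4\<close> in the expansion of the mean of \<open>log |1 + \<zeta>|\<close>.\<close>

definition quadratic_coeff :: "real \<Rightarrow> real \<Rightarrow> real" where
  "quadratic_coeff d k = 1 / (2 * k) - 1 / (d * k)"

definition quartic_coeff :: "real \<Rightarrow> real \<Rightarrow> real" where
  "quartic_coeff d k = (d + 2) / (k * (d * k + 2)) * (- 1 / 4 + 2 / d - 6 / (d * (d + 2)))"

text \<open>Substituting \<open>\<tau>\<^sup>2 = tanh\<^sup>2 h = h\<^sup>2 - 2/3 h\<^sup>4 + \<dots>\<close> and adding \<open>log cosh h = h\<^sup>2/2 - h\<^sup>4/12 + \<dots>\<close> produces the
  coefficients in terms of \<open>h\<close>.\<close>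

lemma coeff_identities:
  assumes "0 < d" "0 < k"
  shows "quadratic_coeff d k + 1 / 2 = drift_coeff d k"
    "- 2 / 3 * quadratic_coeff d k + quartic_coeff d k - 1 / 12 = bias_coeff d k"
proof -
  show "quadratic_coeff d k + 1 / 2 = drift_coeff d k"
    using assms unfolding quadratic_coeff_def drift_coeff_def by (simp add: field_simps)
  have pos: "d * k + 2 \<noteq> 0" "d + 2 \<noteq> 0" "d \<noteq> 0" "k \<noteq> 0" "d * k / 2 + 1 \<noteq> 0"
    using mult_pos_pos[OF assms] assms by linarith+
  have q: "quartic_coeff d k = - ((d - 2) * (d - 4)) / (4 * (d * k) * (d * k + 2))"
    unfolding quartic_coeff_def using pos by (simp add: divide_simps) algebra
  have c: "quadratic_coeff d k = (d - 2) / (2 * (d * k))"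
    unfolding quadratic_coeff_def using pos by (simp add: divide_simps)
  have b: "bias_coeff d k = - ((d * k + d - 2) * (d * k + 3 * d - 4)) / (12 * (d * k) * (d * k + 2))"
    unfolding bias_coeff_def using pos by (simp add: divide_simps) algebra
  show "- 2 / 3 * quadratic_coeff d k + quartic_coeff d k - 1 / 12 = bias_coeff d k"
    unfolding q c b using pos by (simp add: divide_simps) algebra
qed

context rotation_invariant_law
begin

lemma d_pos: "0 < d"
  by (cases F) (simp_all add: dim_scalars del: scalars.simps)

abbreviation h :: "'n qmat set \<Rightarrow> real" where "h X \<equiv> hyp_dist F X (hyp_origin F)"

lemma measurable_h [measurable]: "h \<in> borel_measurable (hyp_borel F)"
  by (rule measurable_hyp_dist_origin[OF card])

lemma measurable_\<tau> [measurable]: "\<tau> \<in> borel_measurable (hyp_borel F)"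
proof -
  have "(tanh :: real \<Rightarrow> real) \<in> borel_measurable borel"
    by (intro borel_measurable_continuous_onI continuous_intros) simp
  from measurable_compose[OF measurable_h this] show ?thesis .
qed

lemma h_nonneg: "X \<in> hyp_space F \<Longrightarrow> 0 \<le> h X"
  by (rule hyp_dist_nonneg[OF card _ hyp_origin_in_space])

lemma last_neq_first: "last_ix \<noteq> (first_ix :: 'n)"
  using first_ix_neq_last_ix[OF card] by simp

abbreviation u :: "'n qmat set \<Rightarrow> real" where "u X \<equiv> qRe (\<zeta> last_ix X)"
abbreviation w :: "'n qmat set \<Rightarrow> real" where "w X \<equiv> (norm (\<zeta> last_ix X))\<^sup>2"

lemma u_w_bounds:
  assumes X: "X \<in> hyp_space F"
  shows "\<bar>u X\<bar> \<le> h X" "0 \<le> w X" "w X \<le> (h X)\<^sup>2" "(\<tau> X)\<^sup>2 \<le> (h X)\<^sup>2"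
proof -
  show \<tau>: "(\<tau> X)\<^sup>2 \<le> (h X)\<^sup>2"
    using tanh_le_self[OF h_nonneg[OF X]] h_nonneg[OF X] by (intro power_mono) auto
  show w: "w X \<le> (h X)\<^sup>2" "0 \<le> w X"
    using \<zeta>_norm[OF X last_neq_first] \<tau> by auto
  have "norm (\<zeta> last_ix X) \<le> h X" using w(1) h_nonneg[OF X] by (rule power2_le_imp_le)
  then show "\<bar>u X\<bar> \<le> h X" using abs_qRe_le_norm[of "\<zeta> last_ix X"] by linarith
qed

lemma busemann_u_w:
  assumes X: "X \<in> hyp_space F"
  shows "busemann X = ln (1 + (2 * u X + w X)) / 2 + ln (cosh (h X))"
proof -
  obtain g where g: "g \<in> isom_matrices F" "X = coset F g" using X by (auto simp: hyp_space_iff)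
  have "(norm (1 + \<zeta> last_ix X))\<^sup>2 = 1 + (2 * u X + w X)"
    unfolding norm_quat_power2 by (simp add: power2_eq_square algebra_simps)
  moreover have "0 < norm (1 + \<zeta> last_ix X)"
    using one_plus_ball_point_nonzero[OF card g(1)] g(2) by simp
  ultimately have "ln (1 + (2 * u X + w X)) = 2 * ln (norm (1 + \<zeta> last_ix X))"
    by (metis ln_realpow of_nat_numeral)
  then show ?thesis using busemann_coset_dist[OF card g(1)] g(2) by simp
qed

lemma w_le_1: "X \<in> hyp_space F \<Longrightarrow> w X \<le> 1"
  and u_le_1: "X \<in> hyp_space F \<Longrightarrow> \<bar>u X\<bar> \<le> 1"
  using \<zeta>_norm_1[OF _ last_neq_first, of X] abs_qRe_le_norm[of "\<zeta> last_ix X"]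
  by (auto simp: power_le_one)

lemma expectation_busemann_poly:
  assumes h: "AE X in \<mu>. h X \<le> 1"
  shows "expectation (\<lambda>X. busemann_poly (u X) (w X) (h X))
    = quadratic_coeff d k * expectation (\<lambda>X. (\<tau> X)\<^sup>2) + quartic_coeff d k * expectation (\<lambda>X. ((\<tau> X)\<^sup>2)\<^sup>2)
      + expectation (\<lambda>X. (h X)\<^sup>2) / 2 - expectation (\<lambda>X. (h X) ^ 4) / 12"
proof -
  note l = last_neq_first
  have uw: "\<bar>u X ^ a * w X ^ b\<bar> \<le> 1" if "X \<in> hyp_space F" for X a b
    using u_le_1[OF that] w_le_1[OF that] by (simp add: abs_mult power_abs mult_le_one power_le_one)
  have int: "integrable \<mu> (\<lambda>X. u X ^ a * w X ^ b)" for a b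
    by (rule integrable_bounded[of _ 1]) (use uw in auto)
  have i: "integrable \<mu> (\<lambda>X. u X)" "integrable \<mu> (\<lambda>X. w X)" "integrable \<mu> (\<lambda>X. (u X)\<^sup>2)"
    "integrable \<mu> (\<lambda>X. u X * w X)" "integrable \<mu> (\<lambda>X. (w X)\<^sup>2)" "integrable \<mu> (\<lambda>X. u X ^ 3)"
    "integrable \<mu> (\<lambda>X. (u X)\<^sup>2 * w X)" "integrable \<mu> (\<lambda>X. u X ^ 4)"
    using int[of 1 0] int[of 0 1] int[of 2 0] int[of 1 1] int[of 0 2] int[of 3 0] int[of 2 1] int[of 4 0]
    by simp_all
  have ih: "integrable \<mu> (\<lambda>X. (h X)\<^sup>2)" "integrable \<mu> (\<lambda>X. (h X) ^ 4)"
  proof -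
    have *: "AE X in \<mu>. 0 \<le> h X \<and> h X \<le> 1" using h AE_space by eventually_elim (use h_nonneg in auto)
    have "AE X in \<mu>. norm ((h X) ^ m) \<le> 1" for m
      using * by eventually_elim (auto simp: power_le_one)
    then show "integrable \<mu> (\<lambda>X. (h X)\<^sup>2)" "integrable \<mu> (\<lambda>X. (h X) ^ 4)"
      by (auto intro!: integrable_const_bound[of _ 1] simp del: real_norm_def norm_power)
  qed
  let ?A = "expectation (\<lambda>X. (\<tau> X)\<^sup>2)" and ?B = "expectation (\<lambda>X. ((\<tau> X)\<^sup>2)\<^sup>2)"
  have kd: "real k > 0" "d > 0" "k * (d * k + 2) > 0" "d * (d + 2) > 0"
  proof -
    show "real k > 0" "d > 0" using dim d_pos by auto
    then show "k * (d * k + 2) > 0" "d * (d + 2) > 0"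
      by (metis add_pos_pos mult_pos_pos zero_less_numeral)+
  qed
  have w1: "expectation (\<lambda>X. w X) = ?A / k" by (rule real_solve_mult[OF expectation_norm2[OF l] kd(1)])
  have "expectation (\<lambda>X. (w X)\<^sup>2) = (d + 2) * ?B / (k * (d * k + 2))"
    by (rule real_solve_mult[OF expectation_norm4[OF l] kd(3)])
  then have w2: "expectation (\<lambda>X. (w X)\<^sup>2) = (d + 2) / (k * (d * k + 2)) * ?B" by simp
  have "expectation (\<lambda>X. (u X)\<^sup>2) = expectation (\<lambda>X. w X) / d"
    using expectation_re2[OF l, of "\<lambda>_. 1"] by (intro real_solve_mult kd) simp
  then have u2: "expectation (\<lambda>X. (u X)\<^sup>2) = ?A / (d * k)" by (simp add: w1 mult.commute)
  have u2w: "expectation (\<lambda>X. (u X)\<^sup>2 * w X) = expectation (\<lambda>X. (w X)\<^sup>2) / d"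
    using expectation_re2[OF l, of "\<lambda>x. x\<^sup>2"]
    by (intro real_solve_mult kd) (simp add: power_le_one flip: power2_eq_square[of "w _"])
  have u4: "expectation (\<lambda>X. u X ^ 4) = 3 * expectation (\<lambda>X. (w X)\<^sup>2) / (d * (d + 2))"
    by (rule real_solve_mult[OF expectation_re4[OF l] kd(4)])
  have "expectation (\<lambda>X. busemann_poly (u X) (w X) (h X))
    = expectation (\<lambda>X. u X) + expectation (\<lambda>X. w X) / 2 - expectation (\<lambda>X. (u X)\<^sup>2) - expectation (\<lambda>X. u X * w X)
      - expectation (\<lambda>X. (w X)\<^sup>2) / 4 + 4 / 3 * expectation (\<lambda>X. u X ^ 3) + 2 * expectation (\<lambda>X. (u X)\<^sup>2 * w X)
      - 2 * expectation (\<lambda>X. u X ^ 4) + expectation (\<lambda>X. (h X)\<^sup>2) / 2 - expectation (\<lambda>X. (h X) ^ 4) / 12"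
    unfolding busemann_poly_def using i ih by simp
  also have "\<dots> = ?A * (1 / (2 * real k) - 1 / (d * k)) + expectation (\<lambda>X. (w X)\<^sup>2) * (- 1 / 4 + 2 / d - 6 / (d * (d + 2)))
      + expectation (\<lambda>X. (h X)\<^sup>2) / 2 - expectation (\<lambda>X. (h X) ^ 4) / 12"
    unfolding expectation_odd[OF l] u4 u2w u2 w1 by (simp add: algebra_simps)
  also have "\<dots> = quadratic_coeff d k * ?A + quartic_coeff d k * ?B
      + expectation (\<lambda>X. (h X)\<^sup>2) / 2 - expectation (\<lambda>X. (h X) ^ 4) / 12"
    unfolding w2 quadratic_coeff_def quartic_coeff_def by (simp only: ac_simps)
  finally show ?thesis .
qed

lemma expectation_u2: "expectation (\<lambda>X. (u X)\<^sup>2) = expectation (\<lambda>X. (\<tau> X)\<^sup>2) / (d * k)"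
proof -
  have "expectation (\<lambda>X. (u X)\<^sup>2) = expectation (\<lambda>X. w X) / d"
    using expectation_re2[OF last_neq_first, of "\<lambda>_. 1"] by (intro real_solve_mult d_pos) simp
  moreover have "expectation (\<lambda>X. w X) = expectation (\<lambda>X. (\<tau> X)\<^sup>2) / k"
    using expectation_norm2[OF last_neq_first] dim by (simp add: field_simps)
  ultimately show ?thesis by (simp add: mult.commute)
qed

end

text \<open>The remainders are uniform over all laws, since they come from Taylor expansions of fixed
  functions.\<close>

lemma busemann_step_moments:
  fixes F :: base_field and k :: nat
  defines "d \<equiv> real (dim (scalars F))"
  shows "\<exists>C\<ge>0. \<exists>\<delta>>0. \<forall>(\<mu> :: 'n::{finite,linorder} qmat set measure) \<eta>.
    rotation_invariant_law \<mu> F k \<longrightarrow> 0 < \<eta> \<longrightarrow> \<eta> \<le> \<delta> \<longrightarrow> (AE X in \<mu>. hyp_dist F X (hyp_origin F) \<le> \<eta>) \<longrightarrow>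
    \<bar>(\<integral>X. busemann X \<partial>\<mu>) - (drift_coeff d k * (\<integral>X. (hyp_dist F X (hyp_origin F))\<^sup>2 \<partial>\<mu>)
        + bias_coeff d k * (\<integral>X. (hyp_dist F X (hyp_origin F)) ^ 4 \<partial>\<mu>))\<bar> \<le> C * \<eta> ^ 5 \<and>
    \<bar>(\<integral>X. (busemann X)\<^sup>2 \<partial>\<mu>) - (\<integral>X. (hyp_dist F X (hyp_origin F))\<^sup>2 \<partial>\<mu>) / (d * k)\<bar> \<le> C * \<eta> ^ 3"
proof -
  obtain C1 \<delta>1 where 1: "0 \<le> C1" "0 < \<delta>1"
    "\<And>u w h :: real. 0 \<le> h \<Longrightarrow> h \<le> \<delta>1 \<Longrightarrow> \<bar>u\<bar> \<le> h \<Longrightarrow> 0 \<le> w \<Longrightarrow> w \<le> h\<^sup>2 \<Longrightarrow>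
      \<bar>ln (1 + (2 * u + w)) / 2 + ln (cosh h) - busemann_poly u w h\<bar> \<le> C1 * h ^ 5"
    using busemann_poly_expansion by blast
  obtain C2 \<delta>2 where 2: "0 \<le> C2" "0 < \<delta>2"
    "\<And>h :: real. 0 \<le> h \<Longrightarrow> h \<le> \<delta>2 \<Longrightarrow> \<bar>(tanh h)\<^sup>2 - (h\<^sup>2 - 2 / 3 * h ^ 4)\<bar> \<le> C2 * h ^ 5"
    using tanh_square_expansion by blast
  define \<delta> where "\<delta> = min 1 (min \<delta>1 \<delta>2)"
  define C where "C = C1 + \<bar>quadratic_coeff d k\<bar> * C2 + \<bar>quartic_coeff d k\<bar> * (2 * (1 + C2))
    + 2 * (C1 + 20) + (1 + C2) * \<bar>1 / (d * k)\<bar>"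
  have "0 \<le> C" unfolding C_def using 1 2 by simp
  moreover have "0 < \<delta>" using 1 2 by (simp add: \<delta>_def)
  moreover have "\<bar>(\<integral>X. busemann X \<partial>\<mu>) - (drift_coeff d k * (\<integral>X. (hyp_dist F X (hyp_origin F))\<^sup>2 \<partial>\<mu>)
        + bias_coeff d k * (\<integral>X. (hyp_dist F X (hyp_origin F)) ^ 4 \<partial>\<mu>))\<bar> \<le> C * \<eta> ^ 5 \<and>
    \<bar>(\<integral>X. (busemann X)\<^sup>2 \<partial>\<mu>) - (\<integral>X. (hyp_dist F X (hyp_origin F))\<^sup>2 \<partial>\<mu>) / (d * k)\<bar> \<le> C * \<eta> ^ 3"
    if law: "rotation_invariant_law \<mu> F k" and \<eta>: "0 < \<eta>" "\<eta> \<le> \<delta>"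
      and small: "AE X in \<mu>. hyp_dist F X (hyp_origin F) \<le> \<eta>"
    for \<mu> :: "'n qmat set measure" and \<eta>
  proof -
    interpret rotation_invariant_law \<mu> F k by (rule law)
    have \<eta>1: "\<eta> \<le> 1" "\<eta> \<le> \<delta>1" "\<eta> \<le> \<delta>2" using \<eta> by (auto simp: \<delta>_def)
    have AEb: "AE X in \<mu>. X \<in> hyp_space F \<and> 0 \<le> h X \<and> h X \<le> \<eta>"
      using small AE_space by eventually_elim (use h_nonneg in auto)
    have h1: "AE X in \<mu>. h X \<le> 1" using AEb by eventually_elim (use \<eta>1 in auto)
    have mb: "busemann \<in> borel_measurable \<mu>" by simp
    have bh: "\<bar>busemann X\<bar> \<le> h X" if "X \<in> hyp_space F" for X
      using dist_minus_busemann(2)[OF card that] .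
    have pow: "x ^ m \<le> \<eta> ^ m" if "0 \<le> x" "x \<le> \<eta>" for x :: real and m using that by (rule power_mono[rotated])
    have int_b: "integrable \<mu> busemann"
      by (rule integrable_const_bound[of _ 1, OF _ mb]) (use AEb in \<open>eventually_elim; use bh \<eta>1 in force\<close>)
    have int_b2: "integrable \<mu> (\<lambda>X. (busemann X)\<^sup>2)"
    proof (rule integrable_const_bound[of _ 1])
      show "AE X in \<mu>. norm ((busemann X)\<^sup>2) \<le> 1" using AEb
      proof eventually_elim
        case (elim X)
        then have "\<bar>busemann X\<bar> \<le> 1" using bh[of X] \<eta>1 by linarith
        then show ?case by (simp add: abs_square_le_1)
      qed
    qed (use mb in measurable)
    have int_h: "integrable \<mu> (\<lambda>X. h X ^ m)" for m
    proof (rule integrable_const_bound[of _ 1])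
      show "AE X in \<mu>. norm (h X ^ m) \<le> 1" using AEb
        by eventually_elim (use \<eta>1 in \<open>auto simp: power_abs intro!: power_le_one\<close>)
    qed simp
    have int_\<tau>: "integrable \<mu> (\<lambda>X. (\<tau> X)\<^sup>2)" "integrable \<mu> (\<lambda>X. ((\<tau> X)\<^sup>2)\<^sup>2)"
      by (rule integrable_bounded[of _ 1];
        use \<tau>_le_1 power_le_one[OF zero_le_power2 \<tau>_le_1, of _ 2] in simp)+
    have int_u2: "integrable \<mu> (\<lambda>X. (u X)\<^sup>2)"
      by (rule integrable_bounded[of _ 1]) (use u_le_1 in \<open>auto simp: abs_square_le_1\<close>)
    let ?p = "\<lambda>X. busemann_poly (u X) (w X) (h X)"
    have mp: "?p \<in> borel_measurable (hyp_borel F)" unfolding busemann_poly_def by measurable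
    have AEp: "AE X in \<mu>. \<bar>busemann X - ?p X\<bar> \<le> C1 * h X ^ 5" using AEb
    proof eventually_elim
      case (elim X)
      then have X: "X \<in> hyp_space F" and h: "0 \<le> h X" "h X \<le> \<delta>1" using \<eta>1 by auto
      show ?case unfolding busemann_u_w[OF X] by (rule 1(3)[OF h u_w_bounds(1-3)[OF X]])
    qed
    have AEp': "AE X in \<mu>. \<bar>busemann X - ?p X\<bar> \<le> C1 * \<eta> ^ 5" using AEp AEb
    proof eventually_elim
      case (elim X)
      then show ?case using mult_left_mono[OF pow[of "h X" 5] 1(1)] by linarith
    qed
    have int_diff: "integrable \<mu> (\<lambda>X. busemann X - ?p X)"
      using AEp' by (intro integrable_const_bound[of _ "C1 * \<eta> ^ 5"]) (use mb mp in auto)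
    have "integrable \<mu> (\<lambda>X. busemann X - (busemann X - ?p X))"
      using int_b int_diff by (rule Bochner_Integration.integrable_diff)
    then have int_p: "integrable \<mu> ?p" by simp
    have E1: "\<bar>expectation busemann - expectation ?p\<bar> \<le> C1 * \<eta> ^ 5"
    proof -
      have "expectation busemann - expectation ?p = expectation (\<lambda>X. busemann X - ?p X)"
        using int_b int_p by simp
      then show ?thesis using abs_expectation_le[OF _ AEp'] mb mp by simp
    qed
    have AE\<tau>: "AE X in \<mu>. \<bar>(\<tau> X)\<^sup>2 - ((h X)\<^sup>2 - 2 / 3 * h X ^ 4)\<bar> \<le> C2 * \<eta> ^ 5" using AEb
    proof eventually_elim
      case (elim X)
      then have "\<bar>(\<tau> X)\<^sup>2 - ((h X)\<^sup>2 - 2 / 3 * h X ^ 4)\<bar> \<le> C2 * h X ^ 5" using 2(3) \<eta>1 by auto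
      then show ?case using elim mult_left_mono[OF pow[of "h X" 5] 2(1)] by linarith
    qed
    have E2: "\<bar>expectation (\<lambda>X. (\<tau> X)\<^sup>2) - (expectation (\<lambda>X. (h X)\<^sup>2) - 2 / 3 * expectation (\<lambda>X. h X ^ 4))\<bar> \<le> C2 * \<eta> ^ 5"
    proof -
      have "expectation (\<lambda>X. (\<tau> X)\<^sup>2) - (expectation (\<lambda>X. (h X)\<^sup>2) - 2 / 3 * expectation (\<lambda>X. h X ^ 4))
        = expectation (\<lambda>X. (\<tau> X)\<^sup>2 - ((h X)\<^sup>2 - 2 / 3 * h X ^ 4))"
        using int_\<tau> int_h[of 2] int_h[of 4] by simp
      then show ?thesis using abs_expectation_le[OF _ AE\<tau>] by simp
    qed
    have \<tau>h: "\<bar>(\<tau> X)\<^sup>2 - (h X)\<^sup>2\<bar> \<le> (1 + C2) * h X ^ 3" if "0 \<le> h X" "h X \<le> \<eta>" for X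
    proof -
      have "\<bar>(\<tau> X)\<^sup>2 - ((h X)\<^sup>2 - 2 / 3 * h X ^ 4)\<bar> \<le> C2 * h X ^ 5" using 2(3) \<eta>1 that by auto
      moreover have "h X ^ 4 \<le> h X ^ 3" "h X ^ 5 \<le> h X ^ 3"
        using that \<eta>1 by (intro power_decreasing; simp)+
      moreover have "C2 * h X ^ 5 \<le> C2 * h X ^ 3" using calculation(3) 2(1) by (rule mult_left_mono)
      moreover have "0 \<le> h X ^ 4" using that by simp
      ultimately show ?thesis unfolding distrib_right mult_1_left abs_le_iff by linarith
    qed
    have AE4: "AE X in \<mu>. \<bar>((\<tau> X)\<^sup>2)\<^sup>2 - h X ^ 4\<bar> \<le> 2 * (1 + C2) * \<eta> ^ 5" using AEb
    proof eventually_elim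
      case (elim X)
      have "((\<tau> X)\<^sup>2)\<^sup>2 - h X ^ 4 = ((\<tau> X)\<^sup>2 - (h X)\<^sup>2) * ((\<tau> X)\<^sup>2 + (h X)\<^sup>2)"
        by (simp add: power2_eq_square power4_eq_xxxx algebra_simps)
      then have "\<bar>((\<tau> X)\<^sup>2)\<^sup>2 - h X ^ 4\<bar> = \<bar>(\<tau> X)\<^sup>2 - (h X)\<^sup>2\<bar> * ((\<tau> X)\<^sup>2 + (h X)\<^sup>2)"
        by (simp add: abs_mult)
      also have "\<dots> \<le> ((1 + C2) * h X ^ 3) * (2 * (h X)\<^sup>2)"
      proof (rule mult_mono)
        show "\<bar>(\<tau> X)\<^sup>2 - (h X)\<^sup>2\<bar> \<le> (1 + C2) * h X ^ 3" using \<tau>h[of X] elim by simp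
        show "(\<tau> X)\<^sup>2 + (h X)\<^sup>2 \<le> 2 * (h X)\<^sup>2" using u_w_bounds(4)[of X] elim by linarith
        show "0 \<le> (1 + C2) * h X ^ 3" using elim 2(1) by (intro mult_nonneg_nonneg zero_le_power) auto
      qed simp
      also have "\<dots> = 2 * (1 + C2) * h X ^ 5" by (simp add: eval_nat_numeral algebra_simps)
      also have "\<dots> \<le> 2 * (1 + C2) * \<eta> ^ 5" using elim pow[of "h X" 5] 2(1) by (intro mult_left_mono) auto
      finally show ?case .
    qed
    have E4: "\<bar>expectation (\<lambda>X. ((\<tau> X)\<^sup>2)\<^sup>2) - expectation (\<lambda>X. h X ^ 4)\<bar> \<le> 2 * (1 + C2) * \<eta> ^ 5"
    proof -
      have "expectation (\<lambda>X. ((\<tau> X)\<^sup>2)\<^sup>2) - expectation (\<lambda>X. h X ^ 4) = expectation (\<lambda>X. ((\<tau> X)\<^sup>2)\<^sup>2 - h X ^ 4)"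
        using int_\<tau> int_h[of 4] by simp
      then show ?thesis using abs_expectation_le[OF _ AE4] by simp
    qed
    have dk: "0 < d" "0 < real k" using d_pos dim by (auto simp: d_def)
    let ?H2 = "expectation (\<lambda>X. (h X)\<^sup>2)" and ?H4 = "expectation (\<lambda>X. h X ^ 4)"
    let ?A = "expectation (\<lambda>X. (\<tau> X)\<^sup>2)" and ?B = "expectation (\<lambda>X. ((\<tau> X)\<^sup>2)\<^sup>2)"
    let ?q = "quadratic_coeff d k" and ?r = "quartic_coeff d k"
    have Ep: "expectation ?p = ?q * ?A + ?r * ?B + ?H2 / 2 - ?H4 / 12"
      using expectation_busemann_poly[OF h1] by (simp only: d_def)
    have "expectation ?p - (drift_coeff d k * ?H2 + bias_coeff d k * ?H4)
      = ?q * (?A - (?H2 - 2 / 3 * ?H4)) + ?r * (?B - ?H4)"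
      unfolding Ep coeff_identities[OF dk, symmetric] by (simp add: algebra_simps)
    then have "\<bar>expectation ?p - (drift_coeff d k * ?H2 + bias_coeff d k * ?H4)\<bar>
      \<le> \<bar>?q * (?A - (?H2 - 2 / 3 * ?H4))\<bar> + \<bar>?r * (?B - ?H4)\<bar>"
      by (simp only: abs_triangle_ineq)
    also have "\<dots> \<le> \<bar>?q\<bar> * (C2 * \<eta> ^ 5) + \<bar>?r\<bar> * (2 * (1 + C2) * \<eta> ^ 5)"
      unfolding abs_mult by (intro add_mono mult_left_mono E2 E4) auto
    finally have M1: "\<bar>expectation busemann - (drift_coeff d k * ?H2 + bias_coeff d k * ?H4)\<bar>
      \<le> C1 * \<eta> ^ 5 + (\<bar>?q\<bar> * (C2 * \<eta> ^ 5) + \<bar>?r\<bar> * (2 * (1 + C2) * \<eta> ^ 5))"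
      using E1 by linarith
    have "\<dots> = (C1 + \<bar>?q\<bar> * C2 + \<bar>?r\<bar> * (2 * (1 + C2))) * \<eta> ^ 5"
      by (simp add: algebra_simps)
    also have "\<dots> \<le> C * \<eta> ^ 5"
      unfolding C_def using \<eta> 1(1) 2(1) by (intro mult_right_mono) auto
    finally have R1: "\<bar>expectation busemann - (drift_coeff d k * ?H2 + bias_coeff d k * ?H4)\<bar> \<le> C * \<eta> ^ 5"
      using M1 by linarith
    have AEbu: "AE X in \<mu>. \<bar>(busemann X)\<^sup>2 - (u X)\<^sup>2\<bar> \<le> 2 * (C1 + 20) * \<eta> ^ 3" using AEp AEb
    proof eventually_elim
      case (elim X)
      define x where "x = h X"
      have x: "0 \<le> x" "x \<le> 1" "x \<le> \<eta>" using elim \<eta>1 by (auto simp: x_def)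
      have ux: "\<bar>u X\<bar> \<le> x" "0 \<le> w X" "w X \<le> x\<^sup>2" using u_w_bounds(1-3)[of X] elim unfolding x_def by blast+
      have mono: "\<bar>u X ^ a * w X ^ b\<bar> \<le> x\<^sup>2" if "2 \<le> a + 2 * b" for a b
      proof -
        have "\<bar>u X ^ a * w X ^ b\<bar> \<le> x ^ a * (x\<^sup>2) ^ b"
          unfolding abs_mult power_abs using ux by (intro mult_mono power_mono) (auto simp: x(1))
        also have "\<dots> = x ^ (a + 2 * b)" by (simp add: power_add power_mult)
        also have "\<dots> \<le> x\<^sup>2" using x(1,2) that by (rule power_decreasing[rotated 1])
        finally show ?thesis .
      qed
      have x4: "x ^ 4 \<le> x\<^sup>2" "x ^ 5 \<le> x\<^sup>2" "0 \<le> x ^ 4" using x by (auto intro!: power_decreasing)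
      have c: "\<bar>a + b\<bar> \<le> A + B" if "\<bar>a\<bar> \<le> A" "\<bar>b\<bar> \<le> B" for a b A B :: real using that by linarith
      have "\<bar>busemann_poly (u X) (w X) x - u X\<bar> \<le> 20 * x\<^sup>2"
        unfolding busemann_poly_def
        using mono[of 0 1] mono[of 2 0] mono[of 1 1] mono[of 0 2] mono[of 3 0] mono[of 2 1] mono[of 4 0] x4 zero_le_power2[of x]
        unfolding power_0 mult_1_left mult_1_right power_one_right abs_le_iff by linarith
      moreover have "C1 * x ^ 5 \<le> C1 * x\<^sup>2" using x4(2) 1(1) by (rule mult_left_mono)
      ultimately have bu: "\<bar>busemann X - u X\<bar> \<le> (C1 + 20) * x\<^sup>2"
        using elim(1) unfolding x_def[symmetric] distrib_right by linarith
      have "\<bar>(busemann X)\<^sup>2 - (u X)\<^sup>2\<bar> = \<bar>busemann X - u X\<bar> * \<bar>busemann X + u X\<bar>"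
        by (simp add: power2_eq_square algebra_simps flip: abs_mult)
      also have "\<dots> \<le> ((C1 + 20) * x\<^sup>2) * (2 * x)"
        using bu bh[of X] ux elim 1(1) unfolding x_def[symmetric] by (intro mult_mono) auto
      also have "\<dots> = 2 * (C1 + 20) * x ^ 3" by (simp add: eval_nat_numeral algebra_simps)
      also have "\<dots> \<le> 2 * (C1 + 20) * \<eta> ^ 3" using x pow[of x 3] 1(1) by (intro mult_left_mono) auto
      finally show ?case .
    qed
    have E5: "\<bar>expectation (\<lambda>X. (busemann X)\<^sup>2) - expectation (\<lambda>X. (u X)\<^sup>2)\<bar> \<le> 2 * (C1 + 20) * \<eta> ^ 3"
    proof -
      have "expectation (\<lambda>X. (busemann X)\<^sup>2) - expectation (\<lambda>X. (u X)\<^sup>2) = expectation (\<lambda>X. (busemann X)\<^sup>2 - (u X)\<^sup>2)"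
        using int_b2 int_u2 by simp
      then show ?thesis using abs_expectation_le[OF _ AEbu] by simp
    qed
    have AE6: "AE X in \<mu>. \<bar>(\<tau> X)\<^sup>2 - (h X)\<^sup>2\<bar> \<le> (1 + C2) * \<eta> ^ 3" using AEb
    proof eventually_elim
      case (elim X)
      have "(1 + C2) * h X ^ 3 \<le> (1 + C2) * \<eta> ^ 3" using elim pow[of "h X" 3] 2(1) by (intro mult_left_mono) auto
      then show ?case using \<tau>h[of X] elim by linarith
    qed
    have E6: "\<bar>?A - ?H2\<bar> \<le> (1 + C2) * \<eta> ^ 3"
    proof -
      have "?A - ?H2 = expectation (\<lambda>X. (\<tau> X)\<^sup>2 - (h X)\<^sup>2)" using int_\<tau> int_h[of 2] by simp
      then show ?thesis using abs_expectation_le[OF _ AE6] by simp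
    qed
    have "\<bar>?A / (d * k) - ?H2 / (d * k)\<bar> = \<bar>?A - ?H2\<bar> * \<bar>1 / (d * k)\<bar>"
      unfolding abs_mult[symmetric] left_diff_distrib by simp
    also have "\<dots> \<le> ((1 + C2) * \<eta> ^ 3) * \<bar>1 / (d * k)\<bar>" by (intro mult_right_mono E6) auto
    finally have E7: "\<bar>?A / (d * k) - ?H2 / (d * k)\<bar> \<le> (1 + C2) * \<bar>1 / (d * k)\<bar> * \<eta> ^ 3" by (simp only: ac_simps)
    have "\<bar>expectation (\<lambda>X. (busemann X)\<^sup>2) - ?H2 / (d * k)\<bar>
      \<le> 2 * (C1 + 20) * \<eta> ^ 3 + (1 + C2) * \<bar>1 / (d * k)\<bar> * \<eta> ^ 3"
      using E5 E7 unfolding expectation_u2[folded d_def] by linarith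
    also have "\<dots> = (2 * (C1 + 20) + (1 + C2) * \<bar>1 / (d * k)\<bar>) * \<eta> ^ 3" by (simp only: distrib_right)
    also have "\<dots> \<le> C * \<eta> ^ 3"
      unfolding C_def using \<eta> 1(1) 2(1) by (intro mult_right_mono) auto
    finally show ?thesis using R1 by blast
  qed
  ultimately show ?thesis by blast
qed

section \<open>Characteristic functions of triangular arrays\<close>

lemma exp_minus_one_scaled:
  fixes w :: complex
  shows "(\<lambda>n. of_nat n * (exp (w / of_nat n) - 1)) \<longlonglongrightarrow> w"
proof (cases "w = 0")
  case False
  have "((\<lambda>h. (exp (0 + h) - exp 0) / h) \<longlongrightarrow> (1 :: complex)) (at 0)"
    using DERIV_exp[of "0 :: complex"] by (simp add: DERIV_def)
  moreover have "filterlim (\<lambda>n. w / of_nat n) (at 0) sequentially"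
    unfolding filterlim_at
  proof
    show "\<forall>\<^sub>F n in sequentially. w / of_nat n \<in> UNIV \<and> w / of_nat n \<noteq> 0"
      using eventually_gt_at_top[of 0] by eventually_elim (use False in auto)
    show "(\<lambda>n. w / of_nat n) \<longlonglongrightarrow> 0" by (rule lim_const_over_n)
  qed
  ultimately have "(\<lambda>n. (exp (w / of_nat n) - 1) / (w / of_nat n)) \<longlonglongrightarrow> 1"
    using filterlim_compose by force
  then have "(\<lambda>n. w * ((exp (w / of_nat n) - 1) / (w / of_nat n))) \<longlonglongrightarrow> w * 1"
    by (intro tendsto_intros)
  moreover have "\<forall>\<^sub>F n in sequentially. w * ((exp (w / of_nat n) - 1) / (w / of_nat n)) = of_nat n * (exp (w / of_nat n) - 1)"
    using eventually_gt_at_top[of 0] by eventually_elim (use False in auto)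
  ultimately show ?thesis using Lim_transform_eventually by force
qed simp

text \<open>Powers of numbers in the unit disc are compared by \<open>|z\<^sup>n - w\<^sup>n| \<le> n |z - w|\<close>.\<close>

lemma power_tendsto_exp:
  fixes z :: "nat \<Rightarrow> complex"
  assumes lim: "(\<lambda>n. of_nat n * (z n - 1)) \<longlonglongrightarrow> w"
    and z: "\<And>n. norm (z n) \<le> 1" and w: "Re w \<le> 0"
  shows "(\<lambda>n. z n ^ n) \<longlonglongrightarrow> exp w"
proof -
  have "(\<lambda>n. of_nat n * (z n - 1) - of_nat n * (exp (w / of_nat n) - 1)) \<longlonglongrightarrow> w - w"
    by (intro tendsto_diff lim exp_minus_one_scaled)
  then have lim0: "(\<lambda>n. norm (of_nat n * (z n - 1) - of_nat n * (exp (w / of_nat n) - 1))) \<longlonglongrightarrow> 0"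
    using tendsto_norm_zero by force
  have bound: "\<forall>\<^sub>F n in sequentially. norm (z n ^ n - exp w)
      \<le> norm (of_nat n * (z n - 1) - of_nat n * (exp (w / of_nat n) - 1))"
    using eventually_gt_at_top[of 0]
  proof eventually_elim
    case (elim n)
    have "exp w = exp (w / of_nat n) ^ n" using elim by (simp flip: exp_of_nat_mult)
    moreover have "Re (w / of_nat n) \<le> 0" using w by (simp add: Re_divide_of_nat divide_nonpos_nonneg)
    then have "norm (exp (w / of_nat n)) \<le> 1" by simp
    ultimately have "norm (z n ^ n - exp w) \<le> n * norm (z n - exp (w / of_nat n))"
      using norm_power_diff[OF z[of n], of "exp (w / of_nat n)" n] by simp
    also have "\<dots> = norm (of_nat n * (z n - exp (w / of_nat n)))" by (simp add: norm_mult)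
    finally show ?case by (simp add: algebra_simps)
  qed
  have "(\<lambda>n. z n ^ n - exp w) \<longlonglongrightarrow> 0"
    by (rule Lim_null_comparison[OF bound lim0])
  then show ?thesis by (simp add: LIM_zero_iff)
qed

text \<open>The second order expansion of the characteristic function of a single summand, taken \<open>n\<close> times,
  leaves exactly the limits of mean and variance in the exponent; the third moment controls the
  remainder.\<close>

lemma char_triangular:
  fixes M :: "nat \<Rightarrow> real measure" and s \<eta> :: "nat \<Rightarrow> real"
  assumes M: "\<And>n. real_distribution (M n)"
    and \<eta>: "\<forall>\<^sub>F n in sequentially. 0 < s n \<and> (AE x in M n. \<bar>x\<bar> \<le> \<eta> n)"
    and mean: "(\<lambda>n. n * (\<integral>x. x \<partial>M n) / s n) \<longlonglongrightarrow> m"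
    and var: "(\<lambda>n. n * (\<integral>x. x\<^sup>2 \<partial>M n) / (s n)\<^sup>2) \<longlonglongrightarrow> v"
    and third: "(\<lambda>n. n * (\<eta> n / s n) ^ 3) \<longlonglongrightarrow> 0"
  shows "(\<lambda>n. char (M n) (t / s n) ^ n) \<longlonglongrightarrow> exp (\<i> * of_real (m * t) - of_real (v * t\<^sup>2 / 2))"
proof (rule power_tendsto_exp)
  show "norm (char (M n) (t / s n)) \<le> 1" for n
    by (rule real_distribution.cmod_char_le_1[OF M])
  have "0 \<le> v"
  proof (rule tendsto_lowerbound[OF var])
    show "\<forall>\<^sub>F n in sequentially. 0 \<le> n * (\<integral>x. x\<^sup>2 \<partial>M n) / (s n)\<^sup>2" by (intro always_eventually allI) simp
  qed simp
  then show "Re (\<i> * of_real (m * t) - of_real (v * t\<^sup>2 / 2)) \<le> 0" by simp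
  let ?e = "\<lambda>n. (\<integral>x. x \<partial>M n)" and ?v = "\<lambda>n. (\<integral>x. x\<^sup>2 \<partial>M n)"
  define T where "T n = \<i> * of_real (n * ?e n / s n * t) - of_real (n * ?v n / (s n)\<^sup>2 * t\<^sup>2 / 2)" for n :: nat
  have T: "T \<longlonglongrightarrow> \<i> * of_real (m * t) - of_real (v * t\<^sup>2 / 2)"
    unfolding T_def by (intro tendsto_intros tendsto_of_real mean var) simp
  have "\<forall>\<^sub>F n in sequentially. norm (of_nat n * (char (M n) (t / s n) - 1) - T n) \<le> \<bar>t\<bar> ^ 3 / 6 * (n * (\<eta> n / s n) ^ 3)"
    using \<eta>
  proof eventually_elim
    case (elim n)
    interpret M: real_distribution "M n" by (rule M)
    have s: "0 < s n" and AE: "AE x in M n. \<bar>x\<bar> \<le> \<eta> n" using elim by auto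
    have int: "integrable (M n) (\<lambda>x. x ^ j)" for j
    proof (rule M.integrable_const_bound[of _ "\<eta> n ^ j"])
      show "AE x in M n. norm (x ^ j) \<le> \<eta> n ^ j"
        using AE by eventually_elim (auto simp: power_abs intro!: power_mono)
    qed simp
    have int3: "integrable (M n) (\<lambda>x. \<bar>x\<bar> ^ 3)"
      using integrable_abs[OF int[of 3]] by (simp add: power_abs)
    have E3: "M.expectation (\<lambda>x. \<bar>x\<bar> ^ 3) \<le> \<eta> n ^ 3"
    proof -
      have "M.expectation (\<lambda>x. \<bar>x\<bar> ^ 3) \<le> M.expectation (\<lambda>x. \<eta> n ^ 3)"
        using int3 AE by (intro integral_mono_AE) (auto intro!: power_mono elim!: eventually_mono)
      then show ?thesis using M.prob_space by simp
    qed
    let ?\<theta> = "t / s n"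
    let ?P = "1 + \<i> * ?\<theta> * ?e n - ?\<theta>\<^sup>2 / 2 * ?v n"
    have P: "(\<Sum>j\<le>2. ((\<i> * ?\<theta>) ^ j / fact j) * M.expectation (\<lambda>x. x ^ j)) = ?P"
    proof -
      have "\<i> * c * (\<i> * c) = - (c * c)" for c :: complex by (simp add: algebra_simps)
      then show ?thesis using M.prob_space by (simp add: numeral_2_eq_2 power2_eq_square)
    qed
    have "norm (char (M n) ?\<theta> - ?P)
      \<le> \<bar>?\<theta>\<bar>\<^sup>2 / fact (Suc 2) * M.expectation (\<lambda>x. min (2 * \<bar>x\<bar>\<^sup>2 * Suc 2) (\<bar>?\<theta>\<bar> * \<bar>x\<bar> ^ Suc 2))"
      using M.char_approx2[of 2 ?\<theta>] int unfolding P by simp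
    also have "\<dots> \<le> \<bar>?\<theta>\<bar>\<^sup>2 / fact (Suc 2) * M.expectation (\<lambda>x. \<bar>?\<theta>\<bar> * \<bar>x\<bar> ^ 3)"
    proof (intro mult_left_mono integral_mono)
      show "integrable (M n) (\<lambda>x. \<bar>?\<theta>\<bar> * \<bar>x\<bar> ^ 3)" using int3 by simp
      show "integrable (M n) (\<lambda>x. min (2 * \<bar>x\<bar>\<^sup>2 * Suc 2) (\<bar>?\<theta>\<bar> * \<bar>x\<bar> ^ Suc 2))"
        using int[of 2] int3 by (intro integrable_min) (auto simp: eval_nat_numeral)
    qed (auto simp: eval_nat_numeral)
    also have "\<dots> \<le> \<bar>?\<theta>\<bar>\<^sup>2 / fact (Suc 2) * (\<bar>?\<theta>\<bar> * \<eta> n ^ 3)"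
      unfolding integral_mult_right_zero by (intro mult_left_mono E3) auto
    also have "\<dots> = \<bar>t\<bar> ^ 3 / 6 * (\<eta> n / s n) ^ 3"
      using s by (simp add: fact_numeral eval_nat_numeral abs_divide power_divide)
    finally have main: "norm (char (M n) ?\<theta> - ?P) \<le> \<bar>t\<bar> ^ 3 / 6 * (\<eta> n / s n) ^ 3" .
    have "of_nat n * (char (M n) ?\<theta> - 1) - T n = of_nat n * (char (M n) ?\<theta> - ?P)"
      unfolding T_def by (simp add: algebra_simps power_divide)
    then have "norm (of_nat n * (char (M n) ?\<theta> - 1) - T n) = n * norm (char (M n) ?\<theta> - ?P)"
      by (simp add: norm_mult)
    also have "\<dots> \<le> n * (\<bar>t\<bar> ^ 3 / 6 * (\<eta> n / s n) ^ 3)" using main by (intro mult_left_mono) auto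
    finally show ?case by (simp only: ac_simps)
  qed
  moreover have "(\<lambda>n. \<bar>t\<bar> ^ 3 / 6 * (n * (\<eta> n / s n) ^ 3)) \<longlonglongrightarrow> 0"
    using tendsto_mult_right_zero[OF third] by simp
  ultimately have "(\<lambda>n. of_nat n * (char (M n) (t / s n) - 1) - T n) \<longlonglongrightarrow> 0"
    by (rule Lim_null_comparison)
  from tendsto_add[OF this T]
  show "(\<lambda>n. of_nat n * (char (M n) (t / s n) - 1)) \<longlonglongrightarrow> \<i> * of_real (m * t) - of_real (v * t\<^sup>2 / 2)" by simp
qed

lemma char_affine:
  fixes N :: "'a measure"
  assumes "f \<in> borel_measurable N"
  shows "char (distr N borel (\<lambda>x. (f x - a) / s)) t = iexp (- (t / s * a)) * char (distr N borel f) (t / s)"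
proof -
  have "char (distr N borel (\<lambda>x. (f x - a) / s)) t = (\<integral>x. iexp (t * ((f x - a) / s)) \<partial>N)"
    unfolding char_def using assms by (subst integral_distr) auto
  also have "\<dots> = (\<integral>x. iexp (- (t / s * a)) * iexp (t / s * f x) \<partial>N)"
    by (intro Bochner_Integration.integral_cong refl)
      (simp add: exp_add[symmetric] diff_divide_distrib algebra_simps)
  also have "\<dots> = iexp (- (t / s * a)) * char (distr N borel f) (t / s)"
    unfolding char_def using assms by (subst integral_distr) auto
  finally show ?thesis .
qed

lemma norm_iexp_diff: "norm (iexp x - iexp y) \<le> \<bar>x - y\<bar>"
proof -
  have "iexp x - iexp y = iexp y * (iexp (x - y) - 1)"
    by (simp add: algebra_simps flip: exp_add)
  then have "norm (iexp x - iexp y) = norm (iexp (x - y) - 1)"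
    by (simp add: norm_mult)
  also have "\<dots> \<le> \<bar>x - y\<bar>" using iexp_approx1[of "x - y" 0] by simp
  finally show ?thesis .
qed

text \<open>Where the two variables are within \<open>C\<close>, use that \<open>e\<^bsup>ix\<^esup>\<close> is Lipschitz; elsewhere it is bounded.\<close>

lemma (in prob_space) char_close:
  assumes [measurable]: "f \<in> borel_measurable M" "g \<in> borel_measurable M"
    and "prob {x \<in> space M. C < \<bar>f x - g x\<bar>} \<le> \<epsilon>" "0 \<le> C"
  shows "norm (char (distr M borel f) t - char (distr M borel g) t) \<le> \<bar>t\<bar> * C + 2 * \<epsilon>"
proof -
  let ?A = "{x \<in> space M. C < \<bar>f x - g x\<bar>}"
  have int: "integrable M (\<lambda>x. iexp (t * f x))" "integrable M (\<lambda>x. iexp (t * g x))"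
    by (intro integrable_const_bound[of _ 1]; simp)+
  have "char (distr M borel f) t - char (distr M borel g) t = (\<integral>x. iexp (t * f x) - iexp (t * g x) \<partial>M)"
    unfolding char_def using int by (simp add: integral_distr)
  also have "norm \<dots> \<le> (\<integral>x. norm (iexp (t * f x) - iexp (t * g x)) \<partial>M)"
    by (rule integral_norm_bound)
  also have "\<dots> \<le> (\<integral>x. \<bar>t\<bar> * C + 2 * indicator ?A x \<partial>M)"
  proof (rule integral_mono)
    show "integrable M (\<lambda>x. norm (iexp (t * f x) - iexp (t * g x)))"
      using int by (intro integrable_norm Bochner_Integration.integrable_diff)
    show "integrable M (\<lambda>x. \<bar>t\<bar> * C + 2 * indicator ?A x)"
      by (intro Bochner_Integration.integrable_add integrable_mult_right) (auto simp: emeasure_eq_measure integrable_indicator_iff)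
    fix x assume x: "x \<in> space M"
    show "norm (iexp (t * f x) - iexp (t * g x)) \<le> \<bar>t\<bar> * C + 2 * indicator ?A x"
    proof (cases "x \<in> ?A")
      case True
      have "norm (iexp (t * f x) - iexp (t * g x)) \<le> norm (iexp (t * f x)) + norm (iexp (t * g x))"
        by (rule norm_triangle_ineq4)
      also have "\<dots> = 2" by simp
      finally show ?thesis using True assms(4) by (simp add: add_increasing)
    next
      case False
      have "norm (iexp (t * f x) - iexp (t * g x)) \<le> \<bar>t * f x - t * g x\<bar>" by (rule norm_iexp_diff)
      also have "\<dots> = \<bar>t\<bar> * \<bar>f x - g x\<bar>" by (simp add: abs_mult flip: right_diff_distrib)
      also have "\<dots> \<le> \<bar>t\<bar> * C" using False x by (intro mult_left_mono) auto
      finally show ?thesis using False by simp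
    qed
  qed
  also have "\<dots> = \<bar>t\<bar> * C + 2 * prob ?A"
    by (subst Bochner_Integration.integral_add) (auto simp: prob_space integrable_indicator_iff emeasure_eq_measure)
  finally show ?thesis using assms(3) by linarith
qed

lemma real_distribution_normal:
  assumes "0 < v"
  shows "real_distribution (normal_distribution \<mu> v)"
  unfolding normal_distribution_def real_distribution_def real_distribution_axioms_def
  using prob_space_normal_density[of "sqrt v"] assms by simp

lemma char_normal:
  assumes "0 < v"
  shows "char (normal_distribution \<mu> v) t = exp (\<i> * of_real (\<mu> * t) - of_real (v * t\<^sup>2 / 2))"
proof -
  let ?s = "sqrt v"
  interpret N: real_distribution std_normal_distribution by (rule real_dist_normal_dist)
  have "distributed std_normal_distribution lborel (\<lambda>x. x) std_normal_density"
    unfolding distributed_def by (auto simp: distr_id2)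
  then have "distributed std_normal_distribution lborel (\<lambda>x. \<mu> + ?s * x) (normal_density \<mu> ?s)"
    using N.normal_density_affine[of "\<lambda>x. x" 0 1 ?s \<mu>] assms by simp
  then have "normal_distribution \<mu> v = distr std_normal_distribution lborel (\<lambda>x. \<mu> + ?s * x)"
    unfolding distributed_def normal_distribution_def by simp
  also have "\<dots> = distr std_normal_distribution borel (\<lambda>x. (x - (- \<mu> / ?s)) / (1 / ?s))"
    using assms by (intro distr_cong) (auto simp: field_simps)
  finally have "char (normal_distribution \<mu> v) t
    = iexp (- (t / (1 / ?s) * (- \<mu> / ?s))) * char (distr std_normal_distribution borel (\<lambda>x. x)) (t / (1 / ?s))"
    using char_affine[of "\<lambda>x. x" std_normal_distribution "- \<mu> / ?s" "1 / ?s" t] by (simp only:) simp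
  also have "distr std_normal_distribution borel (\<lambda>x. x) = std_normal_distribution"
    by (rule distr_id2) simp
  also have "iexp (- (t / (1 / ?s) * (- \<mu> / ?s))) * char std_normal_distribution (t / (1 / ?s))
      = exp (\<i> * of_real (\<mu> * t)) * exp (of_real (- (v * t\<^sup>2 / 2)))"
  proof -
    have "(complex_of_real (sqrt v))\<^sup>2 = of_real v" using assms by (simp flip: of_real_power)
    then show ?thesis
      using assms by (simp add: char_std_normal_distribution power_mult_distrib mult.commute exp_of_real[symmetric])
  qed
  also have "\<dots> = exp (\<i> * of_real (\<mu> * t) - of_real (v * t\<^sup>2 / 2))"
    by (simp flip: exp_add)
  finally show ?thesis .
qed

section \<open>The limit theorem\<close>

text \<open>The complement of the support is a union of open null sets, and by Lindelof a countable one.\<close>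

lemma compact_measure_support_bounded:
  assumes "sets \<nu> = sets borel_half_line" "compact (measure_support \<nu>)"
  shows "\<exists>R>0. AE x in \<nu>. 0 \<le> x \<and> x \<le> R"
proof -
  have sp: "space \<nu> = {0..}" using sets_eq_imp_space_eq[OF assms(1)] by (simp add: space_restrict_space)
  obtain R where R: "0 < R" "\<And>x. x \<in> measure_support \<nu> \<Longrightarrow> \<bar>x\<bar> \<le> R"
    using compact_imp_bounded[OF assms(2)] unfolding bounded_pos by auto
  define \<U> where "\<U> = {U :: real set. open U \<and> emeasure \<nu> (U \<inter> space \<nu>) = 0}"
  have meas: "U \<inter> space \<nu> \<in> sets \<nu>" if "open U" for U
  proof -
    have "U \<inter> {0..} = {0..} \<inter> U" by blast
    then show ?thesis using that unfolding assms(1) sp sets_restrict_space by auto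
  qed
  obtain \<V> where \<V>: "\<V> \<subseteq> \<U>" "countable \<V>" "\<Union>\<V> = \<Union>\<U>"
    using Lindelof[of \<U>] by (auto simp: \<U>_def)
  have "(\<Union>U\<in>\<V>. U \<inter> space \<nu>) \<in> null_sets \<nu>"
    using \<V>(1,2) meas by (intro null_sets_UN') (auto simp: \<U>_def null_sets_def)
  then have "AE x in \<nu>. x \<notin> (\<Union>U\<in>\<V>. U \<inter> space \<nu>)" by (rule AE_not_in)
  then have "AE x in \<nu>. 0 \<le> x \<and> x \<le> R" using AE_space
  proof eventually_elim
    case (elim x)
    then have "x \<notin> \<Union>\<U>" using \<V>(3) by blast
    then have "x \<in> measure_support \<nu>"
      using elim(2) by (auto simp: measure_support_def \<U>_def zero_less_iff_neq_zero)
    then show ?case using R(2)[of x] elim(2) sp by auto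
  qed
  then show ?thesis using R(1) by blast
qed

lemma second_moment_pos:
  assumes "prob_space \<nu>" "sets \<nu> = sets borel_half_line" "\<nu> \<noteq> return borel_half_line 0"
    and R: "AE x in \<nu>. 0 \<le> x \<and> x \<le> R"
  shows "0 < moment \<nu> 2"
proof -
  interpret prob_space \<nu> by fact
  have [measurable_cong]: "sets \<nu> = sets borel_half_line" by fact
  have int: "integrable \<nu> (\<lambda>x. x\<^sup>2)"
  proof (rule integrable_const_bound[of _ "R\<^sup>2"])
    show "AE x in \<nu>. norm (x\<^sup>2) \<le> R\<^sup>2" using R by eventually_elim (auto intro: power_mono)
    have "(\<lambda>x. x\<^sup>2) \<in> borel_measurable borel_half_line" by (rule measurable_restrict_space1) simp
    then show "(\<lambda>x. x\<^sup>2) \<in> borel_measurable \<nu>" using measurable_cong_sets[OF assms(2) refl] by blast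
  qed
  have "0 \<le> moment \<nu> 2" unfolding moment_def by simp
  moreover have "moment \<nu> 2 \<noteq> 0"
  proof
    assume "moment \<nu> 2 = 0"
    then have "AE x in \<nu>. x\<^sup>2 = 0"
      using integral_nonneg_eq_0_iff_AE[OF int] by (simp add: moment_def)
    then have "AE x in \<nu>. x = 0" by eventually_elim simp
    then have "distr \<nu> borel_half_line (\<lambda>x. x) = distr \<nu> borel_half_line (\<lambda>x. 0)"
      by (intro distr_cong_AE) auto
    then have "\<nu> = return borel_half_line 0"
      using assms(2) by (simp add: distr_id2 space_restrict_space)
    then show False using assms(3) by simp
  qed
  ultimately show ?thesis by simp
qed

text \<open>One walk of the theorem for each \<open>n\<close>, with steps compressed by \<open>n\<^bsup>-r\<^esup>\<close>.\<close>

locale compressed_walks =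
  fixes F :: base_field and k :: nat and r :: real and \<nu> :: "real measure"
    and P :: "nat \<Rightarrow> 'w measure" and S :: "nat \<Rightarrow> nat \<Rightarrow> 'w \<Rightarrow> 'n::{finite,linorder} qmat set"
  assumes dim: "2 \<le> k" "CARD('n) = k + 1"
    and \<nu>: "prob_space \<nu>" "sets \<nu> = sets borel_half_line"
    and \<nu>_compact: "compact (measure_support \<nu>)"
    and r: "0 < r"
    and walk: "\<And>n. 1 \<le> n \<Longrightarrow> radial_random_walk F (P n) (S n)"
    and assoc: "\<And>n. 1 \<le> n \<Longrightarrow> associated_with F (P n) (S n) (compress (n powr (- r)) \<nu>)"
begin

lemma card: "3 \<le> CARD('n)" using dim by simp

definition d :: real where "d = real (dim (scalars F))"

definition \<kappa> :: "nat \<Rightarrow> 'n qmat set \<Rightarrow> 'n qmat set measure" where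
  "\<kappa> n = (SOME \<kappa>. invariant_kernel F \<kappa> \<and> markov_chain (P n) (hyp_borel F) \<kappa> (hyp_origin F) (S n))"

lemma radial_walk_n:
  assumes "1 \<le> n"
  shows "radial_walk F (P n) (S n) (\<kappa> n)"
proof -
  have "invariant_kernel F (\<kappa> n) \<and> markov_chain (P n) (hyp_borel F) (\<kappa> n) (hyp_origin F) (S n)"
    unfolding \<kappa>_def using walk[OF assms] unfolding radial_random_walk_def by (rule someI_ex)
  then show ?thesis using card by (intro radial_walk.intro) auto
qed

abbreviation h :: "'n qmat set \<Rightarrow> real" where "h X \<equiv> hyp_dist F X (hyp_origin F)"

definition step :: "nat \<Rightarrow> 'n qmat set measure" where
  "step n = radial_walk.law F (P n) (S n) (Suc 0)"

lemma rotation_invariant_step: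
  assumes "1 \<le> n"
  shows "rotation_invariant_law (step n) F k"
proof -
  interpret radial_walk F "P n" "S n" "\<kappa> n" by (rule radial_walk_n[OF assms])
  show ?thesis
    unfolding step_def rotation_invariant_law_def rotation_invariant_law_axioms_def
    using prob_space_law dim law_rotation_invariant by auto
qed

lemma measurable_h [measurable]: "h \<in> borel_measurable (hyp_borel F)"
  by (rule measurable_hyp_dist_origin[OF card])

lemma step_h:
  assumes n: "1 \<le> n"
  shows "distr (step n) borel_half_line h = distr \<nu> borel_half_line (\<lambda>x. n powr (- r) * x)"
proof -
  interpret radial_walk F "P n" "S n" "\<kappa> n" by (rule radial_walk_n[OF n])
  show ?thesis using step_distance[OF assoc[OF n]] by (simp add: step_def compress_def)
qed

lemma measurable_h_half_line:
  assumes "1 \<le> n"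
  shows "h \<in> measurable (step n) borel_half_line" "(\<lambda>x. n powr (- r) * x) \<in> measurable \<nu> borel_half_line"
proof -
  interpret L: rotation_invariant_law "step n" F k by (rule rotation_invariant_step[OF assms])
  show "h \<in> measurable (step n) borel_half_line"
    using L.h_nonneg by (intro measurable_restrict_space2) auto
  have "(\<lambda>x. x) \<in> borel_measurable borel_half_line" by (rule measurable_restrict_space1) simp
  then have "(\<lambda>x. x) \<in> borel_measurable \<nu>" using measurable_cong_sets[OF \<nu>(2) refl] by blast
  then show "(\<lambda>x. n powr (- r) * x) \<in> measurable \<nu> borel_half_line"
    using sets_eq_imp_space_eq[OF \<nu>(2)] by (intro measurable_restrict_space2) (auto simp: space_restrict_space)
qed

lemma step_moment:
  assumes n: "1 \<le> n"
  shows "(\<integral>X. h X ^ m \<partial>step n) = n powr (- (m * r)) * moment \<nu> m"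
proof -
  have b: "(\<lambda>x :: real. x ^ m) \<in> borel_measurable borel_half_line"
    by (rule measurable_restrict_space1) simp
  have "(\<integral>X. h X ^ m \<partial>step n) = (\<integral>x. x ^ m \<partial>distr (step n) borel_half_line h)"
    by (rule integral_distr[OF measurable_h_half_line(1)[OF n] b, symmetric])
  also have "\<dots> = (\<integral>x. (n powr (- r) * x) ^ m \<partial>\<nu>)"
    unfolding step_h[OF n] by (rule integral_distr[OF measurable_h_half_line(2)[OF n] b])
  also have "\<dots> = (n powr (- r)) ^ m * moment \<nu> m"
    by (simp add: power_mult_distrib moment_def)
  also have "(n powr (- r)) ^ m = n powr (- (m * r))"
    using n by (subst powr_power) (auto simp: mult.commute)
  finally show ?thesis .
qed

lemma step_bounded:
  assumes n: "1 \<le> n" and R: "AE x in \<nu>. 0 \<le> x \<and> x \<le> R"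
  shows "AE X in step n. h X \<le> R * n powr (- r)"
proof -
  let ?c = "n powr (- r)"
  have m: "{x \<in> space borel_half_line. x \<le> R * ?c} \<in> sets borel_half_line"
    by (auto simp: sets_restrict_space space_restrict_space)
  have "AE x in \<nu>. ?c * x \<le> R * ?c"
    using R by eventually_elim (simp add: mult.commute mult_right_mono)
  then have "AE x in distr \<nu> borel_half_line (\<lambda>x. ?c * x). x \<le> R * ?c"
    using AE_distr_iff[OF measurable_h_half_line(2)[OF n] m] by simp
  then have "AE x in distr (step n) borel_half_line h. x \<le> R * ?c" by (simp only: step_h[OF n])
  then show ?thesis using AE_distr_iff[OF measurable_h_half_line(1)[OF n] m] by simp
qed

abbreviation (input) \<beta> :: "nat \<Rightarrow> real" where
  "\<beta> n \<equiv> drift_coeff d k * moment \<nu> 2 * n powr (- 2 * r)"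

text \<open>The law of one increment after removing the leading term \<open>\<beta> n\<close> of its mean; \<open>n \<beta>\<^sub>n\<close> is the centring of
  the theorem. The value for \<open>n = 0\<close> is an arbitrary probability measure on the real line.\<close>

definition centred_step :: "nat \<Rightarrow> real measure" where
  "centred_step n = (if n = 0 then return borel 0 else distr (step n) borel (\<lambda>X. busemann X - \<beta> n))"

lemma real_distribution_centred_step: "real_distribution (centred_step n)"
proof (cases "n = 0")
  case True
  then show ?thesis
    by (auto simp: centred_step_def real_distribution_def real_distribution_axioms_def intro: prob_space_return)
next
  case False
  then interpret L: rotation_invariant_law "step n" F k by (intro rotation_invariant_step) simp
  have "prob_space (distr (step n) borel (\<lambda>X. busemann X - \<beta> n))"
    by (rule L.prob_space_distr) simp
  then show ?thesis
    using False by (auto simp: centred_step_def real_distribution_def real_distribution_axioms_def)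
qed

lemma char_busemann_centred:
  assumes n: "1 \<le> n"
  shows "char (distr (radial_walk.law F (P n) (S n) n) borel (\<lambda>X. (busemann X - n * \<beta> n) / s)) t
    = char (centred_step n) (t / s) ^ n"
proof -
  interpret W: radial_walk F "P n" "S n" "\<kappa> n" by (rule radial_walk_n[OF n])
  have step: "step n = W.law (Suc 0)" by (simp add: step_def)
  have "char (distr (W.law n) borel (\<lambda>X. (busemann X - n * \<beta> n) / s)) t
      = iexp (- (t / s * (n * \<beta> n))) * char (W.busemann_law n) (t / s)"
    unfolding W.busemann_law_def by (rule char_affine) simp
  also have "\<dots> = (iexp (- (t / s * \<beta> n)) * char (W.busemann_law (Suc 0)) (t / s)) ^ n"
    unfolding W.char_busemann_law[of n] power_mult_distrib
    by (simp add: mult.assoc mult.left_commute flip: exp_of_nat_mult)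
  also have "iexp (- (t / s * \<beta> n)) * char (W.busemann_law (Suc 0)) (t / s)
      = char (distr (step n) borel (\<lambda>X. (busemann X - \<beta> n) / 1)) (t / s)"
    unfolding W.busemann_law_def step by (subst char_affine) simp_all
  also have "\<dots> = char (centred_step n) (t / s)" using n by (simp add: centred_step_def)
  finally show ?thesis .
qed

lemma powr_neg_tendsto_0: "a < 0 \<Longrightarrow> (\<lambda>n. C * real n powr a) \<longlonglongrightarrow> 0"
  by (intro tendsto_mult_right_zero tendsto_neg_powr filterlim_real_sequentially) auto

text \<open>The support of \<open>\<nu>\<close> is bounded, so a step has length at most a constant times \<open>n\<^bsup>-r\<^esup>\<close>, and the uniform
  remainders of \<open>busemann_step_moments\<close> become powers of \<open>n\<^bsup>-r\<^esup>\<close>.\<close>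

lemma centred_step_estimates:
  obtains C where "0 \<le> C" "\<forall>\<^sub>F n in sequentially.
      (AE x in centred_step n. \<bar>x\<bar> \<le> C * n powr (- r)) \<and>
      \<bar>(\<integral>x. x \<partial>centred_step n) - bias_coeff d k * moment \<nu> 4 * n powr (- 4 * r)\<bar> \<le> C * n powr (- 5 * r) \<and>
      \<bar>(\<integral>x. x\<^sup>2 \<partial>centred_step n) - moment \<nu> 2 / (d * k) * n powr (- 2 * r)\<bar> \<le> C * n powr (- 3 * r)"
proof -
  obtain R where R: "0 < R" "AE x in \<nu>. 0 \<le> x \<and> x \<le> R"
    using compact_measure_support_bounded[OF \<nu>(2) \<nu>_compact] by blast
  obtain C0 \<delta> where C0: "0 \<le> C0" "0 < \<delta>"
    "\<forall>(\<mu> :: 'n qmat set measure) \<eta>.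
      rotation_invariant_law \<mu> F k \<longrightarrow> 0 < \<eta> \<longrightarrow> \<eta> \<le> \<delta> \<longrightarrow> (AE X in \<mu>. h X \<le> \<eta>) \<longrightarrow>
      \<bar>(\<integral>X. busemann X \<partial>\<mu>) - (drift_coeff d k * (\<integral>X. (h X)\<^sup>2 \<partial>\<mu>) + bias_coeff d k * (\<integral>X. (h X) ^ 4 \<partial>\<mu>))\<bar> \<le> C0 * \<eta> ^ 5 \<and>
      \<bar>(\<integral>X. (busemann X)\<^sup>2 \<partial>\<mu>) - (\<integral>X. (h X)\<^sup>2 \<partial>\<mu>) / (d * k)\<bar> \<le> C0 * \<eta> ^ 3"
    using busemann_step_moments[of F k] unfolding d_def by blast
  define B where "B = drift_coeff d k * moment \<nu> 2"
  define C where "C = R + \<bar>B\<bar> + C0 * R ^ 5 + C0 * R ^ 3 + 2 * \<bar>B\<bar> * R + B\<^sup>2"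
  have C_ge: "R + \<bar>B\<bar> \<le> C" "C0 * R ^ 5 \<le> C" "C0 * R ^ 3 + 2 * \<bar>B\<bar> * R + B\<^sup>2 \<le> C" "0 \<le> C"
    unfolding C_def using R(1) C0(1) by (simp_all add: add_nonneg_nonneg)
  have "(\<lambda>n. R * real n powr (- r)) \<longlonglongrightarrow> 0" using r by (intro powr_neg_tendsto_0) simp
  then have "\<forall>\<^sub>F n in sequentially. R * real n powr (- r) < \<delta>" using C0(2) by (rule order_tendstoD)
  then have "\<forall>\<^sub>F n in sequentially.
      (AE x in centred_step n. \<bar>x\<bar> \<le> C * n powr (- r)) \<and>
      \<bar>(\<integral>x. x \<partial>centred_step n) - bias_coeff d k * moment \<nu> 4 * n powr (- 4 * r)\<bar> \<le> C * n powr (- 5 * r) \<and>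
      \<bar>(\<integral>x. x\<^sup>2 \<partial>centred_step n) - moment \<nu> 2 / (d * k) * n powr (- 2 * r)\<bar> \<le> C * n powr (- 3 * r)"
    using eventually_ge_at_top[of 1]
  proof eventually_elim
    case (elim n)
    then have n: "1 \<le> n" by simp
    interpret L: rotation_invariant_law "step n" F k by (rule rotation_invariant_step[OF n])
    define c where "c = real n powr (- r)"
    have c: "0 < c" "c \<le> 1" using n r by (auto simp: c_def powr_le_one_le ge_one_powr_ge_zero powr_minus_divide)
    have cp: "c ^ m = n powr (- (m * r))" for m
      unfolding c_def using n by (subst powr_power) (auto simp: mult.commute)
    have small: "AE X in step n. h X \<le> R * c" unfolding c_def by (rule step_bounded[OF n R(2)])
    have bc: "\<beta> n = B * c ^ 2" by (simp add: cp B_def)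
    have mom: "\<bar>(\<integral>X. busemann X \<partial>step n) - (drift_coeff d k * (\<integral>X. (h X)\<^sup>2 \<partial>step n) + bias_coeff d k * (\<integral>X. (h X) ^ 4 \<partial>step n))\<bar> \<le> C0 * (R * c) ^ 5"
      "\<bar>(\<integral>X. (busemann X)\<^sup>2 \<partial>step n) - (\<integral>X. (h X)\<^sup>2 \<partial>step n) / (d * k)\<bar> \<le> C0 * (R * c) ^ 3"
      using C0(3)[rule_format, OF rotation_invariant_step[OF n] _ _ small] R(1) c elim by (auto simp: c_def)
    have AEb: "AE X in step n. \<bar>busemann X\<bar> \<le> R * c" using small AE_space
      by eventually_elim (use dist_minus_busemann(2)[OF card] in force)
    have mb: "busemann \<in> borel_measurable (step n)" by simp
    have int_b: "integrable (step n) busemann"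
      using AEb by (intro L.integrable_const_bound[of _ "R * c"]) auto
    have int_b2: "integrable (step n) (\<lambda>X. (busemann X)\<^sup>2)"
    proof (rule L.integrable_const_bound[of _ "(R * c)\<^sup>2"])
      show "AE X in step n. norm ((busemann X)\<^sup>2) \<le> (R * c)\<^sup>2"
        using AEb by eventually_elim (metis abs_ge_zero norm_power power_mono real_norm_def)
    qed simp
    let ?e = "\<integral>X. busemann X \<partial>step n"
    have M: "centred_step n = distr (step n) borel (\<lambda>X. busemann X - \<beta> n)" using n by (simp add: centred_step_def)
    have mean: "(\<integral>x. x \<partial>centred_step n) = ?e - \<beta> n"
      unfolding M using int_b L.prob_space by (subst integral_distr) auto
    have square: "(\<integral>x. x\<^sup>2 \<partial>centred_step n) = (\<integral>X. (busemann X)\<^sup>2 \<partial>step n) - 2 * \<beta> n * ?e + (\<beta> n)\<^sup>2"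
    proof -
      have "(\<integral>x. x\<^sup>2 \<partial>centred_step n) = (\<integral>X. (busemann X)\<^sup>2 - 2 * \<beta> n * busemann X + (\<beta> n)\<^sup>2 \<partial>step n)"
        unfolding M by (subst integral_distr) (auto simp: power2_diff algebra_simps)
      then show ?thesis using int_b int_b2 L.prob_space by simp
    qed
    have h2: "(\<integral>X. (h X)\<^sup>2 \<partial>step n) = c ^ 2 * moment \<nu> 2" "(\<integral>X. (h X) ^ 4 \<partial>step n) = c ^ 4 * moment \<nu> 4"
      using step_moment[OF n, of 2] step_moment[OF n, of 4] cp[of 2] cp[of 4] by simp_all
    have e: "\<bar>?e\<bar> \<le> R * c" using L.abs_expectation_le[OF mb AEb] .
    have c43: "c ^ 4 \<le> c ^ 3" using c by (intro power_decreasing) auto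
    have c21: "c\<^sup>2 \<le> c" using c by (simp add: power2_eq_square mult_left_le)
    have 1: "AE x in centred_step n. \<bar>x\<bar> \<le> C * c"
      unfolding M
    proof (subst AE_distr_iff)
      show "AE X in step n. \<bar>busemann X - \<beta> n\<bar> \<le> C * c" using AEb
      proof eventually_elim
        case (elim X)
        have "\<bar>busemann X - \<beta> n\<bar> \<le> R * c + \<bar>B\<bar> * c ^ 2"
          using elim unfolding bc by (simp add: abs_mult order_trans[OF abs_triangle_ineq4] add_mono)
        also have "\<dots> \<le> R * c + \<bar>B\<bar> * c" using c21 by (intro add_left_mono mult_left_mono) auto
        also have "\<dots> = (R + \<bar>B\<bar>) * c" by (simp add: distrib_right)
        also have "\<dots> \<le> C * c" using C_ge(1) c by (intro mult_right_mono) auto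
        finally show ?case .
      qed
    qed auto
    have 2: "\<bar>(\<integral>x. x \<partial>centred_step n) - bias_coeff d k * moment \<nu> 4 * c ^ 4\<bar> \<le> C * c ^ 5"
    proof -
      have "(\<integral>x. x \<partial>centred_step n) - bias_coeff d k * moment \<nu> 4 * c ^ 4
        = ?e - (drift_coeff d k * (c ^ 2 * moment \<nu> 2) + bias_coeff d k * (c ^ 4 * moment \<nu> 4))"
        unfolding mean bc B_def by (simp add: algebra_simps)
      then have "\<bar>(\<integral>x. x \<partial>centred_step n) - bias_coeff d k * moment \<nu> 4 * c ^ 4\<bar> \<le> C0 * (R * c) ^ 5"
        using mom(1) by (simp only: h2)
      also have "\<dots> = (C0 * R ^ 5) * c ^ 5" by (simp add: power_mult_distrib)
      also have "\<dots> \<le> C * c ^ 5" using C_ge(2) c by (intro mult_right_mono) auto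
      finally show ?thesis .
    qed
    have 3: "\<bar>(\<integral>x. x\<^sup>2 \<partial>centred_step n) - moment \<nu> 2 / (d * k) * c ^ 2\<bar> \<le> C * c ^ 3"
    proof -
      have A: "\<bar>(\<integral>X. (busemann X)\<^sup>2 \<partial>step n) - moment \<nu> 2 / (d * k) * c ^ 2\<bar> \<le> (C0 * R ^ 3) * c ^ 3"
        using mom(2) unfolding h2 by (simp add: power_mult_distrib mult_ac)
      have "\<bar>2 * \<beta> n * ?e\<bar> \<le> 2 * (\<bar>B\<bar> * c ^ 2) * (R * c)"
        unfolding abs_mult bc using e by (intro mult_mono) (auto simp: c less_imp_le)
      also have "\<dots> = 2 * \<bar>B\<bar> * R * c ^ 3" by (simp add: eval_nat_numeral)
      finally have Bd: "\<bar>2 * \<beta> n * ?e\<bar> \<le> 2 * \<bar>B\<bar> * R * c ^ 3" .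
      have "(\<beta> n)\<^sup>2 = B\<^sup>2 * c ^ 4" unfolding bc by (simp add: power_mult_distrib flip: power_mult)
      also have "\<dots> \<le> B\<^sup>2 * c ^ 3" using c43 by (intro mult_left_mono) auto
      finally have Cd: "(\<beta> n)\<^sup>2 \<le> B\<^sup>2 * c ^ 3" .
      have comb: "\<bar>x - y + z - w\<bar> \<le> a + b + e" if "\<bar>x - w\<bar> \<le> a" "\<bar>y\<bar> \<le> b" "0 \<le> z" "z \<le> e"
        for x y z w a b e :: real using that by linarith
      have "\<bar>(\<integral>x. x\<^sup>2 \<partial>centred_step n) - moment \<nu> 2 / (d * k) * c ^ 2\<bar>
        \<le> (C0 * R ^ 3) * c ^ 3 + 2 * \<bar>B\<bar> * R * c ^ 3 + B\<^sup>2 * c ^ 3"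
        unfolding square by (rule comb[OF A Bd _ Cd]) simp
      also have "\<dots> = (C0 * R ^ 3 + 2 * \<bar>B\<bar> * R + B\<^sup>2) * c ^ 3" by (simp only: distrib_right)
      also have "\<dots> \<le> C * c ^ 3" using C_ge(3) c by (intro mult_right_mono) auto
      finally show ?thesis .
    qed
    show ?case using 1 2 3 by (simp add: cp) (simp add: c_def)
  qed
  then show ?thesis using that[of C] C_ge(4) by blast
qed

text \<open>For the scaling \<open>n\<^sup>\<sigma>\<close>, the three inequalities make the remainders of mean and variance and the third
  moments of all \<open>n\<close> steps together negligible, while \<open>m\<close> and \<open>v\<close> are the limits of the main terms.\<close>

lemma char_centred_step_limit:
  assumes \<sigma>: "1 < 5 * r + \<sigma>" "1 < 3 * r + 2 * \<sigma>" "1 < 3 * r + 3 * \<sigma>"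
    and m: "(\<lambda>n. bias_coeff d k * moment \<nu> 4 * n powr (1 - 4 * r - \<sigma>)) \<longlonglongrightarrow> m"
    and v: "(\<lambda>n. moment \<nu> 2 / (d * k) * n powr (1 - 2 * r - 2 * \<sigma>)) \<longlonglongrightarrow> v"
  shows "(\<lambda>n. char (centred_step n) (t / n powr \<sigma>) ^ n) \<longlonglongrightarrow> exp (\<i> * of_real (m * t) - of_real (v * t\<^sup>2 / 2))"
proof -
  obtain C where C: "0 \<le> C" and ev: "\<forall>\<^sub>F n in sequentially.
      (AE x in centred_step n. \<bar>x\<bar> \<le> C * n powr (- r)) \<and>
      \<bar>(\<integral>x. x \<partial>centred_step n) - bias_coeff d k * moment \<nu> 4 * n powr (- 4 * r)\<bar> \<le> C * n powr (- 5 * r) \<and>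
      \<bar>(\<integral>x. x\<^sup>2 \<partial>centred_step n) - moment \<nu> 2 / (d * k) * n powr (- 2 * r)\<bar> \<le> C * n powr (- 3 * r)"
    by (rule centred_step_estimates)
  have shift: "real n * x / n powr b = x * n powr (1 - b)" if "1 \<le> n" for n :: nat and x b
    using that by (simp add: powr_diff field_simps)
  show ?thesis
  proof (rule char_triangular[where \<eta> = "\<lambda>n. C * n powr (- r)"])
    show "real_distribution (centred_step n)" for n by (rule real_distribution_centred_step)
    show "\<forall>\<^sub>F n in sequentially. 0 < real n powr \<sigma> \<and> (AE x in centred_step n. \<bar>x\<bar> \<le> C * n powr (- r))"
      using ev eventually_ge_at_top[of 1] by eventually_elim auto
    show "(\<lambda>n. n * (\<integral>x. x \<partial>centred_step n) / n powr \<sigma>) \<longlonglongrightarrow> m"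
    proof -
      have "\<forall>\<^sub>F n in sequentially. norm (n * (\<integral>x. x \<partial>centred_step n) / n powr \<sigma>
        - bias_coeff d k * moment \<nu> 4 * n powr (1 - 4 * r - \<sigma>)) \<le> C * n powr (1 - 5 * r - \<sigma>)"
        using ev eventually_ge_at_top[of 1]
      proof eventually_elim
        case (elim n)
        have p: "n powr (- a * r) * n powr (1 - \<sigma>) = n powr (1 - a * r - \<sigma>)" for a
          by (simp add: powr_add[symmetric] algebra_simps)
        have "n * (\<integral>x. x \<partial>centred_step n) / n powr \<sigma> - bias_coeff d k * moment \<nu> 4 * n powr (1 - 4 * r - \<sigma>)
          = ((\<integral>x. x \<partial>centred_step n) - bias_coeff d k * moment \<nu> 4 * n powr (- 4 * r)) * n powr (1 - \<sigma>)"
          unfolding shift[OF elim(2)] left_diff_distrib mult.assoc p ..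
        also have "norm \<dots> \<le> (C * n powr (- 5 * r)) * n powr (1 - \<sigma>)"
          unfolding norm_mult using elim(1) by (intro mult_mono) auto
        also have "\<dots> = C * n powr (1 - 5 * r - \<sigma>)" unfolding mult.assoc p ..
        finally show ?case .
      qed
      then have "(\<lambda>n. n * (\<integral>x. x \<partial>centred_step n) / n powr \<sigma>
        - bias_coeff d k * moment \<nu> 4 * n powr (1 - 4 * r - \<sigma>)) \<longlonglongrightarrow> 0"
        by (rule Lim_null_comparison) (rule powr_neg_tendsto_0, use \<sigma> in simp)
      from tendsto_add[OF this m] show ?thesis by simp
    qed
    show "(\<lambda>n. n * (\<integral>x. x\<^sup>2 \<partial>centred_step n) / (n powr \<sigma>)\<^sup>2) \<longlonglongrightarrow> v"
    proof -
      have "\<forall>\<^sub>F n in sequentially. norm (n * (\<integral>x. x\<^sup>2 \<partial>centred_step n) / (n powr \<sigma>)\<^sup>2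
        - moment \<nu> 2 / (d * k) * n powr (1 - 2 * r - 2 * \<sigma>)) \<le> C * n powr (1 - 3 * r - 2 * \<sigma>)"
        using ev eventually_ge_at_top[of 1]
      proof eventually_elim
        case (elim n)
        have p: "n powr (- a * r) * n powr (1 - 2 * \<sigma>) = n powr (1 - a * r - 2 * \<sigma>)" for a
          by (simp add: powr_add[symmetric] algebra_simps)
        have sq: "(n powr \<sigma>)\<^sup>2 = n powr (2 * \<sigma>)"
          by (simp add: power2_eq_square powr_add[symmetric])
        have "n * (\<integral>x. x\<^sup>2 \<partial>centred_step n) / (n powr \<sigma>)\<^sup>2 - moment \<nu> 2 / (d * k) * n powr (1 - 2 * r - 2 * \<sigma>)
          = ((\<integral>x. x\<^sup>2 \<partial>centred_step n) - moment \<nu> 2 / (d * k) * n powr (- 2 * r)) * n powr (1 - 2 * \<sigma>)"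
          unfolding sq shift[OF elim(2)] left_diff_distrib mult.assoc p ..
        also have "norm \<dots> \<le> (C * n powr (- 3 * r)) * n powr (1 - 2 * \<sigma>)"
          unfolding norm_mult using elim(1) by (intro mult_mono) auto
        also have "\<dots> = C * n powr (1 - 3 * r - 2 * \<sigma>)" unfolding mult.assoc p ..
        finally show ?case .
      qed
      then have "(\<lambda>n. n * (\<integral>x. x\<^sup>2 \<partial>centred_step n) / (n powr \<sigma>)\<^sup>2
        - moment \<nu> 2 / (d * k) * n powr (1 - 2 * r - 2 * \<sigma>)) \<longlonglongrightarrow> 0"
        by (rule Lim_null_comparison) (rule powr_neg_tendsto_0, use \<sigma> in simp)
      from tendsto_add[OF this v] show ?thesis by simp
    qed
    show "(\<lambda>n. n * (C * n powr (- r) / n powr \<sigma>) ^ 3) \<longlonglongrightarrow> 0"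
    proof (rule Lim_transform_eventually)
      show "(\<lambda>n. C ^ 3 * n powr (1 - 3 * r - 3 * \<sigma>)) \<longlonglongrightarrow> 0"
        by (rule powr_neg_tendsto_0) (use \<sigma> in simp)
      show "\<forall>\<^sub>F n in sequentially. C ^ 3 * n powr (1 - 3 * r - 3 * \<sigma>) = n * (C * n powr (- r) / n powr \<sigma>) ^ 3"
        using eventually_ge_at_top[of 1]
      proof eventually_elim
        case (elim n)
        have "(C * n powr (- r) / n powr \<sigma>) ^ 3 = C ^ 3 * (n powr (- r - \<sigma>)) ^ 3"
          by (simp add: powr_diff power_mult_distrib power_divide)
        also have "(n powr (- r - \<sigma>)) ^ 3 = n powr (- 3 * r - 3 * \<sigma>)"
          using elim by (subst powr_power) (auto simp: algebra_simps)
        finally show ?case using elim by (simp add: powr_mult_base algebra_simps)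
      qed
    qed
  qed
qed

text \<open>The difference of distance and Busemann function is bounded in probability; as \<open>\<sigma> > 0\<close>, it vanishes
  after scaling.\<close>

lemma char_walk_limit:
  assumes \<sigma>: "0 < \<sigma>" "1 < 5 * r + \<sigma>" "1 < 3 * r + 2 * \<sigma>" "1 < 3 * r + 3 * \<sigma>"
    and m: "(\<lambda>n. bias_coeff d k * moment \<nu> 4 * n powr (1 - 4 * r - \<sigma>)) \<longlonglongrightarrow> m"
    and v: "(\<lambda>n. moment \<nu> 2 / (d * k) * n powr (1 - 2 * r - 2 * \<sigma>)) \<longlonglongrightarrow> v"
  shows "(\<lambda>n. char (distr (P n) borel (\<lambda>\<omega>. (h (S n n \<omega>) - drift_coeff d k * moment \<nu> 2 * n powr (1 - 2 * r)) / n powr \<sigma>)) t)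
    \<longlonglongrightarrow> exp (\<i> * of_real (m * t) - of_real (v * t\<^sup>2 / 2))"
proof -
  let ?c = "\<lambda>n. char (distr (P n) borel (\<lambda>\<omega>. (h (S n n \<omega>) - drift_coeff d k * moment \<nu> 2 * n powr (1 - 2 * r)) / n powr \<sigma>)) t"
  let ?d = "\<lambda>n. char (centred_step n) (t / n powr \<sigma>) ^ n"
  have "(\<lambda>n. ?c n - ?d n) \<longlonglongrightarrow> 0"
  proof (rule tendstoI)
    fix \<epsilon> :: real assume \<epsilon>: "0 < \<epsilon>"
    obtain C where C: "0 < C" and tight: "\<forall>(P :: 'w measure) (S :: nat \<Rightarrow> 'w \<Rightarrow> 'n qmat set) \<kappa> n.
      radial_walk F P S \<kappa> \<longrightarrow>
      measure (radial_walk.law F P S n) {X \<in> hyp_space F. C < \<bar>hyp_dist F X (hyp_origin F) - busemann X\<bar>} \<le> \<epsilon> / 4"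
      using dist_minus_busemann_tight[OF card, of "\<epsilon> / 4" F] \<epsilon> by auto
    have "(\<lambda>n. (\<bar>t\<bar> * C) * real n powr (- \<sigma>)) \<longlonglongrightarrow> 0" using \<sigma>(1) by (intro powr_neg_tendsto_0) simp
    then have "\<forall>\<^sub>F n in sequentially. (\<bar>t\<bar> * C) * real n powr (- \<sigma>) < \<epsilon> / 2"
      by (rule order_tendstoD) (use \<epsilon> in simp)
    then show "\<forall>\<^sub>F n in sequentially. dist (?c n - ?d n) 0 < \<epsilon>"
      using eventually_ge_at_top[of 1]
    proof eventually_elim
      case (elim n)
      interpret W: radial_walk F "P n" "S n" "\<kappa> n" by (rule radial_walk_n[OF elim(2)])
      interpret Ln: prob_space "W.law n" by (rule W.prob_space_law)
      let ?s = "real n powr \<sigma>"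
      have s: "0 < ?s" using elim by simp
      have mh: "h \<in> borel_measurable (W.law n)" "busemann \<in> borel_measurable (W.law n)" by simp_all
      have center: "drift_coeff d k * moment \<nu> 2 * n powr (1 - 2 * r) = n * \<beta> n"
        using elim(2) by (simp add: powr_mult_base)
      have c: "?c n = char (distr (W.law n) borel (\<lambda>X. (h X - n * \<beta> n) / ?s)) t"
        unfolding W.law_def center by (subst distr_distr) (auto simp: comp_def)
      have dn: "?d n = char (distr (W.law n) borel (\<lambda>X. (busemann X - n * \<beta> n) / ?s)) t"
        by (rule char_busemann_centred[OF elim(2), symmetric])
      have "\<bar>(h X - n * \<beta> n) / ?s - (busemann X - n * \<beta> n) / ?s\<bar> = \<bar>h X - busemann X\<bar> / ?s" for X
        using s by (simp add: abs_divide flip: diff_divide_distrib)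
      then have "{X \<in> space (W.law n). C / ?s < \<bar>(h X - n * \<beta> n) / ?s - (busemann X - n * \<beta> n) / ?s\<bar>}
        = {X \<in> hyp_space F. C < \<bar>h X - busemann X\<bar>}"
        using s by (simp add: divide_less_cancel)
      then have "Ln.prob {X \<in> space (W.law n). C / ?s < \<bar>(h X - n * \<beta> n) / ?s - (busemann X - n * \<beta> n) / ?s\<bar>} \<le> \<epsilon> / 4"
        using tight[rule_format, OF radial_walk_n[OF elim(2)], of n] by simp
      then have "norm (?c n - ?d n) \<le> \<bar>t\<bar> * (C / ?s) + 2 * (\<epsilon> / 4)"
        unfolding c dn by (rule Ln.char_close[rotated 2]) (use mh C s in auto)
      also have "\<bar>t\<bar> * (C / ?s) = (\<bar>t\<bar> * C) * real n powr (- \<sigma>)" by (simp add: powr_minus_divide)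
      finally show ?case using elim(1) by simp
    qed
  qed
  from tendsto_add[OF this char_centred_step_limit[OF \<sigma>(2-4) m v, of t]] show ?thesis by simp
qed

text \<open>The index is shifted because there is no walk for \<open>n = 0\<close>.\<close>

lemma weak_conv_walk:
  assumes \<sigma>: "0 < \<sigma>" "1 < 5 * r + \<sigma>" "1 < 3 * r + 2 * \<sigma>" "1 < 3 * r + 3 * \<sigma>"
    and m: "(\<lambda>n. bias_coeff d k * moment \<nu> 4 * n powr (1 - 4 * r - \<sigma>)) \<longlonglongrightarrow> m"
    and v: "(\<lambda>n. moment \<nu> 2 / (d * k) * n powr (1 - 2 * r - 2 * \<sigma>)) \<longlonglongrightarrow> v"
    and L: "real_distribution L" "\<And>t. char L t = exp (\<i> * of_real (m * t) - of_real (v * t\<^sup>2 / 2))"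
  defines "D \<equiv> \<lambda>n. distr (P n) borel (\<lambda>\<omega>. (h (S n n \<omega>) - drift_coeff d k * moment \<nu> 2 * n powr (1 - 2 * r)) / n powr \<sigma>)"
  shows "weak_conv_m (\<lambda>n. D (Suc n)) L" "real_distribution (D (Suc n))"
proof -
  show real: "real_distribution (D (Suc n))" for n
  proof -
    interpret W: radial_walk F "P (Suc n)" "S (Suc n)" "\<kappa> (Suc n)" by (rule radial_walk_n) simp
    have "(\<lambda>\<omega>. h (S (Suc n) (Suc n) \<omega>)) \<in> borel_measurable (P (Suc n))"
      by (rule measurable_compose[OF W.measurable_S measurable_h])
    then have "prob_space (D (Suc n))" unfolding D_def by (intro W.prob_space_distr) measurable
    then show ?thesis by (auto simp: D_def real_distribution_def real_distribution_axioms_def)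
  qed
  show "weak_conv_m (\<lambda>n. D (Suc n)) L"
  proof (rule levy_continuity)
    show "(\<lambda>n. char (D (Suc n)) t) \<longlonglongrightarrow> char L t" for t
      using LIMSEQ_Suc[OF char_walk_limit[OF \<sigma> m v, of t]] unfolding D_def L(2) .
  qed (use real L in auto)
qed

end

text \<open>With \<open>\<sigma> = 1/2 - r\<close> the variance of the scaled sum is constant, and its mean is \<open>M n\<^bsup>1/2-3r\<^esup>\<close>, which tends to
  \<open>0\<close> for \<open>r > 1/6\<close> and equals \<open>M\<close> for \<open>r = 1/6\<close>. With \<open>\<sigma> = 1 - 4r\<close> the mean is \<open>M\<close>, and the variance is of
  order \<open>n\<^bsup>6r-1\<^esup>\<close>, which tends to \<open>0\<close> for \<open>r < 1/6\<close>.\<close>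

theorem theorem1p3:
  fixes F :: base_field
    and k :: nat
    and d M r :: real
    and \<nu> :: "real measure"
    and P :: "nat \<Rightarrow> 'w measure"
    and S :: "nat \<Rightarrow> nat \<Rightarrow> 'w \<Rightarrow> 'n::{finite,linorder} qmat set"
    and X :: "nat \<Rightarrow> 'w \<Rightarrow> real"
  defines "d \<equiv> real (dim (scalars F))"
    and "M \<equiv> - ((d * (k + 1) / 2 - 1) * (d * (k + 3) / 2 - 2) * moment \<nu> 4
                 / (6 * d * k * (d * k / 2 + 1)))"
    and "X \<equiv> (\<lambda>n \<omega>. hyp_dist F (S n n \<omega>) (hyp_origin F)
                 - (d * (k + 1) / 2 - 1) * moment \<nu> 2 / (d * k) * n powr (1 - 2 * r))"
  assumes k: "2 \<le> k" "CARD('n) = k + 1"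
    and \<nu>: "prob_space \<nu>" "sets \<nu> = sets borel_half_line"
    and \<nu>_nontrivial: "\<nu> \<noteq> return borel_half_line 0"
    and \<nu>_compact: "compact (measure_support \<nu>)"
    and r: "0 < r" "r < 1 / 2"
    and walk: "\<And>n. 1 \<le> n \<Longrightarrow> radial_random_walk F (P n) (S n)"
    and assoc: "\<And>n. 1 \<le> n \<Longrightarrow> associated_with F (P n) (S n) (compress (n powr (- r)) \<nu>)"
  shows "(1 / 6 < r \<longrightarrow>
            weak_conv_m (\<lambda>n. distr (P n) borel (\<lambda>\<omega>. X n \<omega> / n powr (1 / 2 - r)))
              (normal_distribution 0 (moment \<nu> 2 / (d * k)))) \<and>
         (r = 1 / 6 \<longrightarrow>
            weak_conv_m (\<lambda>n. distr (P n) borel (\<lambda>\<omega>. X n \<omega> / n powr (1 / 2 - r)))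
              (normal_distribution M (moment \<nu> 2 / (d * k)))) \<and>
         (r < 1 / 6 \<longrightarrow>
            (\<forall>\<epsilon>>0. (\<lambda>n. measure (P n)
                        {\<omega> \<in> space (P n). \<epsilon> < \<bar>X n \<omega> / n powr (1 - 4 * r) - M\<bar>})
                     \<longlonglongrightarrow> 0))"
proof -
  interpret W: compressed_walks F k r \<nu> P S
    using k \<nu> \<nu>_compact r(1) walk assoc by (rule compressed_walks.intro)
  have dW: "W.d = d" by (simp add: W.d_def d_def)
  obtain R where R: "AE x in \<nu>. 0 \<le> x \<and> x \<le> R"
    using compact_measure_support_bounded[OF \<nu>(2) \<nu>_compact] by blast
  have m2: "0 < moment \<nu> 2" by (rule second_moment_pos[OF \<nu> \<nu>_nontrivial R])
  have "0 < d" unfolding d_def by (cases F) (simp_all add: dim_scalars del: scalars.simps)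
  then have v_pos: "0 < moment \<nu> 2 / (d * k)" using m2 k(1) by simp
  have M: "bias_coeff d k * moment \<nu> 4 = M"
    unfolding M_def bias_coeff_def by (simp add: add.commute)
  have X: "X n \<omega> = hyp_dist F (S n n \<omega>) (hyp_origin F) - drift_coeff W.d k * moment \<nu> 2 * n powr (1 - 2 * r)" for n \<omega>
    unfolding X_def dW drift_coeff_def by (simp add: add.commute)
  let ?v = "moment \<nu> 2 / (d * k)"
  let ?D = "\<lambda>\<sigma> n. distr (P n) borel (\<lambda>\<omega>. X n \<omega> / n powr \<sigma>)"
  have const: "(\<lambda>n. C * real n powr 0) \<longlonglongrightarrow> C" for C
    by (rule tendsto_eventually) (use eventually_gt_at_top[of 0] in \<open>eventually_elim; simp\<close>)
  have normal_limit: "weak_conv_m (?D (1 / 2 - r)) (normal_distribution m ?v)"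
    if "1 / 8 < r" and m: "(\<lambda>n. M * real n powr (1 / 2 - 3 * r)) \<longlonglongrightarrow> m" for m
  proof -
    have e: "1 - 4 * r - (1 / 2 - r) = 1 / 2 - 3 * r" "1 - 2 * r - 2 * (1 / 2 - r) = 0" by simp_all
    have "weak_conv_m (\<lambda>n. ?D (1 / 2 - r) (Suc n)) (normal_distribution m ?v)"
      unfolding X
      by (rule W.weak_conv_walk(1)[where m = m and v = ?v])
        (use that r v_pos m const[of ?v] in
          \<open>simp_all only: dW M e real_distribution_normal char_normal, simp_all\<close>)
    then show ?thesis unfolding weak_conv_m_def weak_conv_def by (auto intro: LIMSEQ_imp_Suc)
  qed
  have "weak_conv_m (?D (1 / 2 - r)) (normal_distribution 0 ?v)" if "1 / 6 < r"
    by (rule normal_limit) (use that W.powr_neg_tendsto_0[of "1 / 2 - 3 * r" M] in auto)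
  moreover have "weak_conv_m (?D (1 / 2 - r)) (normal_distribution M ?v)" if "r = 1 / 6"
  proof (rule normal_limit)
    have "1 / 2 - 3 * r = 0" using that by simp
    then show "(\<lambda>n. M * real n powr (1 / 2 - 3 * r)) \<longlonglongrightarrow> M" using const[of M] by metis
  qed (use that in simp)
  moreover have "(\<lambda>n. measure (P n) {\<omega> \<in> space (P n). \<epsilon> < \<bar>X n \<omega> / n powr (1 - 4 * r) - M\<bar>}) \<longlonglongrightarrow> 0"
    if r6: "r < 1 / 6" and \<epsilon>: "0 < \<epsilon>" for \<epsilon>
  proof -
    let ?A = "- cball M \<epsilon>"
    have L: "real_distribution (return borel M)"
      by (auto simp: real_distribution_def real_distribution_axioms_def intro: prob_space_return)
    have e: "1 - 4 * r - (1 - 4 * r) = 0" by simp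
    have v: "(\<lambda>n. ?v * real n powr (1 - 2 * r - 2 * (1 - 4 * r))) \<longlonglongrightarrow> 0"
      by (rule W.powr_neg_tendsto_0) (use r6 in simp)
    have char: "char (return borel M) t = exp (\<i> * of_real (M * t) - of_real (0 * t\<^sup>2 / 2))" for t
      by (simp add: char_def integral_return mult.commute)
    have lim: "weak_conv_m (\<lambda>n. ?D (1 - 4 * r) (Suc n)) (return borel M)"
      and D: "\<And>n. real_distribution (?D (1 - 4 * r) (Suc n))"
      unfolding X
      using W.weak_conv_walk[of "1 - 4 * r" M 0 "return borel M"] r6 r(1) L char v const[of M]
      unfolding dW M e by simp_all
    have "(\<lambda>n. measure (?D (1 - 4 * r) (Suc n)) ?A) \<longlonglongrightarrow> measure (return borel M) ?A"
    proof (rule weak_conv_imp_continuity_set_conv[OF D L lim])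
      \<comment> \<open>The frontier consists of \<open>M - \<epsilon>\<close> and \<open>M + \<epsilon>\<close>, so the limit does not charge it.\<close>
      show "emeasure (return borel M) (frontier ?A) = 0"
        using \<epsilon> by (simp add: frontier_complement frontier_cball indicator_def)
    qed simp
    also have "measure (return borel M) ?A = 0" using \<epsilon> by (simp add: measure_return)
    also have "(\<lambda>n. measure (?D (1 - 4 * r) (Suc n)) ?A)
      = (\<lambda>n. measure (P (Suc n)) {\<omega> \<in> space (P (Suc n)). \<epsilon> < \<bar>X (Suc n) \<omega> / Suc n powr (1 - 4 * r) - M\<bar>})"
    proof
      fix n
      interpret Q: radial_walk F "P (Suc n)" "S (Suc n)" "W.\<kappa> (Suc n)" by (rule W.radial_walk_n) simp
      have "(\<lambda>\<omega>. hyp_dist F (S (Suc n) (Suc n) \<omega>) (hyp_origin F)) \<in> borel_measurable (P (Suc n))"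
        by (rule measurable_compose[OF Q.measurable_S W.measurable_h])
      then have "(\<lambda>\<omega>. X (Suc n) \<omega> / Suc n powr (1 - 4 * r)) \<in> borel_measurable (P (Suc n))"
        unfolding X by measurable
      then have "measure (?D (1 - 4 * r) (Suc n)) ?A
        = measure (P (Suc n)) ((\<lambda>\<omega>. X (Suc n) \<omega> / Suc n powr (1 - 4 * r)) -` ?A \<inter> space (P (Suc n)))"
        by (intro measure_distr) auto
      also have "(\<lambda>\<omega>. X (Suc n) \<omega> / Suc n powr (1 - 4 * r)) -` ?A \<inter> space (P (Suc n))
        = {\<omega> \<in> space (P (Suc n)). \<epsilon> < \<bar>X (Suc n) \<omega> / Suc n powr (1 - 4 * r) - M\<bar>}"
        by (auto simp: dist_real_def abs_minus_commute)
      finally show "measure (?D (1 - 4 * r) (Suc n)) ?A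
        = measure (P (Suc n)) {\<omega> \<in> space (P (Suc n)). \<epsilon> < \<bar>X (Suc n) \<omega> / Suc n powr (1 - 4 * r) - M\<bar>}" .
    qed
    finally show ?thesis by (rule LIMSEQ_imp_Suc)
  qed
  ultimately show ?thesis by blast
qed

end
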